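(* (1) For $0<t\le1$, the Berger sphere $(\mathrm{SU}(2),h_t)$ admits an isometric embedding $\varphi_t\colon\mathrm{SU}(2)\to\mathbb{R}^7$ by first eigenfunctions of $-\Delta_{(d\mu_{h_t},\,h_{1/\sqrt6}^* )}$. Therefore, the map $\varphi_t$ is an inflated map with respect to $(d\mu_{h_t},h_t)$, and the metric $h_{1/\sqrt6}^*$ is a solution to the first-eigenvalue maximization problem associated with $(d\mu_{h_t},h_t)$. (2) For $t\ge1$, the tautological embedding $\varphi_0\colon\mathrm{SU}(2)\to\mathbb{R}^4$ is a common short map (that is, $\varphi_0^*h_{\mathbb{R}^4}\le h_t$) by first eigenfunctions of $-\Delta_{(d\mu_{h_t},h_\infty^* )}$ and satisfies $(h_\infty^*,\,h_t-\varphi_0^*h_{\mathbb{R}^4})\equiv0$. Therefore, $\varphi_0$ is an inflated map with respect to $(d\mu_{h_t},h_t)$, and the positive semidefinite metric $h_\infty^*$ is a solution to the first-eigenvalue maximization problem associated with $(d\mu_{h_t},h_t)$. (3) For $t=1$, the metrics $h_s^*$, $1/\sqrt6\le s\le\infty$, all provide solutions to the first-eigenvalue maximization problem associated with $(d\mu_{h_1},h_1)$.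
   Context: $\mathrm{SU}(2)$ is the set of matrices $A(\zeta_1,\zeta_2)=\begin{pmatrix}\zeta_1&-\overline{\zeta_2}\\ \zeta_2&\overline{\zeta_1}\end{pmatrix}$ with $|\zeta_1|^2+|\zeta_2|^2=1$. The real left-invariant one-forms $\sigma_1,\sigma_2,\sigma_3$ are given by $\sigma_1+i\sigma_2=i(\zeta_2\,d\zeta_1-\zeta_1\,d\zeta_2)$, $\sigma_3=-i(\overline{\zeta_1}\,d\zeta_1+\overline{\zeta_2}\,d\zeta_2)$, and $E_1,E_2,E_3$ are the dual left-invariant vector fields, $\sigma_a(E_b)=\delta_{ab}$. For $t>0$ the Berger metric is $h_t=\sigma_1^2+\sigma_2^2+t^2\sigma_3^2$, with volume element $d\mu_{h_t}$ and dual metric $h_t^*=E_1\otimes E_1+E_2\otimes E_2+t^{-2}E_3\otimes E_3$ on the cotangent bundle; put $h_\infty^*=E_1\otimes E_1+E_2\otimes E_2$. The tautological embedding $\varphi_0\colon\mathrm{SU}(2)\to\mathbb{C}^2=\mathbb{R}^4$ is $A(\zeta_1,\zeta_2)\mapsto(\zeta_1,\zeta_2)$. $h_{\mathbb{R}^N}$ is the Euclidean metric. On a compact manifold $M$ (connected, without boundary) with smooth volume element $d\mu$ and Riemannian metric $h$, put $d\mu_1=d\mu/\int_M d\mu$. $\mathcal{M}^*$ is the set of all smooth sections $g^*$ of $S^2TM$ that are positive semidefinite on $T^*M$ at every point; $(g^*,k)=g^{ij}k_{ij}$. The Bakry-Émery Laplacian $\Delta_{(d\mu,g^* )}$ is determined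 by $\int_M(\Delta_{(d\mu,g^* )}u)\,v\,d\mu=-\int_M g^*(du,dv)\,d\mu$ for all $u,v\in C^\infty(M)$. $\lambda_1(d\mu,g^* )=\inf\int_M g^*(du,du)\,d\mu\big/\int_M u^2\,d\mu$, the infimum over nonzero $C^1$-functions $u$ with $\int_M u\,d\mu=0$. First eigenfunctions of $-\Delta_{(d\mu,g^* )}$ are solutions $u$ of $-\Delta_{(d\mu,g^* )}u=\lambda_1(d\mu,g^* )u$; a map is "by first eigenfunctions" if every (real) component is such a function (zero allowed). The first-eigenvalue maximization problem associated with $(d\mu,h)$: over all nonzero $g^*\in\mathcal{M}^*$, maximize $\lambda_1(d\mu,g^* )\big/\int_M(g^*,h)\,d\mu_1$; a solution is a $g^*$ attaining the maximum. Let $l^2$ be the Hilbert space of square-summable real sequences with standard metric $h_{l^2}$ and norm $\|\cdot\|$. An inflated map with respect to $(d\mu,h)$ is a $C^\infty$-map $\varphi\colon M\to l^2$ that maximizes $\int_M\|\varphi\|^2\,d\mu_1$ among all $C^\infty$-maps $M\to l^2$ satisfying $\varphi^*h_{l^2}\le h$ and $\int_M\varphi\,d\mu_1=0$. Maps into $\mathbb{R}^N$ are regarded as maps into $l^2$ via a standard linear isometric inclusion. *)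

theory Defs
  imports "HOL-Analysis.Analysis"
begin

section \<open>The Hilbert space of square-summable sequences\<close>

typedef l2 = "{f :: nat \<Rightarrow> real. summable (\<lambda>n. (f n)\<^sup>2)}"
  morphisms l2_nth Abs_l2
  by (rule exI[of _ "\<lambda>_. 0"]) simp

setup_lifting type_definition_l2

lemma l2_summable [simp]: "summable (\<lambda>n. (l2_nth x n)\<^sup>2)"
  using l2_nth by simp

lemma l2_eqI: "(\<And>n. l2_nth x n = l2_nth y n) \<Longrightarrow> x = y"
  by (metis ext l2_nth_inject)

lemma square_summable_mult:
  fixes f g :: "nat \<Rightarrow> real"
  assumes "summable (\<lambda>n. (f n)\<^sup>2)" "summable (\<lambda>n. (g n)\<^sup>2)"
  shows "summable (\<lambda>n. f n * g n)"
proof (rule summable_comparison_test')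
  show "summable (\<lambda>n. (f n)\<^sup>2 + (g n)\<^sup>2)"
    using assms by (rule summable_add)
  show "norm (f n * g n) \<le> (f n)\<^sup>2 + (g n)\<^sup>2" if "0 \<le> n" for n
  proof -
    have "2 * (\<bar>f n\<bar> * \<bar>g n\<bar>) \<le> (f n)\<^sup>2 + (g n)\<^sup>2"
      using sum_squares_bound[of "\<bar>f n\<bar>" "\<bar>g n\<bar>"] by (simp add: mult.assoc)
    moreover have "0 \<le> \<bar>f n\<bar> * \<bar>g n\<bar>" by simp
    ultimately have "\<bar>f n\<bar> * \<bar>g n\<bar> \<le> (f n)\<^sup>2 + (g n)\<^sup>2" by linarith
    then show ?thesis by (simp add: abs_mult)
  qed
qed

lemma square_summable_add:
  fixes f g :: "nat \<Rightarrow> real"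
  assumes "summable (\<lambda>n. (f n)\<^sup>2)" "summable (\<lambda>n. (g n)\<^sup>2)"
  shows "summable (\<lambda>n. (f n + g n)\<^sup>2)"
proof -
  have "summable (\<lambda>n. ((f n)\<^sup>2 + (g n)\<^sup>2) + 2 * (f n * g n))"
    by (intro summable_add summable_mult assms square_summable_mult)
  then show ?thesis by (simp add: power2_sum mult.assoc)
qed

instantiation l2 :: real_vector
begin

lift_definition zero_l2 :: l2 is "\<lambda>_. 0" by simp

lift_definition plus_l2 :: "l2 \<Rightarrow> l2 \<Rightarrow> l2" is "\<lambda>f g n. f n + g n"
  by (rule square_summable_add)

lift_definition scaleR_l2 :: "real \<Rightarrow> l2 \<Rightarrow> l2" is "\<lambda>c f n. c * f n"
  by (simp add: power_mult_distrib summable_mult)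

lift_definition uminus_l2 :: "l2 \<Rightarrow> l2" is "\<lambda>f n. - f n" by simp

lift_definition minus_l2 :: "l2 \<Rightarrow> l2 \<Rightarrow> l2" is "\<lambda>f g n. f n - g n"
proof -
  fix f g :: "nat \<Rightarrow> real"
  assume "summable (\<lambda>n. (f n)\<^sup>2)" "summable (\<lambda>n. (g n)\<^sup>2)"
  then show "summable (\<lambda>n. (f n - g n)\<^sup>2)"
    using square_summable_add[of f "\<lambda>n. - g n"] by simp
qed

lemma l2_nth_simps [simp]:
  "l2_nth 0 n = 0"
  "l2_nth (x + y) n = l2_nth x n + l2_nth y n"
  "l2_nth (- x) n = - l2_nth x n"
  "l2_nth (x - y) n = l2_nth x n - l2_nth y n"
  "l2_nth (c *\<^sub>R x) n = c * l2_nth x n"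
  by (simp_all add: minus_l2.rep_eq zero_l2.rep_eq plus_l2.rep_eq uminus_l2.rep_eq scaleR_l2.rep_eq)

instance
  by standard (rule l2_eqI, simp add: algebra_simps)+

end

instantiation l2 :: real_inner
begin

definition inner_l2 :: "l2 \<Rightarrow> l2 \<Rightarrow> real" where
  "inner_l2 x y = (\<Sum>n. l2_nth x n * l2_nth y n)"

definition norm_l2 :: "l2 \<Rightarrow> real" where "norm_l2 x = sqrt (inner x x)"

definition dist_l2 :: "l2 \<Rightarrow> l2 \<Rightarrow> real" where "dist_l2 x y = norm (x - y)"

definition sgn_l2 :: "l2 \<Rightarrow> l2" where "sgn_l2 x = x /\<^sub>R norm x"

definition uniformity_l2 :: "(l2 \<times> l2) filter" where
  "uniformity_l2 = (INF e\<in>{0<..}. principal {(x, y). dist x y < e})"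

definition open_l2 :: "l2 set \<Rightarrow> bool" where
  "open_l2 U \<longleftrightarrow> (\<forall>x\<in>U. eventually (\<lambda>(x', y). x' = x \<longrightarrow> y \<in> U) uniformity)"

instance
proof
  fix x y z :: l2 and r :: real
  have s: "summable (\<lambda>n. l2_nth a n * l2_nth b n)" for a b
    by (intro square_summable_mult l2_summable)
  show "inner x y = inner y x"
    by (simp add: inner_l2_def mult.commute)
  show "inner (x + y) z = inner x z + inner y z"
    by (simp add: inner_l2_def distrib_right suminf_add s)
  show "inner (r *\<^sub>R x) y = r * inner x y"
    by (simp add: inner_l2_def mult.assoc suminf_mult s)
  show "0 \<le> inner x x"
    unfolding inner_l2_def by (intro suminf_nonneg s) simp
  show "(inner x x = 0) = (x = 0)"
  proof
    assume "inner x x = 0"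
    then have "\<forall>n. l2_nth x n * l2_nth x n = 0"
      unfolding inner_l2_def using suminf_eq_zero_iff[OF s[of x x]] by simp
    then show "x = 0" by (intro l2_eqI) simp
  qed (simp add: inner_l2_def)
qed (auto simp: norm_l2_def dist_l2_def sgn_l2_def uniformity_l2_def open_l2_def)

end

lemma norm_l2_squared: "(norm x)\<^sup>2 = (\<Sum>n. (l2_nth x n)\<^sup>2)"
  by (simp only: power2_norm_eq_inner inner_l2_def) (simp add: power2_eq_square)

lemma sum_l2_nth_le_norm: "(\<Sum>n<N. (l2_nth x n)\<^sup>2) \<le> (norm x)\<^sup>2"
  unfolding norm_l2_squared by (rule sum_le_suminf) auto

lemma abs_l2_nth_le_norm: "\<bar>l2_nth x n\<bar> \<le> norm x"
proof -
  have "(l2_nth x n)\<^sup>2 \<le> (\<Sum>k<Suc n. (l2_nth x k)\<^sup>2)"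
    by (rule member_le_sum) auto
  also have "\<dots> \<le> (norm x)\<^sup>2" by (rule sum_l2_nth_le_norm)
  finally show ?thesis by (metis abs_le_square_iff abs_norm_cancel)
qed

instance l2 :: banach
proof
  fix X :: "nat \<Rightarrow> l2"
  assume X: "Cauchy X"
  have "Cauchy (\<lambda>m. l2_nth (X m) n)" for n
  proof (rule metric_CauchyI)
    fix e :: real assume "0 < e"
    then obtain M where M: "\<forall>m\<ge>M. \<forall>k\<ge>M. dist (X m) (X k) < e"
      using X unfolding Cauchy_def by meson
    have "dist (l2_nth (X m) n) (l2_nth (X k) n) < e" if "m \<ge> M" "k \<ge> M" for m k
    proof -
      have "\<bar>l2_nth (X m) n - l2_nth (X k) n\<bar> \<le> dist (X m) (X k)"
        using abs_l2_nth_le_norm[of "X m - X k" n] by (simp add: dist_norm)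
      then show ?thesis using M that by (force simp: dist_real_def)
    qed
    then show "\<exists>M. \<forall>m\<ge>M. \<forall>k\<ge>M. dist (l2_nth (X m) n) (l2_nth (X k) n) < e" by blast
  qed
  then have "\<forall>n. \<exists>l. (\<lambda>m. l2_nth (X m) n) \<longlonglongrightarrow> l"
    using Cauchy_convergent_iff convergent_def by blast
  then obtain f where f: "\<And>n. (\<lambda>m. l2_nth (X m) n) \<longlonglongrightarrow> f n" by metis
  have bound: "(\<Sum>n<N. (l2_nth (X m) n - f n)\<^sup>2) \<le> e\<^sup>2"
    if "\<forall>k\<ge>M. dist (X m) (X k) < e" for e m M N
  proof (rule tendsto_upperbound)
    show "(\<lambda>k. \<Sum>n<N. (l2_nth (X m) n - l2_nth (X k) n)\<^sup>2) \<longlonglongrightarrow>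
        (\<Sum>n<N. (l2_nth (X m) n - f n)\<^sup>2)"
      by (intro tendsto_intros f)
    show "\<forall>\<^sub>F k in sequentially. (\<Sum>n<N. (l2_nth (X m) n - l2_nth (X k) n)\<^sup>2) \<le> e\<^sup>2"
    proof (rule eventually_sequentiallyI[of M])
      fix k assume "M \<le> k"
      then have "norm (X m - X k) \<le> e" using that by (simp add: dist_norm less_imp_le)
      then have "(norm (X m - X k))\<^sup>2 \<le> e\<^sup>2" by (simp add: power_mono)
      then show "(\<Sum>n<N. (l2_nth (X m) n - l2_nth (X k) n)\<^sup>2) \<le> e\<^sup>2"
        using sum_l2_nth_le_norm[of "X m - X k" N] by simp
    qed
  qed simp
  obtain M1 where M1: "\<forall>m\<ge>M1. \<forall>k\<ge>M1. dist (X m) (X k) < 1"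
    using X unfolding Cauchy_def by (meson zero_less_one)
  have s1: "summable (\<lambda>n. (l2_nth (X M1) n - f n)\<^sup>2)"
    by (rule summableI_nonneg_bounded[where x = "1\<^sup>2"]) (use bound[of M1 M1 1] M1 in auto)
  have "summable (\<lambda>n. (f n)\<^sup>2)"
    using square_summable_add[OF l2_summable[of "- X M1"] s1] by simp
  then have nth: "l2_nth (Abs_l2 f) n = f n" for n
    by (simp add: Abs_l2_inverse)
  have "X \<longlonglongrightarrow> Abs_l2 f"
  proof (rule metric_LIMSEQ_I)
    fix e :: real assume e: "0 < e"
    then obtain M where M: "\<forall>m\<ge>M. \<forall>k\<ge>M. dist (X m) (X k) < e / 2"
      using X unfolding Cauchy_def by (meson half_gt_zero)
    have "dist (X m) (Abs_l2 f) < e" if "m \<ge> M" for m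
    proof -
      have "(\<Sum>n. (l2_nth (X m - Abs_l2 f) n)\<^sup>2) \<le> (e / 2)\<^sup>2"
        by (rule suminf_le_const[OF l2_summable]) (use bound[of M m "e / 2"] M that in \<open>simp add: nth\<close>)
      then have "norm (X m - Abs_l2 f) \<le> e / 2"
        unfolding norm_l2_squared[symmetric] by (rule power2_le_imp_le) (use e in simp)
      then show ?thesis using e by (simp add: dist_norm)
    qed
    then show "\<exists>M. \<forall>m\<ge>M. dist (X m) (Abs_l2 f) < e" by blast
  qed
  then show "convergent X" by (auto simp: convergent_def)
qed

instance l2 :: second_countable_topology
proof
  define q where "q xs = Abs_l2 (\<lambda>n. if n < length xs then real_of_rat (xs ! n) else 0)"
    for xs :: "rat list"
  have q: "l2_nth (q xs) n = (if n < length xs then real_of_rat (xs ! n) else 0)" for xs n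
  proof -
    have "summable (\<lambda>n. (if n < length xs then real_of_rat (xs ! n) else 0)\<^sup>2)"
      by (rule summable_finite[of "{..<length xs}"]) auto
    then show ?thesis by (simp add: q_def Abs_l2_inverse)
  qed
  have dense: "\<exists>xs. dist (q xs) x < e" if e: "0 < e" for x e
  proof -
    obtain N where N: "norm (\<Sum>n. (l2_nth x (n + N))\<^sup>2) < e\<^sup>2 / 2"
      using suminf_exist_split[OF _ l2_summable, of "e\<^sup>2 / 2" x] e by auto
    define d where "d = e / sqrt (2 * (real N + 1))"
    have d: "0 < d" using e by (simp add: d_def)
    have "\<exists>r. \<bar>real_of_rat r - l2_nth x n\<bar> < d" for n
    proof -
      obtain r where "l2_nth x n - d < real_of_rat r" "real_of_rat r < l2_nth x n + d"
        using of_rat_dense[of "l2_nth x n - d" "l2_nth x n + d"] d by auto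
      then show ?thesis by (intro exI[of _ r]) (simp add: abs_less_iff)
    qed
    then obtain r where r: "\<And>n. \<bar>real_of_rat (r n) - l2_nth x n\<bar> < d" by metis
    define xs where "xs = map r [0..<N]"
    have "(\<Sum>n<N. (l2_nth (q xs - x) n)\<^sup>2) \<le> real N * d\<^sup>2"
    proof -
      have "(\<Sum>n<N. (l2_nth (q xs - x) n)\<^sup>2) \<le> (\<Sum>n<N. d\<^sup>2)"
      proof (rule sum_mono)
        fix n assume "n \<in> {..<N}"
        then have "\<bar>l2_nth (q xs - x) n\<bar> \<le> d"
          using r[of n] by (simp add: q xs_def)
        then show "(l2_nth (q xs - x) n)\<^sup>2 \<le> d\<^sup>2"
          using d by (metis abs_le_square_iff abs_of_pos)
      qed
      then show ?thesis by simp
    qed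
    also have "\<dots> < (real N + 1) * d\<^sup>2" using d by simp
    also have "\<dots> = e\<^sup>2 / 2"
      by (simp add: d_def power_divide field_simps)
    finally have a: "(\<Sum>n<N. (l2_nth (q xs - x) n)\<^sup>2) < e\<^sup>2 / 2" .
    have b: "(\<Sum>n. (l2_nth (q xs - x) (n + N))\<^sup>2) < e\<^sup>2 / 2"
      using N by (simp add: q xs_def)
    have "(norm (q xs - x))\<^sup>2 < e\<^sup>2"
      unfolding norm_l2_squared
      using suminf_split_initial_segment[OF l2_summable[of "q xs - x"], of N] a b by simp
    then have "dist (q xs) x < e"
      unfolding dist_norm by (rule power_less_imp_less_base) (use e in simp)
    then show ?thesis by blast
  qed
  let ?B = "(\<lambda>(xs, r). ball (q xs) (real_of_rat r)) ` UNIV"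
  have "topological_basis ?B"
  proof (rule topological_basisI)
    fix U :: "l2 set" and x assume U: "open U" "x \<in> U"
    then obtain e where e: "e > 0" "ball x e \<subseteq> U" using open_contains_ball by blast
    obtain r where r: "0 < real_of_rat r" "real_of_rat r < e / 2"
      using of_rat_dense[of 0 "e / 2"] e by auto
    obtain xs where xs: "dist (q xs) x < real_of_rat r" using dense r by blast
    have "ball (q xs) (real_of_rat r) \<subseteq> ball x e"
    proof
      fix y assume "y \<in> ball (q xs) (real_of_rat r)"
      then have "dist x y < e"
        using dist_triangle[of x y "q xs"] xs r by (simp add: dist_commute)
      then show "y \<in> ball x e" by simp
    qed
    moreover have "x \<in> ball (q xs) (real_of_rat r)" using xs by simp
    ultimately show "\<exists>B\<in>?B. x \<in> B \<and> B \<subseteq> U" using e by force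
  qed auto
  then show "\<exists>B::l2 set set. countable B \<and> open = generate_topology B"
    by (intro exI[of _ ?B] conjI topological_basis_imp_subbasis) auto
qed

text \<open>The inclusion of Euclidean space, \<open>(x\<^sub>1, \<dots>, x\<^sub>N) \<mapsto> (x\<^sub>1, \<dots>, x\<^sub>N, 0, 0, \<dots>)\<close>.
  It is meant for numeral index types; there \<open>of_nat (n + 1)\<close>, for \<open>n < N\<close>, runs through
  all indices (the last one is \<open>of_nat N = 0\<close>).\<close>

definition l2_inclusion :: "real ^ 'n::{finite, semiring_1} \<Rightarrow> l2" where
  "l2_inclusion x = Abs_l2 (\<lambda>n. if n < CARD('n) then x $ of_nat (n + 1) else 0)"


section \<open>Smooth maps on \<open>SU(2)\<close>\<close>

type_synonym cmat2 = "complex ^ 2 ^ 2"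

definition su2_matrix :: "complex \<Rightarrow> complex \<Rightarrow> cmat2" where
  "su2_matrix z w = vector [vector [z, - cnj w], vector [w, cnj z]]"

definition SU2 :: "cmat2 set" where
  "SU2 = {su2_matrix z w | z w. (cmod z)\<^sup>2 + (cmod w)\<^sup>2 = 1}"

text \<open>\<open>C\<^sup>k\<close>-maps on an open subset of a Euclidean space; since the domain is finite-dimensional,
  continuity of the derivative may be tested direction by direction, also for
  infinite-dimensional targets.\<close>

primrec Ck_on :: "nat \<Rightarrow> ('a::euclidean_space \<Rightarrow> 'b::real_normed_vector) \<Rightarrow> 'a set \<Rightarrow> bool" where
  "Ck_on 0 f U \<longleftrightarrow> continuous_on U f"
| "Ck_on (Suc k) f U \<longleftrightarrow> (\<forall>x\<in>U. f differentiable (at x)) \<and>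
     (\<forall>v. Ck_on k (\<lambda>x. frechet_derivative f (at x) v) U)"

text \<open>A map on the embedded submanifold \<open>SU(2)\<close> is of class \<open>C\<^sup>k\<close> (smooth) if it is locally the
  restriction of such a map on an open subset of the ambient matrix space. The values
  outside \<open>SU(2)\<close> are irrelevant.\<close>

definition Ck_SU2 :: "nat \<Rightarrow> (cmat2 \<Rightarrow> 'b::real_normed_vector) \<Rightarrow> bool" where
  "Ck_SU2 k f \<longleftrightarrow> (\<forall>x\<in>SU2. \<exists>U F. open U \<and> x \<in> U \<and> Ck_on k F U \<and> (\<forall>y\<in>U \<inter> SU2. F y = f y))"

definition smooth_SU2 :: "(cmat2 \<Rightarrow> 'b::real_normed_vector) \<Rightarrow> bool" where
  "smooth_SU2 f \<longleftrightarrow> (\<forall>x\<in>SU2. \<exists>U F. open U \<and> x \<in> U \<and> (\<forall>k. Ck_on k F U) \<and> (\<forall>y\<in>U \<inter> SU2. F y = f y))"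

definition tangent :: "cmat2 \<Rightarrow> cmat2 set" where
  "tangent x = {v. \<exists>\<gamma>::real \<Rightarrow> cmat2. range \<gamma> \<subseteq> SU2 \<and> \<gamma> 0 = x \<and> (\<gamma> has_vector_derivative v) (at 0)}"

text \<open>A derivative within \<open>SU(2)\<close> is uniquely determined on tangent vectors only, so
  \<open>differential f x v\<close> is meaningful for tangent \<open>v\<close>.\<close>

definition differential :: "(cmat2 \<Rightarrow> 'b::real_normed_vector) \<Rightarrow> cmat2 \<Rightarrow> cmat2 \<Rightarrow> 'b" where
  "differential f x = frechet_derivative f (at x within SU2)"


section \<open>The left-invariant frame and the Berger metrics\<close>

text \<open>With \<open>\<zeta>\<^sub>1 = x $ 1 $ 1\<close>, \<open>\<zeta>\<^sub>2 = x $ 2 $ 1\<close>, \<open>d\<zeta>\<^sub>1 = v $ 1 $ 1\<close>, \<open>d\<zeta>\<^sub>2 = v $ 2 $ 1\<close>. The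
  expression defining \<open>\<sigma>\<^sub>3\<close> is real on tangent vectors.\<close>

definition \<sigma> :: "3 \<Rightarrow> cmat2 \<Rightarrow> cmat2 \<Rightarrow> real" where
  "\<sigma> a x v =
     (let \<omega> = \<i> * (x $ 2 $ 1 * v $ 1 $ 1 - x $ 1 $ 1 * v $ 2 $ 1);
          \<theta> = - \<i> * (cnj (x $ 1 $ 1) * v $ 1 $ 1 + cnj (x $ 2 $ 1) * v $ 2 $ 1)
      in if a = 1 then Re \<omega> else if a = 2 then Im \<omega> else Re \<theta>)"

definition E :: "3 \<Rightarrow> cmat2 \<Rightarrow> cmat2" where
  "E b x = (THE v. v \<in> tangent x \<and> (\<forall>a. \<sigma> a x v = (if a = b then 1 else 0)))"

text \<open>A covariant 2-tensor field assigns a bilinear form on the tangent space to each point.\<close>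

type_synonym tensor2 = "cmat2 \<Rightarrow> cmat2 \<Rightarrow> cmat2 \<Rightarrow> real"

definition berger :: "real \<Rightarrow> tensor2" where
  "berger t x v w = \<sigma> 1 x v * \<sigma> 1 x w + \<sigma> 2 x v * \<sigma> 2 x w + t\<^sup>2 * (\<sigma> 3 x v * \<sigma> 3 x w)"

text \<open>Since \<open>E\<^sub>1, E\<^sub>2, E\<^sub>3\<close> is a global smooth frame, a section \<open>\<Sum>\<^sub>a\<^sub>b g\<^sup>a\<^sup>b E\<^sub>a \<otimes> E\<^sub>b\<close> of
  \<open>TM \<otimes> TM\<close> is given by its matrix of coefficients.\<close>

type_synonym cotensor2 = "cmat2 \<Rightarrow> real ^ 3 ^ 3"

definition cometric :: "cotensor2 \<Rightarrow> cmat2 \<Rightarrow> (cmat2 \<Rightarrow> real) \<Rightarrow> (cmat2 \<Rightarrow> real) \<Rightarrow> real" where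
  "cometric g x \<alpha> \<beta> = (\<Sum>a\<in>UNIV. \<Sum>b\<in>UNIV. g x $ a $ b * \<alpha> (E a x) * \<beta> (E b x))"

text \<open>The contraction \<open>g\<^sup>i\<^sup>j k\<^sub>i\<^sub>j\<close>.\<close>

definition contraction :: "cotensor2 \<Rightarrow> tensor2 \<Rightarrow> cmat2 \<Rightarrow> real" where
  "contraction g k x = (\<Sum>a\<in>UNIV. \<Sum>b\<in>UNIV. g x $ a $ b * k x (E a x) (E b x))"

text \<open>\<open>E\<^sub>a \<otimes> E\<^sub>b\<close> has a single nonzero coefficient.\<close>

definition E_tensor :: "3 \<Rightarrow> 3 \<Rightarrow> cotensor2" where
  "E_tensor a b x = (\<chi> i j. if i = a \<and> j = b then 1 else 0)"

definition berger_dual :: "real \<Rightarrow> cotensor2" where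
  "berger_dual t x = E_tensor 1 1 x + E_tensor 2 2 x + (1 / t\<^sup>2) *\<^sub>R E_tensor 3 3 x"

definition berger_dual_inf :: cotensor2 where
  "berger_dual_inf x = E_tensor 1 1 x + E_tensor 2 2 x"

text \<open>Covectors at \<open>x\<close> are the restrictions to the tangent space of linear functionals on the
  ambient space.\<close>

definition psd_sections :: "cotensor2 set" where
  "psd_sections = {g. smooth_SU2 g \<and>
     (\<forall>x\<in>SU2. transpose (g x) = g x \<and> (\<forall>\<alpha>. linear \<alpha> \<longrightarrow> 0 \<le> cometric g x \<alpha> \<alpha>))}"


section \<open>Riemannian volume\<close>

text \<open>The coordinates \<open>(\<eta>, a, b) \<mapsto> A(cos \<eta> e\<^sup>i\<^sup>a, sin \<eta> e\<^sup>i\<^sup>b)\<close> map the box below diffeomorphically onto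
  \<open>SU(2)\<close> minus finitely many submanifolds of lower dimension, which are null sets. The volume
  element of \<open>h\<close> is \<open>sqrt (det (h(\<partial>\<^sub>i, \<partial>\<^sub>j))) d\<eta> da db\<close>.\<close>

definition hopf_coords :: "real ^ 3 \<Rightarrow> cmat2" where
  "hopf_coords p = su2_matrix (complex_of_real (cos (p $ 1)) * cis (p $ 2))
                              (complex_of_real (sin (p $ 1)) * cis (p $ 3))"

definition hopf_box :: "(real ^ 3) set" where
  "hopf_box = {p. 0 < p $ 1 \<and> p $ 1 < pi / 2 \<and> 0 < p $ 2 \<and> p $ 2 < 2 * pi \<and> 0 < p $ 3 \<and> p $ 3 < 2 * pi}"

definition gram :: "tensor2 \<Rightarrow> real ^ 3 \<Rightarrow> real ^ 3 ^ 3" where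
  "gram h p = (\<chi> i j. h (hopf_coords p)
      (frechet_derivative hopf_coords (at p) (axis i 1))
      (frechet_derivative hopf_coords (at p) (axis j 1)))"

definition volume_element :: "tensor2 \<Rightarrow> cmat2 measure" where
  "volume_element h =
     distr (density (restrict_space lborel hopf_box) (\<lambda>p. ennreal (sqrt (det (gram h p)))))
       (restrict_space borel SU2) hopf_coords"


section \<open>The first eigenvalue of the Bakry-Emery Laplacian\<close>

text \<open>The defining property determines the values on \<open>SU(2)\<close>, which are all that is used.\<close>

definition laplacian :: "cmat2 measure \<Rightarrow> cotensor2 \<Rightarrow> (cmat2 \<Rightarrow> real) \<Rightarrow> cmat2 \<Rightarrow> real" where
  "laplacian \<mu> g u = (SOME w. smooth_SU2 w \<and>
     (\<forall>v. smooth_SU2 v \<longrightarrow>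
        (\<integral>x. w x * v x \<partial>\<mu>) = - (\<integral>x. cometric g x (differential u x) (differential v x) \<partial>\<mu>)))"

definition lambda1 :: "cmat2 measure \<Rightarrow> cotensor2 \<Rightarrow> real" where
  "lambda1 \<mu> g = Inf {(\<integral>x. cometric g x (differential u x) (differential u x) \<partial>\<mu>) / (\<integral>x. (u x)\<^sup>2 \<partial>\<mu>) | u.
     Ck_SU2 1 u \<and> (\<exists>x\<in>SU2. u x \<noteq> 0) \<and> (\<integral>x. u x \<partial>\<mu>) = 0}"

definition first_eigenfunction :: "cmat2 measure \<Rightarrow> cotensor2 \<Rightarrow> (cmat2 \<Rightarrow> real) \<Rightarrow> bool" where
  "first_eigenfunction \<mu> g u \<longleftrightarrow>
     smooth_SU2 u \<and> (\<forall>x\<in>SU2. - laplacian \<mu> g u x = lambda1 \<mu> g * u x)"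

definition by_first_eigenfunctions :: "cmat2 measure \<Rightarrow> cotensor2 \<Rightarrow> (cmat2 \<Rightarrow> real ^ 'n) \<Rightarrow> bool" where
  "by_first_eigenfunctions \<mu> g \<phi> \<longleftrightarrow> (\<forall>i. first_eigenfunction \<mu> g (\<lambda>x. \<phi> x $ i))"

abbreviation normalized :: "cmat2 measure \<Rightarrow> cmat2 measure" where
  "normalized \<mu> \<equiv> uniform_measure \<mu> (space \<mu>)"

definition eigenvalue_ratio :: "cmat2 measure \<Rightarrow> tensor2 \<Rightarrow> cotensor2 \<Rightarrow> real" where
  "eigenvalue_ratio \<mu> h g = lambda1 \<mu> g / (\<integral>x. contraction g h x \<partial>normalized \<mu>)"

definition solves_eigenvalue_maximization :: "cmat2 measure \<Rightarrow> tensor2 \<Rightarrow> cotensor2 \<Rightarrow> bool" where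
  "solves_eigenvalue_maximization \<mu> h g \<longleftrightarrow>
     is_arg_max (eigenvalue_ratio \<mu> h) (\<lambda>g. g \<in> psd_sections \<and> (\<exists>x\<in>SU2. g x \<noteq> 0)) g"


section \<open>Isometric embeddings, short maps, inflated maps\<close>

definition pullback :: "(cmat2 \<Rightarrow> 'b::real_inner) \<Rightarrow> tensor2" where
  "pullback \<phi> x v w = differential \<phi> x v \<bullet> differential \<phi> x w"

definition tensor_le :: "tensor2 \<Rightarrow> tensor2 \<Rightarrow> bool" where
  "tensor_le k h \<longleftrightarrow> (\<forall>x\<in>SU2. \<forall>v\<in>tangent x. k x v v \<le> h x v v)"

definition smooth_embedding :: "(cmat2 \<Rightarrow> 'b::real_normed_vector) \<Rightarrow> bool" where
  "smooth_embedding \<phi> \<longleftrightarrow> smooth_SU2 \<phi> \<and>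
     (\<forall>x\<in>SU2. inj_on (differential \<phi> x) (tangent x)) \<and>
     (\<exists>\<psi>. homeomorphism SU2 (\<phi> ` SU2) \<phi> \<psi>)"

definition isometric_embedding :: "tensor2 \<Rightarrow> (cmat2 \<Rightarrow> 'b::real_inner) \<Rightarrow> bool" where
  "isometric_embedding h \<phi> \<longleftrightarrow> smooth_embedding \<phi> \<and>
     (\<forall>x\<in>SU2. \<forall>v\<in>tangent x. \<forall>w\<in>tangent x. pullback \<phi> x v w = h x v w)"

definition short_map :: "tensor2 \<Rightarrow> (cmat2 \<Rightarrow> 'b::real_inner) \<Rightarrow> bool" where
  "short_map h \<phi> \<longleftrightarrow> smooth_SU2 \<phi> \<and> tensor_le (pullback \<phi>) h"

definition inflated_map :: "cmat2 measure \<Rightarrow> tensor2 \<Rightarrow> (cmat2 \<Rightarrow> l2) \<Rightarrow> bool" where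
  "inflated_map \<mu> h \<phi> \<longleftrightarrow>
     is_arg_max (\<lambda>\<psi>. \<integral>x. (norm (\<psi> x))\<^sup>2 \<partial>normalized \<mu>)
       (\<lambda>\<psi>. smooth_SU2 \<psi> \<and> tensor_le (pullback \<psi>) h \<and> (\<integral>x. \<psi> x \<partial>normalized \<mu>) = 0) \<phi>"

definition \<phi>\<^sub>0 :: "cmat2 \<Rightarrow> real ^ 4" where
  "\<phi>\<^sub>0 x = vector [Re (x $ 1 $ 1), Im (x $ 1 $ 1), Re (x $ 2 $ 1), Im (x $ 2 $ 1)]"

end

theory Submission
  imports Defs
begin

text \<open>Write \<open>\<kappa> = s\<^sup>-\<^sup>2 \<in> [0, 6]\<close>. The operator \<open>E\<^sub>1\<^sup>2 + E\<^sub>2\<^sup>2 + \<kappa> E\<^sub>3\<^sup>2\<close> maps a monomial of bidegree \<open>(p, q)\<close> in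
  \<open>(z, w)\<close> and \<open>(cnj z, cnj w)\<close> to \<open>- (4 p q + 2 (p + q) + \<kappa> (p - q)\<^sup>2)\<close> times itself plus terms of lower degree,
  so on polynomials it is triangular as well as symmetric, and Gram-Schmidt exhibits these numbers
  as its eigenvalues. Projecting onto polynomials (which are dense) yields the spectral gap
  \<open>2 + \<kappa>\<close> for all \<open>C\<^sup>1\<close>-functions; it is attained by the coordinates of the tautological embedding and, for
  \<open>\<kappa> = 6\<close>, also by those of the Hopf map. The gap applied to the components of a short map bounds its
  \<open>L\<^sup>2\<close>-norm, and the components of the eigenmap, inserted as test functions for an arbitrary
  \<open>g\<^sup>*\<close>, bound the eigenvalue ratio.\<close>

section \<open>The tangent spaces and the left-invariant frame\<close>

text \<open>Both maximization problems are controlled by one number: if the components of an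
  eigenmap have eigenvalue 2 + \<kappa> and squares summing to a constant R with 2 + \<kappa> t^2 =
  (2 + \<kappa>) R, then R is the largest mean square and 1/R the largest eigenvalue ratio, so map
  and cometric certify each other. The bound 6 is where 2 + \<kappa> meets 8, the eigenvalue of the
  Hopf map, which does not depend on \<kappa>. Mixing both eigenmaps at \<kappa> = 6 realizes h_t
  for t <= 1: the tautological embedding scaled by t fits the direction of E_3, and the Hopf map,
  constant along E_3, supplies what is missing along E_1 and E_2. For t >= 1 the slack h_t - h_1
  lies in the direction of E_3, which \<kappa> = 0 does not weigh; for t = 1 the condition on R
  reads R = 1 whatever \<kappa> is. The obstacle is that competitors for the first eigenvalue are
  only C^1 while polynomials approximate them only uniformly. Derivatives are controlled by
  invariance instead: the operator preserves the polynomials of bounded degree, so projecting onto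
  them does not increase the Dirichlet energy.\<close>

lemma vec2_eq_iff: "x = y \<longleftrightarrow> x $ 1 = y $ 1 \<and> x $ 2 = y $ 2" for x y :: "'a ^ 2"
  by (metis (mono_tags) exhaust_2 vec_eq_iff)

lemma su2_matrix_nth [simp]:
  "su2_matrix z w $ 1 $ 1 = z" "su2_matrix z w $ 1 $ 2 = - cnj w"
  "su2_matrix z w $ 2 $ 1 = w" "su2_matrix z w $ 2 $ 2 = cnj z"
  by (simp_all add: su2_matrix_def)

lemma su2_matrix_eq_iff: "x = su2_matrix z w \<longleftrightarrow>
    x $ 1 $ 1 = z \<and> x $ 2 $ 1 = w \<and> x $ 1 $ 2 = - cnj w \<and> x $ 2 $ 2 = cnj z"
  by (auto simp: vec2_eq_iff)

lemma su2_matrix_cong_iff [simp]: "su2_matrix z w = su2_matrix z' w' \<longleftrightarrow> z = z' \<and> w = w'"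
  by (metis su2_matrix_nth(1,3))

lemma su2_matrix_linear:
  "su2_matrix z w + su2_matrix z' w' = su2_matrix (z + z') (w + w')"
  "su2_matrix z w - su2_matrix z' w' = su2_matrix (z - z') (w - w')"
  "r *\<^sub>R su2_matrix z w = su2_matrix (of_real r * z) (of_real r * w)"
  by (simp_all add: su2_matrix_eq_iff scaleR_conv_of_real[where 'a = complex])

lemma bounded_linear_su2_matrix: "bounded_linear (\<lambda>p. su2_matrix (fst p) (snd p))"
  unfolding linear_conv_bounded_linear[symmetric]
  by (rule linearI) (simp_all add: su2_matrix_linear scaleR_conv_of_real[where 'a = complex])

lemma has_derivative_su2_matrix:
  assumes "(f has_derivative f') (at x within S)" "(g has_derivative g') (at x within S)"
  shows "((\<lambda>x. su2_matrix (f x) (g x)) has_derivative (\<lambda>h. su2_matrix (f' h) (g' h))) (at x within S)"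
  using bounded_linear.has_derivative[OF bounded_linear_su2_matrix has_derivative_Pair[OF assms]]
  by simp

lemma has_vector_derivative_su2_matrix:
  assumes "(f has_vector_derivative f') (at x within S)" "(g has_vector_derivative g') (at x within S)"
  shows "((\<lambda>x. su2_matrix (f x) (g x)) has_vector_derivative su2_matrix f' g') (at x within S)"
  using bounded_linear.has_vector_derivative[OF bounded_linear_su2_matrix
      has_vector_derivative_Pair[OF assms]] by simp

lemma continuous_on_su2_matrix [continuous_intros]:
  assumes "continuous_on S f" "continuous_on S g"
  shows "continuous_on S (\<lambda>x. su2_matrix (f x) (g x))"
  using bounded_linear.continuous_on[OF bounded_linear_su2_matrix continuous_on_Pair[OF assms]]
  by simp

lemma bounded_linear_entry: "bounded_linear (\<lambda>x::cmat2. x $ i $ j)"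
  using bounded_linear_compose[OF bounded_linear_vec_nth bounded_linear_vec_nth] .

lemma SU2_iff: "x \<in> SU2 \<longleftrightarrow> x = su2_matrix (x $ 1 $ 1) (x $ 2 $ 1) \<and>
    (cmod (x $ 1 $ 1))\<^sup>2 + (cmod (x $ 2 $ 1))\<^sup>2 = 1"
  unfolding SU2_def by auto

lemma su2_matrix_in_SU2 [simp]: "su2_matrix z w \<in> SU2 \<longleftrightarrow> (cmod z)\<^sup>2 + (cmod w)\<^sup>2 = 1"
  by (simp add: SU2_iff)

lemma SU2_norm: "x \<in> SU2 \<Longrightarrow> (cmod (x $ 1 $ 1))\<^sup>2 + (cmod (x $ 2 $ 1))\<^sup>2 = 1"
  unfolding SU2_iff by blast

lemma SU2_entries_eq: "x \<in> SU2 \<Longrightarrow> x = su2_matrix (x $ 1 $ 1) (x $ 2 $ 1)"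
  unfolding SU2_iff by blast

lemma SU2_cnj:
  assumes "x \<in> SU2"
  shows "x $ 1 $ 1 * cnj (x $ 1 $ 1) + x $ 2 $ 1 * cnj (x $ 2 $ 1) = 1"
proof -
  have "x $ 1 $ 1 * cnj (x $ 1 $ 1) + x $ 2 $ 1 * cnj (x $ 2 $ 1) =
      of_real ((cmod (x $ 1 $ 1))\<^sup>2 + (cmod (x $ 2 $ 1))\<^sup>2)"
    by (simp only: of_real_add complex_norm_square)
  then show ?thesis by (simp only: SU2_norm[OF assms] of_real_1)
qed

lemma compact_SU2: "compact SU2"
proof -
  have "bounded {p :: complex \<times> complex. (cmod (fst p))\<^sup>2 + (cmod (snd p))\<^sup>2 = 1}"
    unfolding bounded_iff
    by (rule exI[of _ 1]) (auto simp: norm_prod_def)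
  moreover have "closed {p :: complex \<times> complex. (cmod (fst p))\<^sup>2 + (cmod (snd p))\<^sup>2 = 1}"
    by (intro closed_Collect_eq continuous_intros)
  ultimately have "compact {p :: complex \<times> complex. (cmod (fst p))\<^sup>2 + (cmod (snd p))\<^sup>2 = 1}"
    by (simp add: compact_eq_bounded_closed)
  then have "compact ((\<lambda>p. su2_matrix (fst p) (snd p)) `
      {p :: complex \<times> complex. (cmod (fst p))\<^sup>2 + (cmod (snd p))\<^sup>2 = 1})"
    by (rule compact_continuous_image[rotated]) (intro continuous_intros)
  moreover have "(\<lambda>p. su2_matrix (fst p) (snd p)) `
      {p :: complex \<times> complex. (cmod (fst p))\<^sup>2 + (cmod (snd p))\<^sup>2 = 1} = SU2"
  proof (intro subset_antisym subsetI)
    fix x assume "x \<in> SU2"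
    then show "x \<in> (\<lambda>p. su2_matrix (fst p) (snd p)) `
        {p :: complex \<times> complex. (cmod (fst p))\<^sup>2 + (cmod (snd p))\<^sup>2 = 1}"
      by (intro image_eqI[of _ _ "(x $ 1 $ 1, x $ 2 $ 1)"]) (simp_all add: SU2_norm SU2_entries_eq[symmetric])
  qed auto
  ultimately show ?thesis by simp
qed

text \<open>Left translates x X of a basis of the Lie algebra, with X = A(0, i), A(0, -1), A(i, 0)
  for a = 1, 2, 3; the first column of the product determines it.\<close>

definition frame :: "3 \<Rightarrow> cmat2 \<Rightarrow> cmat2" where
  "frame a x = (if a = 1 then su2_matrix (- \<i> * cnj (x $ 2 $ 1)) (\<i> * cnj (x $ 1 $ 1))
     else if a = 2 then su2_matrix (cnj (x $ 2 $ 1)) (- cnj (x $ 1 $ 1))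
     else su2_matrix (\<i> * x $ 1 $ 1) (\<i> * x $ 2 $ 1))"

lemma frame_simps:
  "frame 1 x = su2_matrix (- \<i> * cnj (x $ 2 $ 1)) (\<i> * cnj (x $ 1 $ 1))"
  "frame 2 x = su2_matrix (cnj (x $ 2 $ 1)) (- cnj (x $ 1 $ 1))"
  "frame 3 x = su2_matrix (\<i> * x $ 1 $ 1) (\<i> * x $ 2 $ 1)"
  by (simp_all add: frame_def)

lemma \<sigma>_simps:
  "\<sigma> 1 x v = Re (\<i> * (x $ 2 $ 1 * v $ 1 $ 1 - x $ 1 $ 1 * v $ 2 $ 1))"
  "\<sigma> 2 x v = Im (\<i> * (x $ 2 $ 1 * v $ 1 $ 1 - x $ 1 $ 1 * v $ 2 $ 1))"
  "\<sigma> 3 x v = Re (- \<i> * (cnj (x $ 1 $ 1) * v $ 1 $ 1 + cnj (x $ 2 $ 1) * v $ 2 $ 1))"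
  by (simp_all add: \<sigma>_def Let_def)

lemma SU2_Re_Im:
  assumes "x \<in> SU2"
  shows "Re (x $ 1 $ 1) * Re (x $ 1 $ 1) + Im (x $ 1 $ 1) * Im (x $ 1 $ 1) +
    Re (x $ 2 $ 1) * Re (x $ 2 $ 1) + Im (x $ 2 $ 1) * Im (x $ 2 $ 1) = 1"
  using SU2_norm[OF assms] unfolding cmod_power2 by (simp add: power2_eq_square)

lemma \<sigma>_frame:
  assumes "x \<in> SU2"
  shows "\<sigma> a x (frame b x) = (if a = b then 1 else 0)"
  using exhaust_3[of a] exhaust_3[of b] SU2_Re_Im[OF assms]
  by (auto simp: \<sigma>_simps frame_simps algebra_simps)

lemma bounded_linear_\<sigma>: "bounded_linear (\<sigma> a x)"
  unfolding linear_conv_bounded_linear[symmetric]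
  using exhaust_3[of a] by (auto intro!: linearI simp: \<sigma>_simps algebra_simps)

text \<open>The condition is orthogonality of (p, q) to the first column of x in R^4, so the great
  circle through x in this direction stays on the unit sphere.\<close>

lemma tangentI:
  assumes x: "x \<in> SU2" and r: "Re (cnj (x $ 1 $ 1) * p + cnj (x $ 2 $ 1) * q) = 0"
  shows "su2_matrix p q \<in> tangent x"
proof (cases "p = 0 \<and> q = 0")
  case True
  have "((\<lambda>s. x) has_vector_derivative su2_matrix p q) (at 0)"
    using True su2_matrix_linear(3)[of 0 p q] by (metis has_vector_derivative_const mult_zero_left of_real_0 scaleR_zero_left)
  then show ?thesis using x unfolding tangent_def by (intro CollectI exI[of _ "\<lambda>s. x"]) auto
next
  case False
  \<comment> \<open>\<open>N\<close> is the angular speed: cos(N s) x + sin(N s)/N v has velocity v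
    at s = 0. The division is why the zero vector is treated apart.\<close>
  define N where "N = sqrt ((cmod p)\<^sup>2 + (cmod q)\<^sup>2)"
  have "(cmod p)\<^sup>2 + (cmod q)\<^sup>2 > 0"
    using False by (metis add_pos_nonneg add_nonneg_pos zero_less_norm_iff zero_less_power zero_le_power2)
  then have N: "N > 0" "N\<^sup>2 = (cmod p)\<^sup>2 + (cmod q)\<^sup>2" by (simp_all add: N_def)
  let ?c = "\<lambda>a b s. of_real (cos (N * s)) * a + of_real (sin (N * s) / N) * b"
  let ?g = "\<lambda>s. su2_matrix (?c (x $ 1 $ 1) p s) (?c (x $ 2 $ 1) q s)"
  have d: "(?c a b has_vector_derivative b) (at 0)" for a b :: complex
  proof -
    have "((\<lambda>s. cos (N * s)) has_real_derivative 0) (at 0)"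
      by (auto intro!: derivative_eq_intros)
    moreover have "((\<lambda>s. sin (N * s) / N) has_real_derivative 1) (at 0)"
      using N by (auto intro!: derivative_eq_intros)
    ultimately have "((\<lambda>s. cos (N * s) *\<^sub>R a + (sin (N * s) / N) *\<^sub>R b) has_vector_derivative
        (0 *\<^sub>R a + 1 *\<^sub>R b)) (at 0)"
      unfolding has_real_derivative_iff_has_vector_derivative
      by (intro has_vector_derivative_add
          bounded_linear.has_vector_derivative[OF bounded_linear_scaleR_left])
    then show ?thesis by (simp add: scaleR_conv_of_real)
  qed
  have "(?g has_vector_derivative su2_matrix p q) (at 0)"
    by (intro has_vector_derivative_su2_matrix d)
  moreover have "?g s \<in> SU2" for s
  proof -
    define C S where "C = cos (N * s)" and "S = sin (N * s) / N"
    have n2: "(cmod (of_real C * a + of_real S * b))\<^sup>2 = C\<^sup>2 * (cmod a)\<^sup>2 + S\<^sup>2 * (cmod b)\<^sup>2 + 2 * (C * S) * Re (cnj a * b)" for a b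
      unfolding cmod_power2
      by (simp add: power2_eq_square algebra_simps)
    have "(cmod (?c (x $ 1 $ 1) p s))\<^sup>2 + (cmod (?c (x $ 2 $ 1) q s))\<^sup>2 =
        C\<^sup>2 * ((cmod (x $ 1 $ 1))\<^sup>2 + (cmod (x $ 2 $ 1))\<^sup>2) + S\<^sup>2 * ((cmod p)\<^sup>2 + (cmod q)\<^sup>2) +
        2 * (C * S) * Re (cnj (x $ 1 $ 1) * p + cnj (x $ 2 $ 1) * q)"
      unfolding C_def[symmetric] S_def[symmetric] n2 by (simp add: algebra_simps)
    also have "\<dots> = C\<^sup>2 + S\<^sup>2 * N\<^sup>2" using SU2_norm[OF x] r N by simp
    also have "\<dots> = 1" using N(1) by (simp add: C_def S_def power_divide)
    finally show ?thesis by simp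
  qed
  moreover have "?g 0 = x" using SU2_entries_eq[OF x] by simp
  ultimately show ?thesis unfolding tangent_def by (intro CollectI exI[of _ ?g]) auto
qed

text \<open>The curve satisfies the real-linear relations that define matrices A(z, w), hence so
  does its velocity; the second fact is the derivative of the constant |z|^2 + |w|^2.\<close>

lemma tangentD:
  assumes "v \<in> tangent x"
  shows "v = su2_matrix (v $ 1 $ 1) (v $ 2 $ 1)"
    and "Re (cnj (x $ 1 $ 1) * v $ 1 $ 1 + cnj (x $ 2 $ 1) * v $ 2 $ 1) = 0"
proof -
  obtain \<gamma> where "range \<gamma> \<subseteq> SU2" and \<gamma>0: "\<gamma> 0 = x" "(\<gamma> has_vector_derivative v) (at (0::real))"
    using assms unfolding tangent_def by auto
  note \<gamma> = subsetD[OF \<open>range \<gamma> \<subseteq> SU2\<close> rangeI] \<gamma>0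
  have e: "((\<lambda>s. \<gamma> s $ i $ j) has_vector_derivative v $ i $ j) (at 0)" for i j
    by (rule bounded_linear.has_vector_derivative[OF bounded_linear_entry \<gamma>(3)])
  have "((\<lambda>s. su2_matrix (\<gamma> s $ 1 $ 1) (\<gamma> s $ 2 $ 1)) has_vector_derivative
      su2_matrix (v $ 1 $ 1) (v $ 2 $ 1)) (at 0)"
    by (intro has_vector_derivative_su2_matrix e)
  moreover have "(\<lambda>s. su2_matrix (\<gamma> s $ 1 $ 1) (\<gamma> s $ 2 $ 1)) = \<gamma>"
    by (rule ext) (rule SU2_entries_eq[OF \<gamma>(1), symmetric])
  ultimately have "(\<gamma> has_vector_derivative su2_matrix (v $ 1 $ 1) (v $ 2 $ 1)) (at 0)" by simp
  then show "v = su2_matrix (v $ 1 $ 1) (v $ 2 $ 1)"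
    by (rule vector_derivative_unique_at[OF \<gamma>(3)])
  let ?n = "\<lambda>s. \<gamma> s $ 1 $ 1 * cnj (\<gamma> s $ 1 $ 1) + \<gamma> s $ 2 $ 1 * cnj (\<gamma> s $ 2 $ 1)"
  have n: "(?n has_vector_derivative
      \<gamma> 0 $ 1 $ 1 * cnj (v $ 1 $ 1) + v $ 1 $ 1 * cnj (\<gamma> 0 $ 1 $ 1) +
      (\<gamma> 0 $ 2 $ 1 * cnj (v $ 2 $ 1) + v $ 2 $ 1 * cnj (\<gamma> 0 $ 2 $ 1))) (at 0)"
    by (rule has_vector_derivative_add[OF
          has_vector_derivative_mult[OF e has_vector_derivative_cnj[OF e]]
          has_vector_derivative_mult[OF e has_vector_derivative_cnj[OF e]]])
  have "?n = (\<lambda>s. 1)" by (rule ext) (rule SU2_cnj[OF \<gamma>(1)])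
  moreover have "((\<lambda>s::real. 1) has_vector_derivative (0::complex)) (at 0)" by simp
  ultimately have "(?n has_vector_derivative 0) (at 0)" by simp
  then have "\<gamma> 0 $ 1 $ 1 * cnj (v $ 1 $ 1) + v $ 1 $ 1 * cnj (\<gamma> 0 $ 1 $ 1) +
      (\<gamma> 0 $ 2 $ 1 * cnj (v $ 2 $ 1) + v $ 2 $ 1 * cnj (\<gamma> 0 $ 2 $ 1)) = 0"
    by (rule vector_derivative_unique_at[OF n])
  from arg_cong[OF this, of Re] show "Re (cnj (x $ 1 $ 1) * v $ 1 $ 1 + cnj (x $ 2 $ 1) * v $ 2 $ 1) = 0"
    using \<gamma>(2) by (simp add: algebra_simps)
qed

lemma frame_tangent:
  assumes "x \<in> SU2"
  shows "frame a x \<in> tangent x"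
  using exhaust_3[of a] by (auto simp: frame_simps algebra_simps intro!: tangentI assms)

lemma tangent_expand:
  assumes x: "x \<in> SU2" and v: "v \<in> tangent x"
  shows "v = (\<Sum>a\<in>UNIV. \<sigma> a x v *\<^sub>R frame a x)"
proof -
  define z w p q where "z = x $ 1 $ 1" and "w = x $ 2 $ 1" and "p = v $ 1 $ 1" and "q = v $ 2 $ 1"
  define W where "W = \<i> * (w * p - z * q)"
  have vv: "v = su2_matrix p q" using tangentD(1)[OF v] by (simp add: p_def q_def)
  have zw: "z * cnj z + w * cnj w = 1" using SU2_cnj[OF x] by (simp add: z_def w_def)
  have "Re (cnj z * p + cnj w * q) = 0" using tangentD(2)[OF v] by (simp add: z_def w_def p_def q_def)
  \<comment> \<open>The expression defining \<sigma>_3 is real on tangent vectors, so there its real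
    part may be replaced by the full complex number.\<close>
  then have 3: "of_real (\<sigma> 3 x v) = - \<i> * (cnj z * p + cnj w * q)"
    by (simp add: \<sigma>_simps z_def w_def p_def q_def complex_eq_iff)
  have 12: "of_real (\<sigma> 1 x v) + \<i> * of_real (\<sigma> 2 x v) = W"
    by (simp add: \<sigma>_simps W_def z_def w_def p_def q_def complex_eq_iff)
  have "(\<Sum>a\<in>UNIV. \<sigma> a x v *\<^sub>R frame a x) = su2_matrix
     (- \<i> * cnj w * (of_real (\<sigma> 1 x v) + \<i> * of_real (\<sigma> 2 x v)) + \<i> * z * of_real (\<sigma> 3 x v))
     (\<i> * cnj z * (of_real (\<sigma> 1 x v) + \<i> * of_real (\<sigma> 2 x v)) + \<i> * w * of_real (\<sigma> 3 x v))"
    by (simp add: sum_3 frame_simps su2_matrix_linear z_def w_def algebra_simps)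
  also have "\<dots> = su2_matrix ((z * cnj z + w * cnj w) * p) ((z * cnj z + w * cnj w) * q)"
    unfolding 3 12 W_def by (simp add: algebra_simps)
  finally show ?thesis by (simp add: zw vv)
qed

text \<open>A tangent vector is determined by its three \<sigma>-coordinates through
  \<open>tangent_expand\<close>, which settles uniqueness in the definite description.\<close>

lemma E_eq_frame:
  assumes x: "x \<in> SU2"
  shows "E b x = frame b x"
  unfolding E_def
proof (rule the_equality)
  show "frame b x \<in> tangent x \<and> (\<forall>a. \<sigma> a x (frame b x) = (if a = b then 1 else 0))"
    using x by (simp add: frame_tangent \<sigma>_frame)
next
  fix v assume v: "v \<in> tangent x \<and> (\<forall>a. \<sigma> a x v = (if a = b then 1 else 0))"
  then have "v = (\<Sum>a\<in>UNIV. (if a = b then 1 else 0) *\<^sub>R frame a x)"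
    using tangent_expand[OF x, of v] by simp
  also have "\<dots> = (\<Sum>a\<in>UNIV. if a = b then frame a x else 0)"
    by (intro sum.cong) auto
  also have "\<dots> = frame b x" by simp
  finally show "v = frame b x" .
qed

section \<open>Differentiation along the frame\<close>

text \<open>Within SU(2) a derivative on the ambient space is not unique, and
  \<open>differential\<close> is an arbitrary choice. Composing with a curve leads to derivatives in
  one real variable, which are unique, and so fixes the value on tangent vectors.\<close>

lemma differential_eq:
  assumes f: "(f has_derivative f') (at x within SU2)" and v: "v \<in> tangent x"
  shows "differential f x v = f' v"
proof -
  obtain \<gamma> where \<gamma>: "range \<gamma> \<subseteq> SU2" "\<gamma> 0 = x" "(\<gamma> has_vector_derivative v) (at (0::real))"
    using v unfolding tangent_def by auto
  have "((f \<circ> \<gamma>) has_derivative (D \<circ> (\<lambda>h. h *\<^sub>R v))) (at 0)"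
    if "(f has_derivative D) (at x within SU2)" for D
    using that \<gamma> by (intro diff_chain_within) (auto simp: has_vector_derivative_def intro: has_derivative_subset)
  moreover have "(f has_derivative differential f x) (at x within SU2)"
    using f unfolding differential_def by (metis differentiable_def frechet_derivative_works)
  ultimately have "(differential f x \<circ> (\<lambda>h. h *\<^sub>R v)) = (f' \<circ> (\<lambda>h. h *\<^sub>R v))"
    using f has_derivative_unique by blast
  from fun_cong[OF this, of 1] show ?thesis by simp
qed

lemma has_derivative_curve:
  assumes f: "(f has_derivative f') (at (\<gamma> s) within SU2)" and \<gamma>: "range \<gamma> \<subseteq> SU2"
    "(\<gamma> has_vector_derivative v) (at (s::real))"
  shows "((\<lambda>s. f (\<gamma> s)) has_vector_derivative differential f (\<gamma> s) v) (at s)"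
proof -
  \<comment> \<open>Tangency is witnessed by curves at parameter 0, hence the shifted parameter r +
    s.\<close>
  have "v \<in> tangent (\<gamma> s)"
    unfolding tangent_def
  proof (intro CollectI exI[of _ "\<lambda>r. \<gamma> (r + s)"] conjI)
    have "((\<gamma> \<circ> (\<lambda>r. r + s)) has_vector_derivative 1 *\<^sub>R v) (at 0)"
      using \<gamma>(2) by (intro vector_diff_chain_at) (auto intro!: derivative_eq_intros)
    then show "((\<lambda>r. \<gamma> (r + s)) has_vector_derivative v) (at 0)" by (simp add: o_def)
  qed (use \<gamma> in auto)
  then have "differential f (\<gamma> s) v = f' v" by (rule differential_eq[OF f])
  moreover have "((f \<circ> \<gamma>) has_derivative (f' \<circ> (\<lambda>h. h *\<^sub>R v))) (at s)"
    using f \<gamma> by (intro diff_chain_within) (auto simp: has_vector_derivative_def intro: has_derivative_subset)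
  ultimately show ?thesis
    using has_derivative_linear[OF f] by (simp add: has_vector_derivative_def o_def linear_cmul)
qed

section \<open>Calculus of \<open>C\<^sup>k\<close> maps\<close>

lemma Ck_on_subset:
  assumes "Ck_on k f U" "V \<subseteq> U"
  shows "Ck_on k f V"
  using assms(1)
proof (induction k arbitrary: f)
  case 0
  then show ?case using continuous_on_subset[OF _ assms(2)] by simp
next
  case (Suc k)
  have "Ck_on k (\<lambda>x. frechet_derivative f (at x) v) V" for v
    by (rule Suc.IH) (use Suc.prems in simp)
  then show ?case using Suc.prems assms(2) by auto
qed

text \<open>Openness matters: \<open>frechet_derivative\<close> at x depends on a full neighbourhood
  of x.\<close>

lemma Ck_on_cong:
  assumes "Ck_on k f U" "open U" "\<And>x. x \<in> U \<Longrightarrow> f x = g x"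
  shows "Ck_on k g U"
  using assms
proof (induction k arbitrary: f g)
  case 0
  then show ?case by (simp cong: continuous_on_cong)
next
  case (Suc k)
  have d: "(g has_derivative frechet_derivative f (at x)) (at x)" if "x \<in> U" for x
    using Suc.prems that
    by (intro has_derivative_transform_within_open[of f _ x UNIV U g]) (auto simp: frechet_derivative_works[symmetric])
  have e: "frechet_derivative f (at x) = frechet_derivative g (at x)" if "x \<in> U" for x
    by (rule frechet_derivative_at[OF d[OF that]])
  have f: "Ck_on k (\<lambda>x. frechet_derivative f (at x) v) U" for v
    using Suc.prems(1) by simp
  have "Ck_on k (\<lambda>x. frechet_derivative g (at x) v) U" for v
    by (rule Suc.IH[OF f Suc.prems(2)]) (simp add: e)
  moreover have "g differentiable (at x)" if "x \<in> U" for x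
    using d[OF that] by (rule differentiableI)
  ultimately show ?case by simp
qed

text \<open>Lets the derivative be supplied by the rules of calculus; uniqueness identifies it with
  \<open>frechet_derivative\<close>, in terms of which \<open>Ck_on\<close> is stated.\<close>

lemma Ck_on_SucI:
  assumes "open U" "\<And>x. x \<in> U \<Longrightarrow> (f has_derivative f' x) (at x)"
    "\<And>v. Ck_on k (\<lambda>x. f' x v) U"
  shows "Ck_on (Suc k) f U"
proof -
  have e: "f' x = frechet_derivative f (at x)" if "x \<in> U" for x
    by (rule frechet_derivative_at[OF assms(2)[OF that]])
  have "Ck_on k (\<lambda>x. frechet_derivative f (at x) v) U" for v
    by (rule Ck_on_cong[OF assms(3)[of v] assms(1)]) (simp add: e)
  then show ?thesis using assms(2) by (auto intro: differentiableI)
qed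

lemma Ck_on_SucD:
  assumes "Ck_on (Suc k) f U" "x \<in> U"
  shows "(f has_derivative frechet_derivative f (at x)) (at x)"
  using assms by (auto simp: frechet_derivative_works[symmetric])

lemma Ck_on_Suc_imp: "Ck_on (Suc k) f U \<Longrightarrow> Ck_on k f U"
proof (induction k arbitrary: f)
  case 0
  then show ?case
    by (auto intro!: continuous_at_imp_continuous_on differentiable_imp_continuous_within)
next
  case (Suc k)
  then show ?case by (metis Ck_on.simps(2))
qed

lemma Ck_on_const: "Ck_on k (\<lambda>x. c) U"
  by (induction k arbitrary: c) (simp_all add: frechet_derivative_const)

lemma Ck_on_bounded_linear:
  assumes "Ck_on k f U" "open U" "bounded_linear L"
  shows "Ck_on k (\<lambda>x. L (f x)) U"
  using assms(1)
proof (induction k arbitrary: f)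
  case 0
  then show ?case using assms(3) by (simp add: bounded_linear.continuous_on)
next
  case (Suc k)
  show ?case
    by (rule Ck_on_SucI[OF assms(2) bounded_linear.has_derivative[OF assms(3) Ck_on_SucD[OF Suc.prems]]])
       (use Suc in auto)
qed

lemma Ck_on_add:
  assumes "Ck_on k f U" "Ck_on k g U" "open U"
  shows "Ck_on k (\<lambda>x. f x + g x) U"
  using assms(1,2)
proof (induction k arbitrary: f g)
  case 0
  then show ?case by (simp add: continuous_on_add)
next
  case (Suc k)
  show ?case
    by (rule Ck_on_SucI[OF assms(3) has_derivative_add[OF Ck_on_SucD[OF Suc.prems(1)] Ck_on_SucD[OF Suc.prems(2)]]])
       (use Suc in auto)
qed

lemma Ck_on_mult:
  fixes f g :: "'a::euclidean_space \<Rightarrow> 'b::real_normed_algebra"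
  assumes "Ck_on k f U" "Ck_on k g U" "open U"
  shows "Ck_on k (\<lambda>x. f x * g x) U"
  using assms(1,2)
proof (induction k arbitrary: f g)
  case 0
  then show ?case by (simp add: continuous_on_mult)
next
  case (Suc k)
  \<comment> \<open>The product rule contains the undifferentiated factors, so these are needed at
    order k too.\<close>
  have k: "Ck_on k f U" "Ck_on k g U"
    using Suc.prems by (auto dest!: Ck_on_Suc_imp simp del: Ck_on.simps)
  have d: "Ck_on k (\<lambda>x. frechet_derivative f (at x) v) U" "Ck_on k (\<lambda>x. frechet_derivative g (at x) v) U" for v
    using Suc.prems by auto
  have "Ck_on k (\<lambda>x. f x * frechet_derivative g (at x) v + frechet_derivative f (at x) v * g x) U" for v
    by (rule Ck_on_add[OF Suc.IH[OF k(1) d(2)] Suc.IH[OF d(1) k(2)] assms(3)])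
  then show ?case
    by (intro Ck_on_SucI[OF assms(3) has_derivative_mult[OF Ck_on_SucD[OF Suc.prems(1)] Ck_on_SucD[OF Suc.prems(2)]]])
qed

lemma Ck_on_power:
  fixes f :: "'a::euclidean_space \<Rightarrow> 'b::real_normed_algebra_1"
  assumes "Ck_on k f U" "open U"
  shows "Ck_on k (\<lambda>x. f x ^ n) U"
  using assms by (induction n) (simp_all add: Ck_on_const Ck_on_mult)

lemma Ck_on_linear:
  assumes "bounded_linear f"
  shows "Ck_on k f UNIV"
proof (cases k)
  case 0
  then show ?thesis using assms by (simp add: linear_continuous_on)
next
  case (Suc m)
  show ?thesis unfolding Suc
    by (rule Ck_on_SucI[OF open_UNIV bounded_linear_imp_has_derivative[OF assms] Ck_on_const])
qed

lemma Ck_on_sum: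
  assumes "\<And>i. i \<in> I \<Longrightarrow> Ck_on k (f i) U" "open U"
  shows "Ck_on k (\<lambda>x. \<Sum>i\<in>I. f i x) U"
  using assms(1)
  by (induction I rule: infinite_finite_induct) (auto intro: Ck_on_const Ck_on_add assms(2))

section \<open>Maps on SU(2) through local extensions\<close>

lemma smooth_SU2E:
  assumes "smooth_SU2 f" "x \<in> SU2"
  obtains U F where "open U" "x \<in> U" "\<forall>k. Ck_on k F U" "\<forall>y\<in>U \<inter> SU2. F y = f y"
  using bspec[OF assms(1)[unfolded smooth_SU2_def] assms(2)] by (elim exE conjE) (rule that)

lemma Ck_SU2E:
  assumes "Ck_SU2 k f" "x \<in> SU2"
  obtains U F where "open U" "x \<in> U" "Ck_on k F U" "\<forall>y\<in>U \<inter> SU2. F y = f y"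
  using bspec[OF assms(1)[unfolded Ck_SU2_def] assms(2)] by (elim exE conjE) (rule that)

lemma smooth_imp_Ck:
  assumes "smooth_SU2 f"
  shows "Ck_SU2 k f"
  unfolding Ck_SU2_def
proof
  fix x assume x: "x \<in> SU2"
  obtain U F where "open U" "x \<in> U" "\<forall>k. Ck_on k F U" "\<forall>y\<in>U \<inter> SU2. F y = f y"
    by (rule smooth_SU2E[OF assms x])
  then show "\<exists>U F. open U \<and> x \<in> U \<and> Ck_on k F U \<and> (\<forall>y\<in>U \<inter> SU2. F y = f y)"
    by (intro exI[of _ U] exI[of _ F]) auto
qed

lemma smooth_SU2_global: "(\<And>k. Ck_on k f UNIV) \<Longrightarrow> smooth_SU2 f"
  unfolding smooth_SU2_def by (intro ballI exI[of _ UNIV] exI[of _ f]) simp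

lemma Ck_SU2_cong:
  assumes "Ck_SU2 k f" "\<And>x. x \<in> SU2 \<Longrightarrow> f x = g x"
  shows "Ck_SU2 k g"
  unfolding Ck_SU2_def
proof
  fix x assume x: "x \<in> SU2"
  obtain U F where "open U" "x \<in> U" "Ck_on k F U" "\<forall>y\<in>U \<inter> SU2. F y = f y"
    by (rule Ck_SU2E[OF assms(1) x])
  with assms(2) show "\<exists>U F. open U \<and> x \<in> U \<and> Ck_on k F U \<and> (\<forall>y\<in>U \<inter> SU2. F y = g y)"
    by (intro exI[of _ U] exI[of _ F]) auto
qed

lemma smooth_SU2_bounded_linear:
  assumes "smooth_SU2 f" "bounded_linear L"
  shows "smooth_SU2 (\<lambda>x. L (f x))"
  unfolding smooth_SU2_def
proof
  fix x assume x: "x \<in> SU2"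
  obtain U F where "open U" "x \<in> U" "\<forall>k. Ck_on k F U" "\<forall>y\<in>U \<inter> SU2. F y = f y"
    by (rule smooth_SU2E[OF assms(1) x])
  then show "\<exists>U F. open U \<and> x \<in> U \<and> (\<forall>k. Ck_on k F U) \<and> (\<forall>y\<in>U \<inter> SU2. F y = L (f y))"
    using Ck_on_bounded_linear[OF _ _ assms(2), of _ F U]
    by (intro exI[of _ U] exI[of _ "\<lambda>x. L (F x)"]) auto
qed

lemma Ck_SU2_bounded_linear:
  assumes "Ck_SU2 k f" "bounded_linear L"
  shows "Ck_SU2 k (\<lambda>x. L (f x))"
  unfolding Ck_SU2_def
proof
  fix x assume x: "x \<in> SU2"
  obtain U F where "open U" "x \<in> U" "Ck_on k F U" "\<forall>y\<in>U \<inter> SU2. F y = f y"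
    by (rule Ck_SU2E[OF assms(1) x])
  then show "\<exists>U F. open U \<and> x \<in> U \<and> Ck_on k F U \<and> (\<forall>y\<in>U \<inter> SU2. F y = L (f y))"
    using Ck_on_bounded_linear[OF _ _ assms(2), of _ F U]
    by (intro exI[of _ U] exI[of _ "\<lambda>x. L (F x)"]) auto
qed

lemma smooth_SU2_diff:
  assumes "smooth_SU2 f" "smooth_SU2 g"
  shows "smooth_SU2 (\<lambda>x. f x - g x)"
  unfolding smooth_SU2_def
proof
  fix x assume x: "x \<in> SU2"
  obtain U F where U: "open U" "x \<in> U" "\<forall>k. Ck_on k F U" "\<forall>y\<in>U \<inter> SU2. F y = f y"
    by (rule smooth_SU2E[OF assms(1) x])
  obtain V G where V: "open V" "x \<in> V" "\<forall>k. Ck_on k G V" "\<forall>y\<in>V \<inter> SU2. G y = g y"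
    by (rule smooth_SU2E[OF assms(2) x])
  have "Ck_on k (\<lambda>x. F x + - G x) (U \<inter> V)" for k
    using U(1,3) V(1,3) Ck_on_subset[of k F U "U \<inter> V"] Ck_on_subset[of k G V "U \<inter> V"]
    by (intro Ck_on_add Ck_on_bounded_linear[OF _ _ bounded_linear_minus[OF bounded_linear_ident]]) auto
  then show "\<exists>U F. open U \<and> x \<in> U \<and> (\<forall>k. Ck_on k F U) \<and> (\<forall>y\<in>U \<inter> SU2. F y = f y - g y)"
    using U V by (intro exI[of _ "U \<inter> V"] exI[of _ "\<lambda>x. F x + - G x"]) auto
qed

lemma Ck_SU2_add:
  assumes "Ck_SU2 k f" "Ck_SU2 k g"
  shows "Ck_SU2 k (\<lambda>x. f x + g x)"
  unfolding Ck_SU2_def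
proof
  fix x assume x: "x \<in> SU2"
  obtain U F where U: "open U" "x \<in> U" "Ck_on k F U" "\<forall>y\<in>U \<inter> SU2. F y = f y"
    by (rule Ck_SU2E[OF assms(1) x])
  obtain V G where V: "open V" "x \<in> V" "Ck_on k G V" "\<forall>y\<in>V \<inter> SU2. G y = g y"
    by (rule Ck_SU2E[OF assms(2) x])
  have "Ck_on k (\<lambda>x. F x + G x) (U \<inter> V)"
    using U(1,3) V(1,3) Ck_on_subset[of k F U "U \<inter> V"] Ck_on_subset[of k G V "U \<inter> V"]
    by (intro Ck_on_add) auto
  then show "\<exists>U F. open U \<and> x \<in> U \<and> Ck_on k F U \<and> (\<forall>y\<in>U \<inter> SU2. F y = f y + g y)"
    using U V by (intro exI[of _ "U \<inter> V"] exI[of _ "\<lambda>x. F x + G x"]) auto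
qed

lemma Ck_SU2_mult:
  fixes f g :: "cmat2 \<Rightarrow> 'b::real_normed_algebra"
  assumes "Ck_SU2 k f" "Ck_SU2 k g"
  shows "Ck_SU2 k (\<lambda>x. f x * g x)"
  unfolding Ck_SU2_def
proof
  fix x assume x: "x \<in> SU2"
  obtain U F where U: "open U" "x \<in> U" "Ck_on k F U" "\<forall>y\<in>U \<inter> SU2. F y = f y"
    by (rule Ck_SU2E[OF assms(1) x])
  obtain V G where V: "open V" "x \<in> V" "Ck_on k G V" "\<forall>y\<in>V \<inter> SU2. G y = g y"
    by (rule Ck_SU2E[OF assms(2) x])
  have "Ck_on k (\<lambda>x. F x * G x) (U \<inter> V)"
    using U(1,3) V(1,3) Ck_on_subset[of k F U "U \<inter> V"] Ck_on_subset[of k G V "U \<inter> V"]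
    by (intro Ck_on_mult) auto
  then show "\<exists>U F. open U \<and> x \<in> U \<and> Ck_on k F U \<and> (\<forall>y\<in>U \<inter> SU2. F y = f y * g y)"
    using U V by (intro exI[of _ "U \<inter> V"] exI[of _ "\<lambda>x. F x * G x"]) auto
qed

lemma Ck_SU2_const: "Ck_SU2 k (\<lambda>x. c)"
  by (intro smooth_imp_Ck smooth_SU2_global Ck_on_const)

lemma has_derivative_local_extension:
  assumes "(F has_derivative F') (at x)" "open U" "x \<in> U \<inter> SU2" "\<forall>y\<in>U \<inter> SU2. F y = f y"
  shows "(f has_derivative F') (at x within SU2)"
proof -
  obtain e where e: "e > 0" "ball x e \<subseteq> U" using assms by (meson IntE openE)
  show ?thesis
    by (rule has_derivative_transform_within[OF has_derivative_at_withinI[OF assms(1)] e(1)])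
       (use assms e in \<open>auto simp: dist_commute subset_eq\<close>)
qed

lemma C1_has_derivative:
  assumes "Ck_SU2 1 f" "x \<in> SU2"
  shows "(f has_derivative differential f x) (at x within SU2)"
proof -
  obtain U F where U: "open U" "x \<in> U" "Ck_on 1 F U" "\<forall>y\<in>U \<inter> SU2. F y = f y"
    by (rule Ck_SU2E[OF assms])
  then have "(f has_derivative frechet_derivative F (at x)) (at x within SU2)"
    using assms(2) Ck_on_SucD[of 0 F U x] by (intro has_derivative_local_extension[of F]) (auto simp del: Ck_on.simps)
  then show ?thesis
    unfolding differential_def by (metis differentiable_def frechet_derivative_works)
qed

lemma C1_continuous_on:
  assumes "Ck_SU2 1 f"
  shows "continuous_on SU2 f"
  unfolding continuous_on_eq_continuous_within
  using C1_has_derivative[OF assms] has_derivative_continuous by blast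

lemma Ck_continuous_on:
  assumes "Ck_SU2 0 f"
  shows "continuous_on SU2 f"
  unfolding continuous_on_eq_continuous_within
proof
  fix x assume x: "x \<in> SU2"
  obtain U F where "open U" "x \<in> U" "Ck_on 0 F U" "\<forall>y\<in>U \<inter> SU2. F y = f y"
    by (rule Ck_SU2E[OF assms x])
  then have U: "open U" "x \<in> U" "continuous_on U F" "\<forall>y\<in>U \<inter> SU2. F y = f y" by simp_all
  obtain e where e: "e > 0" "ball x e \<subseteq> U" using U by (meson openE)
  have "continuous (at x within SU2) F"
    using U by (simp add: continuous_at_imp_continuous_within continuous_on_eq_continuous_at)
  then show "continuous (at x within SU2) f"
    by (rule continuous_transform_within[OF _ e(1) x]) (use U e in \<open>auto simp: dist_commute subset_eq\<close>)
qed

lemma smooth_continuous_on: "smooth_SU2 f \<Longrightarrow> continuous_on SU2 f"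
  by (intro Ck_continuous_on smooth_imp_Ck)

section \<open>Derivatives along the frame fields\<close>

definition along :: "3 \<Rightarrow> (cmat2 \<Rightarrow> 'b::real_normed_vector) \<Rightarrow> cmat2 \<Rightarrow> 'b" where
  "along a f x = differential f x (E a x)"

lemma along_eq:
  assumes "(f has_derivative f') (at x within SU2)" "x \<in> SU2"
  shows "along a f x = f' (frame a x)"
  unfolding along_def E_eq_frame[OF assms(2)]
  by (rule differential_eq[OF assms(1) frame_tangent[OF assms(2)]])

lemma differential_expand:
  assumes f: "Ck_SU2 1 f" and x: "x \<in> SU2" and v: "v \<in> tangent x"
  shows "differential f x v = (\<Sum>a\<in>UNIV. \<sigma> a x v *\<^sub>R along a f x)"
proof -
  interpret bounded_linear "differential f x"
    using C1_has_derivative[OF f x] by (rule has_derivative_bounded_linear)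
  have "differential f x v = differential f x (\<Sum>a\<in>UNIV. \<sigma> a x v *\<^sub>R frame a x)"
    using tangent_expand[OF x v] by simp
  then show ?thesis by (simp add: sum scaleR along_def E_eq_frame[OF x])
qed

text \<open>Formulas for derivatives hold on SU(2) only and are not equalities of functions; this
  allows substituting them before differentiating again.\<close>

lemma along_cong:
  assumes "Ck_SU2 1 f" "\<And>y. y \<in> SU2 \<Longrightarrow> f y = g y" "x \<in> SU2"
  shows "along a f x = along a g x"
proof -
  have "(g has_derivative differential f x) (at x within SU2)"
    by (rule has_derivative_transform[OF assms(3) _ C1_has_derivative[OF assms(1,3)]]) (simp add: assms(2))
  from along_eq[OF this assms(3)] along_eq[OF C1_has_derivative[OF assms(1,3)] assms(3)]
  show ?thesis by simp
qed

lemma along_bounded_linear: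
  assumes "Ck_SU2 1 f" "bounded_linear L" "x \<in> SU2"
  shows "along a (\<lambda>x. L (f x)) x = L (along a f x)"
  using along_eq[OF bounded_linear.has_derivative[OF assms(2) C1_has_derivative[OF assms(1,3)]] assms(3)]
    along_eq[OF C1_has_derivative[OF assms(1,3)] assms(3)] by simp

lemma along_add:
  assumes "Ck_SU2 1 f" "Ck_SU2 1 g" "x \<in> SU2"
  shows "along a (\<lambda>x. f x + g x) x = along a f x + along a g x"
  using along_eq[OF has_derivative_add[OF C1_has_derivative[OF assms(1,3)] C1_has_derivative[OF assms(2,3)]] assms(3)]
    along_eq[OF C1_has_derivative[OF assms(1,3)] assms(3)]
    along_eq[OF C1_has_derivative[OF assms(2,3)] assms(3)] by simp

lemma along_mult:
  fixes f g :: "cmat2 \<Rightarrow> 'b::real_normed_algebra"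
  assumes "Ck_SU2 1 f" "Ck_SU2 1 g" "x \<in> SU2"
  shows "along a (\<lambda>x. f x * g x) x = f x * along a g x + along a f x * g x"
  using along_eq[OF has_derivative_mult[OF C1_has_derivative[OF assms(1,3)] C1_has_derivative[OF assms(2,3)]] assms(3)]
    along_eq[OF C1_has_derivative[OF assms(1,3)] assms(3)]
    along_eq[OF C1_has_derivative[OF assms(2,3)] assms(3)] by simp

lemma along_const [simp]: "x \<in> SU2 \<Longrightarrow> along a (\<lambda>x. c) x = 0"
  by (subst along_eq[OF has_derivative_const]) auto

lemma continuous_on_frame: "continuous_on S (frame a)"
proof -
  have "continuous_on S (\<lambda>x. x $ i $ j)" for i j :: 2 and S :: "cmat2 set"
    by (rule linear_continuous_on[OF bounded_linear_entry])
  moreover have "frame a = (\<lambda>x. frame a x)" ..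
  ultimately show ?thesis
    using exhaust_3[of a]
    by (auto simp: frame_simps[abs_def] intro!: continuous_intros)
qed

lemma continuous_on_along:
  assumes f: "Ck_SU2 1 f"
  shows "continuous_on SU2 (along a f)"
  unfolding continuous_on_eq_continuous_within
proof
  fix x assume x: "x \<in> SU2"
  obtain U F where U: "open U" "x \<in> U" "Ck_on 1 F U" "\<forall>y\<in>U \<inter> SU2. F y = f y"
    by (rule Ck_SU2E[OF f x])
  obtain e where e: "e > 0" "ball x e \<subseteq> U" using U by (meson openE)
  have dF: "(F has_derivative frechet_derivative F (at y)) (at y)" if "y \<in> U" for y
    using U(3) that Ck_on_SucD[of 0 F U y] by (simp del: Ck_on.simps)
  \<comment> \<open>\<open>Ck_on\<close> gives continuity of the derivative in each fixed direction,
    while the frame vector moves with y; expanding it in the ambient basis separates the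
    two.\<close>
  have eq: "along a f y = (\<Sum>b\<in>Basis. (frame a y \<bullet> b) *\<^sub>R frechet_derivative F (at y) b)"
    if "y \<in> U" "y \<in> SU2" for y
  proof -
    have "along a f y = frechet_derivative F (at y) (frame a y)"
      using that U by (intro along_eq has_derivative_local_extension[of F]) (auto simp: dF)
    also have "\<dots> = frechet_derivative F (at y) (\<Sum>b\<in>Basis. (frame a y \<bullet> b) *\<^sub>R b)"
      by (simp add: euclidean_representation)
    finally show ?thesis
      using has_derivative_linear[OF dF[OF that(1)]] by (simp add: linear_sum linear_cmul)
  qed
  have "continuous_on U (\<lambda>y. \<Sum>b\<in>Basis. (frame a y \<bullet> b) *\<^sub>R frechet_derivative F (at y) b)"
    using U(3) by (intro continuous_intros continuous_on_frame) simp
  then have "continuous (at x within SU2) (\<lambda>y. \<Sum>b\<in>Basis. (frame a y \<bullet> b) *\<^sub>R frechet_derivative F (at y) b)"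
    using U by (metis (no_types, lifting) continuous_at_imp_continuous_within continuous_on_eq_continuous_at)
  then show "continuous (at x within SU2) (along a f)"
    by (rule continuous_transform_within[OF _ e(1) x]) (use e in \<open>auto simp: dist_commute subset_eq eq\<close>)
qed

section \<open>Integration over boxes in \<open>\<real>\<^sup>3\<close>\<close>

definition coords :: "3 \<Rightarrow> 3 \<Rightarrow> 3 \<Rightarrow> real \<times> real \<times> real \<Rightarrow> real ^ 3" where
  "coords i j k q = fst q *\<^sub>R axis i 1 + (fst (snd q) *\<^sub>R axis j 1 + snd (snd q) *\<^sub>R axis k 1)"

lemma coords_nth:
  "coords i j k q $ l = (if l = i then fst q else 0) + ((if l = j then fst (snd q) else 0) + (if l = k then snd (snd q) else 0))"
  by (simp add: coords_def axis_def)

lemma continuous_on_coords [continuous_intros]: "continuous_on S (coords i j k)"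
  unfolding coords_def[abs_def] by (intro continuous_intros)

text \<open>Lebesgue measure is determined by its values on boxes, whose preimages are products of
  intervals. Any coordinate i can be put first, so that Fubini makes it the inner variable.\<close>

lemma lborel_real3:
  assumes d: "distinct [i, j, k]"
  shows "distr (lborel \<Otimes>\<^sub>M (lborel \<Otimes>\<^sub>M lborel)) borel (coords i j k) = lborel"
proof (rule lborel_eqI[symmetric])
  have U: "(UNIV :: 3 set) = {i, j, k}"
    using d exhaust_3 by (intro card_seteq[symmetric]) auto
  fix l u :: "real ^ 3"
  assume "\<And>b. b \<in> Basis \<Longrightarrow> l \<bullet> b \<le> u \<bullet> b"
  then have le: "l $ m \<le> u $ m" for m
    by (metis axis_in_Basis_iff cart_eq_inner_axis Basis_real_def singletonI)
  have m: "coords i j k \<in> borel_measurable (lborel \<Otimes>\<^sub>M (lborel \<Otimes>\<^sub>M lborel))"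
    by (simp add: lborel_prod borel_measurable_continuous_onI continuous_on_coords)
  have box: "coords i j k -` box l u =
      {l $ i<..<u $ i} \<times> ({l $ j<..<u $ j} \<times> {l $ k<..<u $ k})"
    using d by (auto simp: mem_box_cart coords_nth U all_conj_distrib split: if_splits)
       (metis (full_types) U UNIV_I insertE singletonD)+
  have "emeasure (distr (lborel \<Otimes>\<^sub>M (lborel \<Otimes>\<^sub>M lborel)) borel (coords i j k)) (box l u) =
      emeasure (lborel \<Otimes>\<^sub>M (lborel \<Otimes>\<^sub>M lborel))
        ({l $ i<..<u $ i} \<times> ({l $ j<..<u $ j} \<times> {l $ k<..<u $ k}))"
    by (subst emeasure_distr[OF m]) (simp_all add: box space_pair_measure)
  also have "\<dots> = ennreal (u $ i - l $ i) * (ennreal (u $ j - l $ j) * ennreal (u $ k - l $ k))"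
  proof -
    have "sigma_finite_measure (lborel \<Otimes>\<^sub>M lborel :: (real \<times> real) measure)"
      unfolding lborel_prod by unfold_locales
    then show ?thesis
      by (simp add: sigma_finite_measure.emeasure_pair_measure_Times lborel.emeasure_pair_measure_Times le)
  qed
  also have "\<dots> = ennreal ((u $ i - l $ i) * ((u $ j - l $ j) * (u $ k - l $ k)))"
    using le by (simp add: ennreal_mult)
  also have "(u $ i - l $ i) * ((u $ j - l $ j) * (u $ k - l $ k)) = (\<Prod>m\<in>UNIV. (u - l) $ m)"
    unfolding U using d by simp
  also have "\<dots> = (\<Prod>b\<in>Basis. (u - l) \<bullet> b)"
    by (simp add: Basis_vec_def cart_eq_inner_axis axis_eq_axis prod.UNION_disjoint)
  finally show "emeasure (distr (lborel \<Otimes>\<^sub>M (lborel \<Otimes>\<^sub>M lborel)) borel (coords i j k)) (box l u) =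
      (\<Prod>b\<in>Basis. (u - l) \<bullet> b)" .
qed simp

lemma set_integrable_box:
  fixes g :: "'a::euclidean_space \<Rightarrow> 'b::{banach, second_countable_topology}"
  assumes "continuous_on UNIV g"
  shows "set_integrable lborel (box lo hi) g"
  by (rule set_integrable_subset[of lborel "cbox lo hi"])
     (use assms box_subset_cbox in \<open>auto simp: set_integrable_def
       intro!: borel_integrable_compact continuous_on_subset[OF assms]\<close>)

lemma LBINT_FTC:
  fixes G g :: "real \<Rightarrow> real"
  assumes "\<And>x. (G has_real_derivative g x) (at x)" "continuous_on UNIV g" "a \<le> b"
  shows "(\<integral>x. indicator {a<..<b} x *\<^sub>R g x \<partial>lborel) = G b - G a"
proof -
  have "set_integrable lborel {a<..<b} g"
    using set_integrable_box[OF assms(2), of a b] by simp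
  then have "(\<integral>x. indicator {a<..<b} x *\<^sub>R g x \<partial>lborel) = integral {a<..<b} g"
    unfolding set_lebesgue_integral_def[symmetric] by (rule set_borel_integral_eq_integral(2))
  also have "\<dots> = integral {a..b} g"
    using integral_open_interval[of a b g] by simp
  also have "\<dots> = G b - G a"
    using assms by (intro integral_unique fundamental_theorem_of_calculus)
      (auto simp: has_real_derivative_iff_has_vector_derivative has_vector_derivative_at_within)
  finally show ?thesis .
qed

text \<open>Fubini with the i-th variable innermost, then the fundamental theorem of calculus. The
  hypothesis \<open>eq\<close> on opposite faces covers both ways in which boundary terms cancel
  later: periodicity, and vanishing on both faces.\<close>

lemma integral_partial_derivative:
  fixes G g :: "real ^ 3 \<Rightarrow> real"
  assumes G: "\<And>p. ((\<lambda>s. G (p + s *\<^sub>R axis i 1)) has_real_derivative g p) (at 0)"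
    and g: "continuous_on UNIV g"
    and le: "lo $ i \<le> hi $ i"
    and eq: "\<And>p. p $ i = lo $ i \<Longrightarrow> G (p + (hi $ i - lo $ i) *\<^sub>R axis i 1) = G p"
  shows "(\<integral>p. indicator (box lo hi) p *\<^sub>R g p \<partial>lborel) = 0"
proof -
  \<comment> \<open>Arithmetic in the index type is modulo 3, so i, i + 1, i + 2 are the three
    indices.\<close>
  have "\<exists>j k. distinct [i, j, k]"
    by (rule exI[of _ "i + 1"], rule exI[of _ "i + 2"]) (use exhaust_3[of i] in auto)
  then obtain j k where d: "distinct [i, j, k]" by blast
  have U: "(UNIV :: 3 set) = {i, j, k}"
    using d exhaust_3 by (intro card_seteq[symmetric]) auto
  let ?L = "lborel \<Otimes>\<^sub>M (lborel \<Otimes>\<^sub>M lborel) :: (real \<times> real \<times> real) measure"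
  let ?h = "\<lambda>p. indicator (box lo hi) p *\<^sub>R g p"
  have m: "coords i j k \<in> measurable ?L borel"
    by (simp add: lborel_prod borel_measurable_continuous_onI continuous_on_coords)
  have h: "integrable lborel ?h"
    using set_integrable_box[OF g] by (simp add: set_integrable_def)
  then have hb: "?h \<in> borel_measurable borel" by (metis borel_measurable_integrable measurable_lborel2)
  have "integrable (distr ?L borel (coords i j k)) ?h" using h by (simp add: lborel_real3[OF d])
  then have int: "integrable ?L (\<lambda>q. ?h (coords i j k q))"
    by (subst (asm) integrable_distr_eq[OF m hb])
  have "(\<integral>p. ?h p \<partial>lborel) = (\<integral>p. ?h p \<partial>(distr ?L borel (coords i j k)))"
    by (simp add: lborel_real3[OF d])
  also have "\<dots> = (\<integral>q. ?h (coords i j k q) \<partial>?L)"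
    by (rule integral_distr[OF m hb])
  also have "\<dots> = (\<integral>r. (\<integral>x. ?h (coords i j k (x, r)) \<partial>lborel) \<partial>(lborel \<Otimes>\<^sub>M lborel))"
  proof -
    interpret pair_sigma_finite "lborel :: real measure" "lborel \<Otimes>\<^sub>M lborel :: (real \<times> real) measure"
      unfolding lborel_prod by unfold_locales
    show ?thesis
      using integral_snd[of "\<lambda>x r. ?h (coords i j k (x, r))"] int by (simp add: case_prod_unfold)
  qed
  also have "\<dots> = 0"
  proof -
    have "(\<integral>x. ?h (coords i j k (x, r)) \<partial>lborel) = 0" for r
    proof (cases "fst r \<in> {lo $ j<..<hi $ j} \<and> snd r \<in> {lo $ k<..<hi $ k}")
      case False
      then have "coords i j k (x, r) \<notin> box lo hi" for x
        using d by (auto simp: mem_box_cart coords_nth dest: spec[of _ j] spec[of _ k])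
      then show ?thesis by simp
    next
      case True
      have shift: "coords i j k (x, r) + s *\<^sub>R axis i 1 = coords i j k (x + s, r)" for x s
        by (simp add: coords_def algebra_simps)
      have "((\<lambda>s. G (coords i j k (s + x, r))) has_real_derivative g (coords i j k (x, r))) (at 0)" for x
        using G[of "coords i j k (x, r)"] unfolding shift by (simp only: add.commute)
      then have "((\<lambda>x. G (coords i j k (x, r))) has_real_derivative g (coords i j k (x, r))) (at x)" for x
        using DERIV_shift[of "\<lambda>x. G (coords i j k (x, r))" _ 0 x] by simp
      moreover have "continuous_on UNIV (\<lambda>x. g (coords i j k (x, r)))"
        unfolding coords_def by (intro continuous_on_compose2[OF g] continuous_intros) auto
      ultimately have "(\<integral>x. indicator {lo $ i<..<hi $ i} x *\<^sub>R g (coords i j k (x, r)) \<partial>lborel) =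
          G (coords i j k (hi $ i, r)) - G (coords i j k (lo $ i, r))"
        by (rule LBINT_FTC) (rule le)
      also have "\<dots> = 0"
        using eq[of "coords i j k (lo $ i, r)"] d by (simp add: shift coords_nth)
      finally have "(\<integral>x. indicator {lo $ i<..<hi $ i} x *\<^sub>R g (coords i j k (x, r)) \<partial>lborel) = 0" .
      moreover have "coords i j k (x, r) \<in> box lo hi \<longleftrightarrow> x \<in> {lo $ i<..<hi $ i}" for x
      proof -
        have "coords i j k (x, r) \<in> box lo hi \<longleftrightarrow>
            (\<forall>m\<in>{i, j, k}. lo $ m < coords i j k (x, r) $ m \<and> coords i j k (x, r) $ m < hi $ m)"
          by (simp add: mem_box_cart flip: U)
        then show ?thesis using True d by (auto simp: coords_nth)
      qed
      ultimately show ?thesis by (simp add: indicator_def)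
    qed
    then show ?thesis by simp
  qed
  finally show ?thesis .
qed

section \<open>Hopf coordinates and the Riemannian volume\<close>

text \<open>The i-th coordinate vector field of \<open>hopf_coords\<close>, as an explicit
  matrix.\<close>

definition hopf_vec :: "3 \<Rightarrow> real ^ 3 \<Rightarrow> cmat2" where
  "hopf_vec i p =
     (if i = 1 then su2_matrix (- of_real (sin (p $ 1)) * cis (p $ 2)) (of_real (cos (p $ 1)) * cis (p $ 3))
      else if i = 2 then su2_matrix (\<i> * of_real (cos (p $ 1)) * cis (p $ 2)) 0
      else su2_matrix 0 (\<i> * of_real (sin (p $ 1)) * cis (p $ 3)))"

lemma hopf_vec_simps:
  "hopf_vec 1 p = su2_matrix (- of_real (sin (p $ 1)) * cis (p $ 2)) (of_real (cos (p $ 1)) * cis (p $ 3))"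
  "hopf_vec 2 p = su2_matrix (\<i> * of_real (cos (p $ 1)) * cis (p $ 2)) 0"
  "hopf_vec 3 p = su2_matrix 0 (\<i> * of_real (sin (p $ 1)) * cis (p $ 3))"
  by (simp_all add: hopf_vec_def)

lemma hopf_in_SU2 [simp]: "hopf_coords p \<in> SU2"
  by (simp add: hopf_coords_def norm_mult)

lemma cis_has_derivative:
  assumes "(f has_derivative f') (at x within S)"
  shows "((\<lambda>x. cis (f x)) has_derivative (\<lambda>h. f' h *\<^sub>R (\<i> * cis (f x)))) (at x within S)"
proof -
  have "(cis has_vector_derivative \<i> * cis (f x)) (at (f x) within f ` S)"
    unfolding has_vector_derivative_complex_iff
    by (auto intro!: derivative_eq_intros simp: has_real_derivative_iff_has_vector_derivative[symmetric] cis.code Im_divide)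
  then show ?thesis
    using diff_chain_within[OF assms, of cis] by (simp add: has_vector_derivative_def o_def)
qed

lemma hopf_has_derivative:
  "(hopf_coords has_derivative (\<lambda>h. \<Sum>i\<in>UNIV. h $ i *\<^sub>R hopf_vec i p)) (at p)"
proof -
  have n: "((\<lambda>p. p $ i) has_derivative (\<lambda>h. h $ i)) (at p)" for i :: 3
    by (intro bounded_linear_imp_has_derivative bounded_linear_vec_nth)
  have c: "((\<lambda>p. complex_of_real (cos (p $ 1))) has_derivative
      (\<lambda>h. of_real (- (h $ 1 * sin (p $ 1))))) (at p)"
    by (rule bounded_linear.has_derivative[OF bounded_linear_of_real])
       (auto intro!: derivative_eq_intros n)
  have s: "((\<lambda>p. complex_of_real (sin (p $ 1))) has_derivative
      (\<lambda>h. of_real (h $ 1 * cos (p $ 1)))) (at p)"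
    by (rule bounded_linear.has_derivative[OF bounded_linear_of_real])
       (auto intro!: derivative_eq_intros n)
  have "(hopf_coords has_derivative (\<lambda>h. su2_matrix
       (of_real (cos (p $ 1)) * (h $ 2 *\<^sub>R (\<i> * cis (p $ 2))) + of_real (- (h $ 1 * sin (p $ 1))) * cis (p $ 2))
       (of_real (sin (p $ 1)) * (h $ 3 *\<^sub>R (\<i> * cis (p $ 3))) + of_real (h $ 1 * cos (p $ 1)) * cis (p $ 3)))) (at p)"
    unfolding hopf_coords_def[abs_def]
    by (intro has_derivative_su2_matrix has_derivative_mult c s cis_has_derivative n)
  moreover have "su2_matrix
       (of_real (cos (p $ 1)) * (h $ 2 *\<^sub>R (\<i> * cis (p $ 2))) + of_real (- (h $ 1 * sin (p $ 1))) * cis (p $ 2))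
       (of_real (sin (p $ 1)) * (h $ 3 *\<^sub>R (\<i> * cis (p $ 3))) + of_real (h $ 1 * cos (p $ 1)) * cis (p $ 3)) =
      (\<Sum>i\<in>UNIV. h $ i *\<^sub>R hopf_vec i p)" for h :: "real ^ 3"
    by (simp add: sum_3 hopf_vec_simps su2_matrix_linear scaleR_conv_of_real[where 'a = complex] algebra_simps)
  ultimately show ?thesis by simp
qed

lemma hopf_partial:
  "frechet_derivative hopf_coords (at p) (axis i 1) = hopf_vec i p"
proof -
  have "frechet_derivative hopf_coords (at p) = (\<lambda>h. \<Sum>i\<in>UNIV. h $ i *\<^sub>R hopf_vec i p)"
    using frechet_derivative_at[OF hopf_has_derivative] by simp
  moreover have "(\<Sum>j\<in>UNIV. (axis i 1 :: real ^ 3) $ j *\<^sub>R hopf_vec j p) = (\<Sum>j\<in>UNIV. if j = i then hopf_vec j p else 0)"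
    by (intro sum.cong) (auto simp: axis_def)
  ultimately show ?thesis by simp
qed

lemma hopf_has_vector_derivative:
  "((\<lambda>s. hopf_coords (p + s *\<^sub>R axis i 1)) has_vector_derivative hopf_vec i (p + s *\<^sub>R axis i 1)) (at s)"
proof -
  have l: "((\<lambda>s. p + s *\<^sub>R axis i 1) has_derivative (\<lambda>h. h *\<^sub>R axis i (1::real))) (at s)"
    by (auto intro!: derivative_eq_intros)
  have "(\<lambda>h. \<Sum>j\<in>UNIV. (h *\<^sub>R axis i (1::real)) $ j *\<^sub>R hopf_vec j q) = (\<lambda>h. h *\<^sub>R hopf_vec i q)" for q
  proof
    fix h
    have "(\<Sum>j\<in>UNIV. (h *\<^sub>R axis i (1::real)) $ j *\<^sub>R hopf_vec j q) = (\<Sum>j\<in>UNIV. if j = i then h *\<^sub>R hopf_vec j q else 0)"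
      by (intro sum.cong) (auto simp: axis_def)
    then show "(\<Sum>j\<in>UNIV. (h *\<^sub>R axis i (1::real)) $ j *\<^sub>R hopf_vec j q) = h *\<^sub>R hopf_vec i q" by simp
  qed
  then show ?thesis
    using has_derivative_compose[OF l hopf_has_derivative] by (simp add: has_vector_derivative_def)
qed

lemma continuous_on_hopf: "continuous_on S hopf_coords"
  using hopf_has_derivative by (intro continuous_at_imp_continuous_on) (auto intro: has_derivative_continuous)

lemma hopf_vec_tangent: "hopf_vec i p \<in> tangent (hopf_coords p)"
  using exhaust_3[of i]
  by (auto simp: hopf_vec_simps intro!: tangentI hopf_in_SU2) (simp_all add: hopf_coords_def algebra_simps,
      simp flip: distrib_left power2_eq_square)

lemma \<sigma>_hopf_vec:
  fixes p :: "real ^ 3"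
  defines "s \<equiv> sin (p $ 1)" and "c \<equiv> cos (p $ 1)" and "\<theta> \<equiv> p $ 2 + p $ 3"
  shows "\<sigma> 1 (hopf_coords p) (hopf_vec 1 p) = sin \<theta>" "\<sigma> 2 (hopf_coords p) (hopf_vec 1 p) = - cos \<theta>"
    "\<sigma> 3 (hopf_coords p) (hopf_vec 1 p) = 0"
    "\<sigma> 1 (hopf_coords p) (hopf_vec 2 p) = - (s * c * cos \<theta>)" "\<sigma> 2 (hopf_coords p) (hopf_vec 2 p) = - (s * c * sin \<theta>)"
    "\<sigma> 3 (hopf_coords p) (hopf_vec 2 p) = c\<^sup>2"
    "\<sigma> 1 (hopf_coords p) (hopf_vec 3 p) = s * c * cos \<theta>" "\<sigma> 2 (hopf_coords p) (hopf_vec 3 p) = s * c * sin \<theta>"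
    "\<sigma> 3 (hopf_coords p) (hopf_vec 3 p) = s\<^sup>2"
proof -
  have sc: "s * s + c * c = 1" by (simp add: s_def c_def flip: power2_eq_square)
  have q: "x * (s * s) + x * (c * c) = x" for x using sc by (simp flip: distrib_left)
  show "\<sigma> 1 (hopf_coords p) (hopf_vec 1 p) = sin \<theta>"
    using q[of "cos (p $ 2) * sin (p $ 3)"] q[of "sin (p $ 2) * cos (p $ 3)"]
    by (simp add: \<sigma>_simps hopf_vec_simps hopf_coords_def \<theta>_def sin_add flip: s_def c_def) (simp add: algebra_simps)
  show "\<sigma> 2 (hopf_coords p) (hopf_vec 1 p) = - cos \<theta>"
    using q[of "cos (p $ 2) * cos (p $ 3)"] q[of "sin (p $ 2) * sin (p $ 3)"]
    by (simp add: \<sigma>_simps hopf_vec_simps hopf_coords_def \<theta>_def cos_add flip: s_def c_def) (simp add: algebra_simps)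
  show "\<sigma> 3 (hopf_coords p) (hopf_vec 1 p) = 0"
    unfolding \<sigma>_simps hopf_vec_simps hopf_coords_def by (simp add: algebra_simps)
  show "\<sigma> 1 (hopf_coords p) (hopf_vec 2 p) = - (s * c * cos \<theta>)" "\<sigma> 2 (hopf_coords p) (hopf_vec 2 p) = - (s * c * sin \<theta>)"
    "\<sigma> 1 (hopf_coords p) (hopf_vec 3 p) = s * c * cos \<theta>" "\<sigma> 2 (hopf_coords p) (hopf_vec 3 p) = s * c * sin \<theta>"
    by (simp_all add: \<sigma>_simps hopf_vec_simps hopf_coords_def \<theta>_def cos_add sin_add flip: s_def c_def)
       (simp_all add: algebra_simps)
  have "\<sigma> 3 (hopf_coords p) (hopf_vec 2 p) = c\<^sup>2 * ((cos (p $ 2))\<^sup>2 + (sin (p $ 2))\<^sup>2)"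
    unfolding \<sigma>_simps hopf_vec_simps hopf_coords_def c_def by (simp add: power2_eq_square algebra_simps)
  then show "\<sigma> 3 (hopf_coords p) (hopf_vec 2 p) = c\<^sup>2" by simp
  have "\<sigma> 3 (hopf_coords p) (hopf_vec 3 p) = s\<^sup>2 * ((cos (p $ 3))\<^sup>2 + (sin (p $ 3))\<^sup>2)"
    unfolding \<sigma>_simps hopf_vec_simps hopf_coords_def s_def by (simp add: power2_eq_square algebra_simps)
  then show "\<sigma> 3 (hopf_coords p) (hopf_vec 3 p) = s\<^sup>2" by simp
qed

text \<open>The Gram matrix is M^T diag(1, 1, t^2) M, where M holds the values of the forms
  \<sigma>_a on the coordinate vectors, and det M = - sin \<eta> cos \<eta> for the first coordinate
  \<eta>.\<close>

lemma det_gram_berger: "det (gram (berger t) p) = (t * (sin (p $ 1) * cos (p $ 1)))\<^sup>2"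
proof -
  define s c C S where "s = sin (p $ 1)" and "c = cos (p $ 1)" and "C = cos (p $ 2 + p $ 3)" and "S = sin (p $ 2 + p $ 3)"
  note \<sigma>s = \<sigma>_hopf_vec[of p, folded s_def c_def C_def S_def]
  have 1: "S\<^sup>2 = 1 - C\<^sup>2" "s\<^sup>2 = 1 - c\<^sup>2"
    by (simp_all add: S_def C_def s_def c_def sin_squared_eq)
  show ?thesis
    unfolding s_def[symmetric] c_def[symmetric]
    by (simp add: det_3 gram_def berger_def hopf_partial \<sigma>s) (use 1 in algebra)
qed

text \<open>Density of the volume of h_1 in Hopf coordinates; that of h_t is t times it. Positivity
  inside the box removes the absolute value left by the square root of the determinant.\<close>

definition hopf_weight :: "real ^ 3 \<Rightarrow> real" where
  "hopf_weight p = sin (p $ 1) * cos (p $ 1)"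

lemma hopf_box_eq: "hopf_box = box 0 (vector [pi / 2, 2 * pi, 2 * pi])"
  by (auto simp: hopf_box_def mem_box_cart forall_3)

lemma hopf_weight_pos: "p \<in> hopf_box \<Longrightarrow> hopf_weight p > 0"
  by (auto simp: hopf_box_def hopf_weight_def intro!: mult_pos_pos sin_gt_zero cos_gt_zero)

lemma continuous_on_hopf_weight: "continuous_on S hopf_weight"
  unfolding hopf_weight_def[abs_def] by (intro continuous_intros)

section \<open>The Berger volume as a weighted integral over the Hopf box\<close>

lemma volume_element_berger:
  assumes "t > 0"
  shows "volume_element (berger t) = distr (density (restrict_space lborel hopf_box) (\<lambda>p. ennreal (t * hopf_weight p)))
       (restrict_space borel SU2) hopf_coords"
proof -
  have "density (restrict_space lborel hopf_box) (\<lambda>p. ennreal (sqrt (det (gram (berger t) p)))) =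
      density (restrict_space lborel hopf_box) (\<lambda>p. ennreal \<bar>t * hopf_weight p\<bar>)"
    by (simp add: det_gram_berger hopf_weight_def)
  also have "\<dots> = density (restrict_space lborel hopf_box) (\<lambda>p. ennreal (t * hopf_weight p))"
  proof (rule density_cong)
    show "AE p in restrict_space lborel hopf_box. ennreal \<bar>t * hopf_weight p\<bar> = ennreal (t * hopf_weight p)"
    proof (rule AE_I2)
      fix p assume "p \<in> space (restrict_space lborel hopf_box)"
      then have "hopf_weight p > 0" by (simp add: space_restrict_space hopf_weight_pos)
      then show "ennreal \<bar>t * hopf_weight p\<bar> = ennreal (t * hopf_weight p)" using assms by simp
    qed
  qed (auto intro!: measurable_restrict_space1 measurable_compose[OF _ measurable_ennreal]
        borel_measurable_continuous_onI continuous_intros continuous_on_hopf_weight)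
  finally show ?thesis unfolding volume_element_def by simp
qed

lemma space_volume_element [simp]: "space (volume_element h) = SU2"
  by (simp add: volume_element_def space_restrict_space)

lemma sets_volume_element: "sets (volume_element h) = sets (restrict_space borel SU2)"
  by (simp add: volume_element_def)

lemma measurable_volume_element:
  fixes f :: "cmat2 \<Rightarrow> 'b::topological_space"
  assumes "continuous_on SU2 f"
  shows "f \<in> borel_measurable (volume_element h)"
  using borel_measurable_continuous_on_restrict[OF assms]
  by (simp add: measurable_cong_sets[OF sets_volume_element refl])

lemma hopf_measurable: "hopf_coords \<in> measurable (restrict_space lborel hopf_box) (restrict_space borel SU2)"
  by (intro measurable_restrict_space2 measurable_restrict_space1)
     (auto intro!: borel_measurable_continuous_onI continuous_on_hopf)

lemma continuous_on_hopf_compose: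
  assumes "continuous_on SU2 f"
  shows "continuous_on S (\<lambda>p. f (hopf_coords p))"
  by (rule continuous_on_compose2[OF assms continuous_on_hopf]) auto

lemma hopf_integrable:
  fixes f :: "cmat2 \<Rightarrow> 'b::{banach, second_countable_topology}"
  assumes "continuous_on SU2 f"
  shows "integrable lborel (\<lambda>p. indicator hopf_box p *\<^sub>R (t * hopf_weight p) *\<^sub>R f (hopf_coords p))"
proof -
  have "continuous_on UNIV (\<lambda>p. (t * hopf_weight p) *\<^sub>R f (hopf_coords p))"
    by (intro continuous_intros continuous_on_hopf_weight continuous_on_hopf_compose assms)
  from set_integrable_box[OF this] show ?thesis
    unfolding hopf_box_eq set_integrable_def .
qed

lemma
  fixes f :: "cmat2 \<Rightarrow> 'b::{banach, second_countable_topology}"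
  assumes t: "t > 0" and f: "continuous_on SU2 f"
  shows integrable_volume: "integrable (volume_element (berger t)) f"
    and integral_volume: "(\<integral>x. f x \<partial>volume_element (berger t)) =
      (\<integral>p. indicator hopf_box p *\<^sub>R (t * hopf_weight p) *\<^sub>R f (hopf_coords p) \<partial>lborel)"
proof -
  let ?R = "restrict_space lborel hopf_box"
  have box: "hopf_box \<inter> space lborel \<in> sets lborel" by (simp add: hopf_box_eq)
  have w: "(\<lambda>p. t * hopf_weight p) \<in> borel_measurable ?R"
    by (auto intro!: measurable_restrict_space1 borel_measurable_continuous_onI continuous_intros continuous_on_hopf_weight)
  have fh: "(\<lambda>p. f (hopf_coords p)) \<in> borel_measurable ?R"
    by (auto intro!: measurable_restrict_space1 borel_measurable_continuous_onI continuous_on_hopf_compose f)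
  have fm: "f \<in> borel_measurable (restrict_space borel SU2)"
    by (rule borel_measurable_continuous_on_restrict[OF f])
  have hm: "hopf_coords \<in> measurable (density ?R (\<lambda>p. ennreal (t * hopf_weight p))) (restrict_space borel SU2)"
    using hopf_measurable by simp
  have pos: "AE p in ?R. 0 \<le> t * hopf_weight p"
  proof (rule AE_I2)
    fix p assume "p \<in> space ?R"
    then have "hopf_weight p > 0" by (simp add: space_restrict_space hopf_weight_pos)
    then show "0 \<le> t * hopf_weight p" using t by simp
  qed
  show "integrable (volume_element (berger t)) f"
    unfolding volume_element_berger[OF t] integrable_distr_eq[OF hm fm] integrable_density[OF fh w pos]
      integrable_restrict_space[OF box]
    by (rule hopf_integrable[OF f])
  show "(\<integral>x. f x \<partial>volume_element (berger t)) =
      (\<integral>p. indicator hopf_box p *\<^sub>R (t * hopf_weight p) *\<^sub>R f (hopf_coords p) \<partial>lborel)"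
    unfolding volume_element_berger[OF t] integral_distr[OF hm fm] integral_density[OF fh w pos]
      integral_restrict_space[OF box] ..
qed

text \<open>Polar form of both entries, with first coordinate arccos |z|. The closed box is taken
  because angles may be 0 and the circles z = 0 and w = 0 come from faces.\<close>

lemma hopf_surj:
  assumes "x \<in> SU2"
  shows "\<exists>p\<in>closure hopf_box. hopf_coords p = x"
proof -
  define z w where "z = x $ 1 $ 1" and "w = x $ 2 $ 1"
  have zw: "(cmod z)\<^sup>2 + (cmod w)\<^sup>2 = 1" using SU2_norm[OF assms] by (simp add: z_def w_def)
  have z1: "cmod z \<le> 1" using zw by (metis abs_le_square_iff abs_norm_cancel abs_one le_add_same_cancel1 one_power2 zero_le_power2)
  define \<eta> where "\<eta> = arccos (cmod z)"
  have \<eta>: "0 \<le> \<eta>" "\<eta> \<le> pi / 2" using z1 arccos_lbound[of "cmod z"] arccos_le_pi2[of "cmod z"] norm_ge_zero[of z] unfolding \<eta>_def by linarith+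
  have c: "cos \<eta> = cmod z" using z1 unfolding \<eta>_def by (intro cos_arccos) (use norm_ge_zero[of z] in linarith)+
  have "sin \<eta> \<ge> 0" using \<eta> by (intro sin_ge_zero) auto
  moreover have "(sin \<eta>)\<^sup>2 = (cmod w)\<^sup>2" using zw c by (simp add: sin_squared_eq)
  ultimately have s: "sin \<eta> = cmod w" by simp
  let ?p = "vector [\<eta>, Arg2pi z, Arg2pi w] :: real ^ 3"
  have "hopf_coords ?p = su2_matrix z w"
    using Arg2pi_eq[of z] Arg2pi_eq[of w] by (simp add: hopf_coords_def c s cis_conv_exp)
  also have "\<dots> = x" using SU2_entries_eq[OF assms] by (simp add: z_def w_def)
  finally have "hopf_coords ?p = x" .
  moreover have "?p \<in> cbox 0 (vector [pi / 2, 2 * pi, 2 * pi])"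
    using \<eta> Arg2pi_ge_0[of z] Arg2pi_ge_0[of w] Arg2pi_lt_2pi[of z] Arg2pi_lt_2pi[of w]
    by (auto simp: mem_box_cart forall_3)
  moreover have "closure hopf_box = cbox 0 (vector [pi / 2, 2 * pi, 2 * pi])"
    unfolding hopf_box_eq by (rule closure_box) (simp add: interval_ne_empty_cart forall_3)
  ultimately show ?thesis by blast
qed

text \<open>The set in the box where the weighted integrand is nonzero is open and null, hence
  empty; continuity carries the zero to the closed box, whose image is all of SU(2).\<close>

lemma integral_volume_eq_0_iff:
  assumes t: "t > 0" and f: "continuous_on SU2 f" and nn: "\<And>x. x \<in> SU2 \<Longrightarrow> 0 \<le> f x"
    and z: "(\<integral>x. f x \<partial>volume_element (berger t)) = (0::real)" and x: "x \<in> SU2"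
  shows "f x = 0"
proof -
  let ?g = "\<lambda>p. (t * hopf_weight p) * f (hopf_coords p)"
  have g: "continuous_on UNIV ?g"
    by (intro continuous_intros continuous_on_hopf_weight continuous_on_hopf_compose f)
  have "AE p in lborel. indicator hopf_box p *\<^sub>R ?g p = 0"
    using z hopf_integrable[OF f, of t] unfolding integral_volume[OF t f]
    by (subst (asm) integral_nonneg_eq_0_iff_AE)
       (auto simp: indicator_def nn hopf_weight_pos t less_imp_le intro!: AE_I2)
  then have ae: "AE p in lborel. p \<in> hopf_box \<longrightarrow> ?g p = 0"
    by eventually_elim (auto simp: indicator_def)
  have "open (hopf_box \<inter> ?g -` (- {0}))"
    using continuous_on_open_vimage[OF open_UNIV, of ?g] g
    by (intro open_Int) (auto simp: hopf_box_eq)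
  moreover have "negligible (hopf_box \<inter> ?g -` (- {0}))"
  proof -
    have e: "{p \<in> space lborel. \<not> (p \<in> hopf_box \<longrightarrow> ?g p = 0)} = hopf_box \<inter> ?g -` (- {0})" by auto
    have "hopf_box \<inter> ?g -` (- {0}) \<in> sets lborel"
      using \<open>open (hopf_box \<inter> ?g -` (- {0}))\<close> by simp
    then have "hopf_box \<inter> ?g -` (- {0}) \<in> null_sets lborel"
      using AE_iff_null[where M = lborel and P = "\<lambda>p. p \<in> hopf_box \<longrightarrow> ?g p = 0", unfolded e] ae by blast
    then show ?thesis by (simp add: negligible_iff_null_sets null_sets_completionI)
  qed
  ultimately have "hopf_box \<inter> ?g -` (- {0}) = {}" using open_not_negligible by blast
  then have "f (hopf_coords p) = 0" if "p \<in> hopf_box" for p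
    using that hopf_weight_pos[OF that] t by auto
  then have "f (hopf_coords p) = 0" if "p \<in> closure hopf_box" for p
    using continuous_constant_on_closure[OF continuous_on_hopf_compose[OF f], of hopf_box 0 p] that by blast
  then show ?thesis using hopf_surj[OF x] by blast
qed

lemma finite_measure_volume:
  assumes t: "t > 0"
  shows "finite_measure (volume_element (berger t))"
proof -
  have "integrable (volume_element (berger t)) (\<lambda>_. 1::real)"
    by (rule integrable_volume[OF t continuous_on_const])
  then show ?thesis by (intro finite_measureI) (auto simp: integrable_iff_bounded less_top[symmetric])
qed

lemma measure_volume_pos:
  assumes t: "t > 0"
  shows "measure (volume_element (berger t)) SU2 > 0"
proof -
  interpret finite_measure "volume_element (berger t)" by (rule finite_measure_volume[OF t])
  have "hopf_coords 0 \<in> SU2" by simp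
  then have "(\<integral>x. 1 \<partial>volume_element (berger t)) \<noteq> (0::real)"
    using integral_volume_eq_0_iff[OF t continuous_on_const[of _ 1]] by fastforce
  then show ?thesis by (simp add: zero_less_measure_iff)
qed

text \<open>In Hopf coordinates, with \<open>\<theta> = a + b\<close>,
  \<open>cos \<eta> sin \<eta> E\<^sub>1 = sin \<theta> cos \<eta> sin \<eta> \<partial>\<^sub>\<eta> - sin\<^sup>2 \<eta> cos \<theta> \<partial>\<^sub>a + cos\<^sup>2 \<eta> cos \<theta> \<partial>\<^sub>b\<close> is divergence free,
  its first coefficient vanishes at \<open>\<eta> = 0, \<pi>/2\<close> and the others are periodic. For \<open>E\<^sub>2\<close> the phase
  \<open>\<theta>\<close> is shifted by \<open>\<pi>/2\<close>, and \<open>E\<^sub>3 = \<partial>\<^sub>a + \<partial>\<^sub>b\<close>.\<close>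

theorem integral_along:
  assumes t: "t > 0" and f: "Ck_SU2 1 f"
  shows "(\<integral>x. along a f x \<partial>volume_element (berger t)) = (0::real)"
proof -
  define A where "A b p = along b f (hopf_coords p)" for b p
  define F where "F p = f (hopf_coords p)" for p
  define DF where "DF i p = (\<Sum>b\<in>UNIV. \<sigma> b (hopf_coords p) (hopf_vec i p) * A b p)" for i p
  let ?hi = "vector [pi / 2, 2 * pi, 2 * pi] :: real ^ 3"
  have A: "continuous_on UNIV (A b)" for b
    unfolding A_def by (intro continuous_on_hopf_compose continuous_on_along f)
  have F: "continuous_on UNIV F"
    unfolding F_def by (intro continuous_on_hopf_compose C1_continuous_on f)
  have dF: "((\<lambda>s. F (p + s *\<^sub>R axis i 1)) has_real_derivative DF i p) (at 0)" for i p
  proof -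
    have "((\<lambda>s. f (hopf_coords (p + s *\<^sub>R axis i 1))) has_vector_derivative
        differential f (hopf_coords (p + 0 *\<^sub>R axis i 1)) (hopf_vec i (p + 0 *\<^sub>R axis i 1))) (at 0)"
      by (rule has_derivative_curve[OF C1_has_derivative[OF f hopf_in_SU2] _ hopf_has_vector_derivative]) auto
    then show ?thesis
      by (simp add: F_def DF_def A_def has_real_derivative_iff_has_vector_derivative
          differential_expand[OF f hopf_in_SU2 hopf_vec_tangent])
  qed
  have per: "F (p + (2 * pi) *\<^sub>R axis i 1) = F p" if "i = 2 \<or> i = 3" for i p
    using that by (auto simp: F_def hopf_coords_def axis_def cis.code)
  have DF: "DF 1 p = sin (p $ 2 + p $ 3) * A 1 p - cos (p $ 2 + p $ 3) * A 2 p"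
    "DF 2 p = - (sin (p $ 1) * cos (p $ 1) * cos (p $ 2 + p $ 3)) * A 1 p
       - sin (p $ 1) * cos (p $ 1) * sin (p $ 2 + p $ 3) * A 2 p + (cos (p $ 1))\<^sup>2 * A 3 p"
    "DF 3 p = sin (p $ 1) * cos (p $ 1) * cos (p $ 2 + p $ 3) * A 1 p
       + sin (p $ 1) * cos (p $ 1) * sin (p $ 2 + p $ 3) * A 2 p + (sin (p $ 1))\<^sup>2 * A 3 p" for p
    by (simp_all add: DF_def sum_3 \<sigma>_hopf_vec)
  have DFc: "continuous_on UNIV (DF i)" for i
    using exhaust_3[of i] by (auto simp: DF intro!: continuous_intros A)
  \<comment> \<open>For a vector field with coefficients q i and partial derivatives k i of q i in
    its own variable, the integrand is the divergence of the field times F. Boundary terms cancel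
    because q 1 vanishes on both faces and the other coefficients are periodic.\<close>
  have main: "(\<integral>p. indicator hopf_box p *\<^sub>R (\<Sum>i\<in>UNIV. k i p * F p + q i p * DF i p) \<partial>lborel) = 0"
    if q: "\<And>i p. ((\<lambda>s. q i (p + s *\<^sub>R axis i 1)) has_real_derivative k i p) (at 0)"
      "\<And>i. continuous_on UNIV (q i)" "\<And>i. continuous_on UNIV (k i)"
      "\<And>p. p $ 1 = 0 \<Longrightarrow> q 1 p = 0" "\<And>p. p $ 1 = pi / 2 \<Longrightarrow> q 1 p = 0"
      "\<And>i p. i = 2 \<or> i = 3 \<Longrightarrow> q i (p + (2 * pi) *\<^sub>R axis i 1) = q i p" for q k
  proof -
    have kc: "continuous_on UNIV (\<lambda>p. k i p * F p + q i p * DF i p)" for i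
      by (intro continuous_intros q F DFc)
    have "(\<integral>p. indicator hopf_box p *\<^sub>R (k i p * F p + q i p * DF i p) \<partial>lborel) = 0" for i
      unfolding hopf_box_eq
    proof (rule integral_partial_derivative[where G = "\<lambda>p. q i p * F p" and i = i])
      show "((\<lambda>s. q i (p + s *\<^sub>R axis i 1) * F (p + s *\<^sub>R axis i 1)) has_real_derivative
          k i p * F p + q i p * DF i p) (at 0)" for p
        using DERIV_mult[OF q(1)[where p = p and i = i] dF[of p i]] by (simp add: algebra_simps)
      show "(0 :: real ^ 3) $ i \<le> ?hi $ i" using exhaust_3[of i] by auto
      show "q i (p + (?hi $ i - 0 $ i) *\<^sub>R axis i 1) * F (p + (?hi $ i - 0 $ i) *\<^sub>R axis i 1) = q i p * F p"
        if "p $ i = 0 $ i" for p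
        using exhaust_3[of i] that q(4)[of p] q(5)[of "p + (pi / 2) *\<^sub>R axis 1 1"] q(6)[of i p] per[of i p]
        by auto
    qed (rule kc)
    moreover have "integrable lborel (\<lambda>p. indicator hopf_box p *\<^sub>R (k i p * F p + q i p * DF i p))" for i
      using set_integrable_box[OF kc] unfolding hopf_box_eq set_integrable_def .
    ultimately show ?thesis by (simp add: sum_3 distrib_left[of "indicator _ _"] Bochner_Integration.integral_add)
  qed
  have "(\<integral>p. indicator hopf_box p *\<^sub>R (hopf_weight p * A a p) \<partial>lborel) = 0"
  proof (cases "a = 3")
    case True
    \<comment> \<open>Coefficients of \<open>hopf_weight\<close> times E_3; each is constant in its
      own variable, so k = 0.\<close>
    define q where "q i p = (if i = 1 then 0 else hopf_weight p)" for i :: 3 and p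
    have "(\<integral>p. indicator hopf_box p *\<^sub>R (\<Sum>i\<in>UNIV. 0 * F p + q i p * DF i p) \<partial>lborel) = 0"
    proof (rule main)
      show "((\<lambda>s. q i (p + s *\<^sub>R axis i 1)) has_real_derivative 0) (at 0)" for i p
        using exhaust_3[of i] by (auto simp: q_def hopf_weight_def axis_def)
      show "continuous_on UNIV (q i)" for i
        unfolding q_def by (cases "i = 1") (auto intro: continuous_on_hopf_weight)
      show "q i (p + (2 * pi) *\<^sub>R axis i 1) = q i p" if "i = 2 \<or> i = 3" for i p
        using that by (auto simp: q_def hopf_weight_def axis_def)
    qed (auto simp: q_def)
    moreover have "(\<Sum>i\<in>UNIV. 0 * F p + q i p * DF i p) = hopf_weight p * A a p" for p
    proof -
      have "(\<Sum>i\<in>UNIV. 0 * F p + q i p * DF i p) = hopf_weight p * (((sin (p $ 1))\<^sup>2 + (cos (p $ 1))\<^sup>2) * A 3 p)"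
        unfolding sum_3 DF q_def
        by (simp add: algebra_simps del: sin_cos_squared_add sin_cos_squared_add2)
      then show ?thesis by (simp add: True)
    qed
    ultimately show ?thesis by simp
  next
    case False
    \<comment> \<open>\<open>\<delta>\<close> treats E_1 and E_2 together: the shift by pi/2 turns
      (sin, cos) into (- cos, sin), as E_2 requires.\<close>
    define \<delta> :: real where "\<delta> = (if a = 1 then 0 else pi / 2)"
    define S C where "S p = sin (p $ 2 + p $ 3 - \<delta>)" and "C p = cos (p $ 2 + p $ 3 - \<delta>)" for p :: "real ^ 3"
    define q where "q i p = (if i = 1 then S p * hopf_weight p
        else if i = 2 then - ((sin (p $ 1))\<^sup>2 * C p) else (cos (p $ 1))\<^sup>2 * C p)" for i :: 3 and p
    define k where "k i p = (if i = 1 then S p * ((cos (p $ 1))\<^sup>2 - (sin (p $ 1))\<^sup>2)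
        else if i = 2 then (sin (p $ 1))\<^sup>2 * S p else - ((cos (p $ 1))\<^sup>2 * S p))" for i :: 3 and p
    have SC: "continuous_on UNIV S" "continuous_on UNIV C"
      unfolding S_def C_def by (intro continuous_intros)+
    have "(\<integral>p. indicator hopf_box p *\<^sub>R (\<Sum>i\<in>UNIV. k i p * F p + q i p * DF i p) \<partial>lborel) = 0"
    proof (rule main)
      show "((\<lambda>s. q i (p + s *\<^sub>R axis i 1)) has_real_derivative k i p) (at 0)" for i p
        using exhaust_3[of i]
        by (auto simp: q_def k_def S_def C_def hopf_weight_def axis_def power2_eq_square algebra_simps
            intro!: derivative_eq_intros)
      show "continuous_on UNIV (q i)" for i
        using exhaust_3[of i] by (auto simp: q_def intro!: continuous_intros SC continuous_on_hopf_weight)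
      show "continuous_on UNIV (k i)" for i
        using exhaust_3[of i] by (auto simp: k_def intro!: continuous_intros SC)
      show "q i (p + (2 * pi) *\<^sub>R axis i 1) = q i p" if "i = 2 \<or> i = 3" for i p
      proof -
        have "C (p + (2 * pi) *\<^sub>R axis i 1) = cos (p $ 2 + p $ 3 - \<delta> + 2 * pi)"
          using that by (auto simp: C_def axis_def algebra_simps)
        then have "C (p + (2 * pi) *\<^sub>R axis i 1) = C p" by (simp only: cos_periodic C_def)
        then show ?thesis using that by (auto simp: q_def axis_def)
      qed
      show "q 1 p = 0" if "p $ 1 = pi / 2" for p
        unfolding q_def hopf_weight_def that by simp
    qed (auto simp: q_def hopf_weight_def)
    moreover have "(\<Sum>i\<in>UNIV. k i p * F p + q i p * DF i p) = hopf_weight p * A a p" for p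
    proof -
      define s c Th where "s = sin (p $ 1)" and "c = cos (p $ 1)" and "Th = p $ 2 + p $ 3"
      have sc: "s\<^sup>2 + c\<^sup>2 = 1" by (simp add: s_def c_def)
      have a: "a = 1 \<and> S p = sin Th \<and> C p = cos Th \<or> a = 2 \<and> S p = - cos Th \<and> C p = sin Th"
        using False exhaust_3[of a] by (auto simp: S_def C_def \<delta>_def Th_def sin_diff cos_diff)
      have "(\<Sum>i\<in>UNIV. k i p * F p + q i p * DF i p) =
          S p * (s * c) * (sin Th * A 1 p - cos Th * A 2 p) -
          s\<^sup>2 * C p * (- (s * c * cos Th) * A 1 p - s * c * sin Th * A 2 p + c\<^sup>2 * A 3 p) +
          c\<^sup>2 * C p * (s * c * cos Th * A 1 p + s * c * sin Th * A 2 p + s\<^sup>2 * A 3 p)"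
        unfolding sum_3 DF q_def k_def hopf_weight_def s_def[symmetric] c_def[symmetric] Th_def[symmetric]
        by (simp add: algebra_simps)
      also have "\<dots> = s * c * (((sin Th)\<^sup>2 + (cos Th)\<^sup>2) * A a p)"
      proof -
        have "S p * (s * c) * (sin Th * A 1 p - cos Th * A 2 p) -
            s\<^sup>2 * C p * (- (s * c * cos Th) * A 1 p - s * c * sin Th * A 2 p + c\<^sup>2 * A 3 p) +
            c\<^sup>2 * C p * (s * c * cos Th * A 1 p + s * c * sin Th * A 2 p + s\<^sup>2 * A 3 p) =
            s * c * (S p * (sin Th * A 1 p - cos Th * A 2 p) +
              (s\<^sup>2 + c\<^sup>2) * C p * (cos Th * A 1 p + sin Th * A 2 p))"
          by (simp add: algebra_simps)
        also have "\<dots> = s * c * (((sin Th)\<^sup>2 + (cos Th)\<^sup>2) * A a p)"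
          unfolding sc using a by (elim disjE conjE) (simp_all add: algebra_simps power2_eq_square
            del: sin_cos_squared_add sin_cos_squared_add2 sin_cos_squared_add3)
        finally show ?thesis .
      qed
      finally show ?thesis by (simp add: hopf_weight_def s_def c_def)
    qed
    ultimately show ?thesis by simp
  qed
  then have "t * (\<integral>p. indicator hopf_box p *\<^sub>R (hopf_weight p * A a p) \<partial>lborel) = 0" by simp
  then show ?thesis
    unfolding integral_volume[OF t continuous_on_along[OF f]]
    by (simp add: A_def algebra_simps flip: integral_mult_right_zero)
qed

section \<open>Monomials\<close>

lemma along_linear:
  fixes u v :: "cmat2 \<Rightarrow> 'b::real_normed_algebra"
  assumes "Ck_SU2 1 u" "Ck_SU2 1 v" "x \<in> SU2"
  shows "along a (\<lambda>x. c * u x + v x) x = c * along a u x + along a v x"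
  using along_add[OF Ck_SU2_bounded_linear[OF assms(1) bounded_linear_mult_right] assms(2,3)]
    along_bounded_linear[OF assms(1) bounded_linear_mult_right assms(3)] by simp

lemma Ck_SU2_linear:
  fixes u v :: "cmat2 \<Rightarrow> 'b::real_normed_algebra"
  assumes "Ck_SU2 k u" "Ck_SU2 k v"
  shows "Ck_SU2 k (\<lambda>x. c * u x + v x)"
  by (intro Ck_SU2_add Ck_SU2_bounded_linear[OF assms(1) bounded_linear_mult_right] assms)

definition zmono :: "nat \<Rightarrow> nat \<Rightarrow> nat \<Rightarrow> nat \<Rightarrow> cmat2 \<Rightarrow> complex" where
  "zmono a b c d x = x $ 1 $ 1 ^ a * x $ 2 $ 1 ^ b * (cnj (x $ 1 $ 1) ^ c * cnj (x $ 2 $ 1) ^ d)"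

lemma Ck_on_zmono: "Ck_on k (zmono a b c d) UNIV"
  unfolding zmono_def[abs_def]
  by (intro Ck_on_mult Ck_on_power open_UNIV Ck_on_linear bounded_linear_entry
      bounded_linear_compose[OF bounded_linear_cnj bounded_linear_entry])

lemma Ck_SU2_zmono: "Ck_SU2 k (zmono a b c d)"
  by (intro smooth_imp_Ck smooth_SU2_global Ck_on_zmono)

lemma along_zmono:
  assumes "x \<in> SU2"
  shows "along t (zmono a b c d) x =
    of_nat a * zmono (a - 1) b c d x * frame t x $ 1 $ 1 + of_nat b * zmono a (b - 1) c d x * frame t x $ 2 $ 1 +
    (of_nat c * zmono a b (c - 1) d x * cnj (frame t x $ 1 $ 1) + of_nat d * zmono a b c (d - 1) x * cnj (frame t x $ 2 $ 1))"
proof -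
  have e: "((\<lambda>x. x $ i $ j) has_derivative (\<lambda>h. h $ i $ j)) (at x within SU2)" for i j :: 2
    by (intro bounded_linear_imp_has_derivative bounded_linear_entry)
  have c: "((\<lambda>x. cnj (x $ i $ j)) has_derivative (\<lambda>h. cnj (h $ i $ j))) (at x within SU2)" for i j :: 2
    by (intro bounded_linear.has_derivative[OF bounded_linear_cnj] e)
  show ?thesis
    unfolding zmono_def[abs_def]
    by (subst along_eq[OF has_derivative_mult[OF has_derivative_mult[OF has_derivative_power[OF e] has_derivative_power[OF e]]
            has_derivative_mult[OF has_derivative_power[OF c] has_derivative_power[OF c]]] assms])
       (simp add: algebra_simps)
qed

text \<open>On functions, \<open>E\<^sub>1 = \<i> W - \<i> V\<close> and \<open>E\<^sub>2 = - W - V\<close>; truncated exponents only occur with coefficient \<open>0\<close>.\<close>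

definition W_op :: "nat \<Rightarrow> nat \<Rightarrow> nat \<Rightarrow> nat \<Rightarrow> cmat2 \<Rightarrow> complex" where
  "W_op a b c d x = (- of_nat a) * zmono (a - 1) b c (d + 1) x + of_nat b * zmono a (b - 1) (c + 1) d x"

definition V_op :: "nat \<Rightarrow> nat \<Rightarrow> nat \<Rightarrow> nat \<Rightarrow> cmat2 \<Rightarrow> complex" where
  "V_op a b c d x = (- of_nat c) * zmono a (b + 1) (c - 1) d x + of_nat d * zmono (a + 1) b c (d - 1) x"

lemma Ck_SU2_W_op: "Ck_SU2 k (W_op a b c d)" and Ck_SU2_V_op: "Ck_SU2 k (V_op a b c d)"
  unfolding W_op_def[abs_def] V_op_def[abs_def]
  by (intro Ck_SU2_linear Ck_SU2_zmono Ck_SU2_bounded_linear[OF Ck_SU2_zmono bounded_linear_mult_right])+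

text \<open>\<open>W_op\<close> is the derivation - cnj w d/dz + cnj z d/dw applied to a monomial
  and \<open>V_op\<close> is its conjugate - w d/d(cnj z) + z d/d(cnj w); the first two formulas are
  read off from the action of the frame on z, w and their conjugates. E_3 generates the rotation of
  (z, w) by a common phase.\<close>

lemma along_zmono_W_V:
  assumes "x \<in> SU2"
  shows "along 1 (zmono a b c d) x = \<i> * W_op a b c d x + - \<i> * V_op a b c d x"
    and "along 2 (zmono a b c d) x = - 1 * W_op a b c d x + - 1 * V_op a b c d x"
    and "along 3 (zmono a b c d) x = \<i> * (of_nat (a + b) - of_nat (c + d)) * zmono a b c d x"
proof -
  show "along 1 (zmono a b c d) x = \<i> * W_op a b c d x + - \<i> * V_op a b c d x"
    "along 2 (zmono a b c d) x = - 1 * W_op a b c d x + - 1 * V_op a b c d x"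
    by (simp_all add: along_zmono[OF assms] frame_simps W_op_def V_op_def) (simp_all add: zmono_def algebra_simps)
  show "along 3 (zmono a b c d) x = \<i> * (of_nat (a + b) - of_nat (c + d)) * zmono a b c d x"
    by (simp add: along_zmono[OF assms] frame_simps, cases a; cases b; cases c; cases d)
       (simp_all add: zmono_def algebra_simps)
qed

lemma along_W_op:
  assumes "x \<in> SU2"
  shows "along t (W_op a b c d) x =
    (- of_nat a) * along t (zmono (a - 1) b c (d + 1)) x + of_nat b * along t (zmono a (b - 1) (c + 1) d) x"
  unfolding W_op_def[abs_def]
  by (subst along_linear[OF Ck_SU2_zmono Ck_SU2_bounded_linear[OF Ck_SU2_zmono bounded_linear_mult_right] assms])
     (simp add: along_bounded_linear[OF Ck_SU2_zmono bounded_linear_mult_right assms])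

lemma along_V_op:
  assumes "x \<in> SU2"
  shows "along t (V_op a b c d) x =
    (- of_nat c) * along t (zmono a (b + 1) (c - 1) d) x + of_nat d * along t (zmono (a + 1) b c (d - 1)) x"
  unfolding V_op_def[abs_def]
  by (subst along_linear[OF Ck_SU2_zmono Ck_SU2_bounded_linear[OF Ck_SU2_zmono bounded_linear_mult_right] assms])
     (simp add: along_bounded_linear[OF Ck_SU2_zmono bounded_linear_mult_right assms])

lemma Ck_SU2_along_zmono: "Ck_SU2 k (along t (zmono a b c d))"
proof -
  have "t = 1 \<or> t = 2 \<or> t = 3" using exhaust_3 by blast
  then show ?thesis
  proof (elim disjE)
    assume t: "t = 1"
    have "Ck_SU2 k (\<lambda>x. \<i> * W_op a b c d x + - \<i> * V_op a b c d x)"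
      by (intro Ck_SU2_linear Ck_SU2_W_op Ck_SU2_bounded_linear[OF Ck_SU2_V_op bounded_linear_mult_right])
    then show ?thesis unfolding t by (rule Ck_SU2_cong) (simp only: along_zmono_W_V)
  next
    assume t: "t = 2"
    have "Ck_SU2 k (\<lambda>x. - 1 * W_op a b c d x + - 1 * V_op a b c d x)"
      by (intro Ck_SU2_linear Ck_SU2_W_op Ck_SU2_bounded_linear[OF Ck_SU2_V_op bounded_linear_mult_right])
    then show ?thesis unfolding t by (rule Ck_SU2_cong) (simp only: along_zmono_W_V)
  next
    assume t: "t = 3"
    show ?thesis unfolding t
      by (rule Ck_SU2_cong[OF Ck_SU2_bounded_linear[OF Ck_SU2_zmono bounded_linear_mult_right]])
         (simp only: along_zmono_W_V(3))
  qed
qed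

text \<open>Since (i W - i V)^2 + (W + V)^2 = 2 (W V + V W), the squares cancel. As W lowers the
  holomorphic degree by one and V raises it, what remains preserves the bidegree.\<close>

lemma along_along_12:
  assumes x: "x \<in> SU2"
  shows "along 1 (along 1 (zmono a b c d)) x + along 2 (along 2 (zmono a b c d)) x =
    2 * ((- of_nat a) * V_op (a - 1) b c (d + 1) x + of_nat b * V_op a (b - 1) (c + 1) d x +
      ((- of_nat c) * W_op a (b + 1) (c - 1) d x + of_nat d * W_op (a + 1) b c (d - 1) x))"
proof -
  have 1: "along 1 (along 1 (zmono a b c d)) x = along 1 (\<lambda>x. \<i> * W_op a b c d x + - \<i> * V_op a b c d x) x"
    by (rule along_cong[OF Ck_SU2_along_zmono _ x]) (simp only: along_zmono_W_V)
  have 2: "along 2 (along 2 (zmono a b c d)) x = along 2 (\<lambda>x. - 1 * W_op a b c d x + - 1 * V_op a b c d x) x"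
    by (rule along_cong[OF Ck_SU2_along_zmono _ x]) (simp only: along_zmono_W_V)
  have 3: "along i (\<lambda>x. k * W_op a b c d x + l * V_op a b c d x) x =
      k * along i (W_op a b c d) x + l * along i (V_op a b c d) x" for i k l
    by (subst along_linear[OF Ck_SU2_W_op Ck_SU2_bounded_linear[OF Ck_SU2_V_op bounded_linear_mult_right] x])
       (simp add: along_bounded_linear[OF Ck_SU2_V_op bounded_linear_mult_right x])
  show ?thesis
    unfolding 1 2 3 along_W_op[OF x] along_V_op[OF x] along_zmono_W_V[OF x]
    by (simp add: algebra_simps)
qed

lemma along_along_3:
  assumes x: "x \<in> SU2"
  shows "along 3 (along 3 (zmono a b c d)) x = - (of_nat (a + b) - of_nat (c + d))\<^sup>2 * zmono a b c d x"
proof -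
  have "along 3 (along 3 (zmono a b c d)) x = along 3 (\<lambda>x. \<i> * (of_nat (a + b) - of_nat (c + d)) * zmono a b c d x) x"
    by (rule along_cong[OF Ck_SU2_along_zmono _ x]) (simp only: along_zmono_W_V)
  also have "\<dots> = - (of_nat (a + b) - of_nat (c + d))\<^sup>2 * zmono a b c d x"
    unfolding along_bounded_linear[OF Ck_SU2_zmono bounded_linear_mult_right x] along_zmono_W_V(3)[OF x]
    by (simp add: power2_eq_square algebra_simps)
  finally show ?thesis .
qed

text \<open>The relation \<open>\<bar>z\<bar>\<^sup>2 + \<bar>w\<bar>\<^sup>2 = 1\<close> makes the off-diagonal terms of the sub-Laplacian drop in degree.\<close>

lemma sublaplacian_zmono:
  assumes x: "x \<in> SU2"
  shows "along 1 (along 1 (zmono a b c d)) x + along 2 (along 2 (zmono a b c d)) x =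
    - of_nat (4 * (a + b) * (c + d) + 2 * (a + b + c + d)) * zmono a b c d x +
    (4 * of_nat (a * c) * zmono (a - 1) b (c - 1) d x + 4 * of_nat (b * d) * zmono a (b - 1) c (d - 1) x)"
proof -
  have zw: "x $ 2 $ 1 * cnj (x $ 2 $ 1) = 1 - x $ 1 $ 1 * cnj (x $ 1 $ 1)"
    using SU2_cnj[OF x] by (simp add: algebra_simps)
  \<comment> \<open>A cross term carries the factor |w|^2 = 1 - |z|^2, which splits it into a
    multiple of the original monomial and one of degree two lower; in 2 the roles of z and w are
    exchanged.\<close>
  have 1: "of_nat (a * c) * zmono (a - 1) (b + 1) (c - 1) (d + 1) x =
      of_nat (a * c) * (zmono (a - 1) b (c - 1) d x - zmono a b c d x)"
  proof (cases "a * c = 0")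
    case False
    then obtain a' c' where ac: "a = Suc a'" "c = Suc c'" by (metis mult_is_0 not0_implies_Suc)
    have "zmono a' (b + 1) c' (d + 1) x = zmono a' b c' d x * (x $ 2 $ 1 * cnj (x $ 2 $ 1))"
      by (simp add: zmono_def algebra_simps)
    also have "\<dots> = zmono a' b c' d x - zmono (Suc a') b (Suc c') d x"
      unfolding zw by (simp add: zmono_def algebra_simps)
    finally show ?thesis by (simp add: ac)
  qed auto
  have 2: "of_nat (b * d) * zmono (a + 1) (b - 1) (c + 1) (d - 1) x =
      of_nat (b * d) * (zmono a (b - 1) c (d - 1) x - zmono a b c d x)"
  proof (cases "b * d = 0")
    case False
    then obtain b' d' where bd: "b = Suc b'" "d = Suc d'" by (metis mult_is_0 not0_implies_Suc)
    have zw': "x $ 1 $ 1 * cnj (x $ 1 $ 1) = 1 - x $ 2 $ 1 * cnj (x $ 2 $ 1)"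
      using zw by (simp add: algebra_simps)
    have "zmono (a + 1) b' (c + 1) d' x = zmono a b' c d' x * (x $ 1 $ 1 * cnj (x $ 1 $ 1))"
      by (simp add: zmono_def algebra_simps)
    also have "\<dots> = zmono a b' c d' x - zmono a (Suc b') c (Suc d') x"
      unfolding zw' by (simp add: zmono_def algebra_simps)
    finally show ?thesis by (simp add: bd)
  qed auto
  \<comment> \<open>Truncated subtraction: a - 1 + 1 differs from a only for a = 0, where the factor
    in front vanishes.\<close>
  have s: "of_nat a * zmono (a - 1 + 1) b c d x = of_nat a * zmono a b c d x"
    "of_nat b * zmono a (b - 1 + 1) c d x = of_nat b * zmono a b c d x"
    "of_nat c * zmono a b (c - 1 + 1) d x = of_nat c * zmono a b c d x"
    "of_nat d * zmono a b c (d - 1 + 1) x = of_nat d * zmono a b c d x"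
    by (cases a; simp; fail | cases b; simp; fail | cases c; simp; fail | cases d; simp; fail)+
  have "along 1 (along 1 (zmono a b c d)) x + along 2 (along 2 (zmono a b c d)) x =
      4 * (of_nat (a * c) * zmono (a - 1) (b + 1) (c - 1) (d + 1) x) +
      4 * (of_nat (b * d) * zmono (a + 1) (b - 1) (c + 1) (d - 1) x) -
      2 * (of_nat (d + 1) * (of_nat a * zmono (a - 1 + 1) b c d x) + of_nat (c + 1) * (of_nat b * zmono a (b - 1 + 1) c d x) +
      of_nat (b + 1) * (of_nat c * zmono a b (c - 1 + 1) d x) + of_nat (a + 1) * (of_nat d * zmono a b c (d - 1 + 1) x))"
    unfolding along_along_12[OF x] W_op_def V_op_def by (simp add: algebra_simps)
  also have "\<dots> = - of_nat (4 * (a + b) * (c + d) + 2 * (a + b + c + d)) * zmono a b c d x +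
    (4 * of_nat (a * c) * zmono (a - 1) b (c - 1) d x + 4 * of_nat (b * d) * zmono a (b - 1) c (d - 1) x)"
    unfolding 1 2 s by (simp add: algebra_simps)
  finally show ?thesis .
qed

section \<open>Spans and density of the polynomials\<close>

text \<open>The real linear span, built by adding one multiple of a generator at a time, so that
  linear properties follow by a single induction.\<close>

inductive_set fspan :: "('a \<Rightarrow> real) set \<Rightarrow> ('a \<Rightarrow> real) set" for X where
  zero: "(\<lambda>x. 0) \<in> fspan X"
| step: "f \<in> X \<Longrightarrow> g \<in> fspan X \<Longrightarrow> (\<lambda>x. c * f x + g x) \<in> fspan X"

lemma fspan_linear:
  assumes "f \<in> fspan X" "g \<in> fspan X"
  shows "(\<lambda>x. k * f x + g x) \<in> fspan X"
  using assms(1)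
proof induction
  case zero
  then show ?case using assms(2) by simp
next
  case (step f h c)
  have "(\<lambda>x. (k * c) * f x + (k * h x + g x)) \<in> fspan X"
    by (rule fspan.step[OF step(1,3)])
  then show ?case by (simp add: algebra_simps)
qed

lemma fspan_base: "f \<in> X \<Longrightarrow> f \<in> fspan X"
  using fspan.step[OF _ fspan.zero, of f X 1] by simp

lemma fspan_scale: "f \<in> fspan X \<Longrightarrow> (\<lambda>x. k * f x) \<in> fspan X"
  using fspan_linear[OF _ fspan.zero] by simp

lemma fspan_subset:
  assumes "X \<subseteq> fspan Y"
  shows "fspan X \<subseteq> fspan Y"
proof
  fix f assume "f \<in> fspan X"
  then show "f \<in> fspan Y"
    by induction (use assms in \<open>auto intro: fspan.zero fspan_linear\<close>)
qed

lemma fspan_mono: "X \<subseteq> Y \<Longrightarrow> fspan X \<subseteq> fspan Y"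
  by (rule fspan_subset) (auto intro: fspan_base)

lemma fspan_insertD:
  assumes "f \<in> fspan (insert e X)"
  shows "\<exists>c g. g \<in> fspan X \<and> f = (\<lambda>x. c * e x + g x)"
  using assms
proof induction
  case zero
  show ?case by (rule exI[of _ 0], rule exI[of _ "\<lambda>x. 0"]) (simp add: fspan.zero)
next
  case (step f h c)
  then obtain k g where g: "g \<in> fspan X" "h = (\<lambda>x. k * e x + g x)" by blast
  show ?case
  proof (cases "f = e")
    case True
    then show ?thesis using g by (intro exI[of _ "c + k"] exI[of _ g]) (simp add: algebra_simps)
  next
    case False
    then have "f \<in> X" using step(1) by simp
    then show ?thesis using g fspan.step[of f X g c]
      by (intro exI[of _ k] exI[of _ "\<lambda>x. c * f x + g x"]) (auto simp: algebra_simps)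
  qed
qed

lemma fspan_mult:
  assumes X: "\<And>f g. f \<in> X \<Longrightarrow> g \<in> X \<Longrightarrow> (\<lambda>x. f x * g x) \<in> fspan X"
    and "f \<in> fspan X" "g \<in> fspan X"
  shows "(\<lambda>x. f x * g x) \<in> fspan X"
  using assms(2)
proof induction
  case zero
  then show ?case by (simp add: fspan.zero)
next
  case (step f h c)
  have "(\<lambda>x. f x * g x) \<in> fspan X"
    using assms(3)
  proof induction
    case zero
    then show ?case by (simp add: fspan.zero)
  next
    case (step g' h' c')
    have "(\<lambda>x. c' * (f x * g' x) + f x * h' x) \<in> fspan X"
      by (rule fspan_linear[OF X[OF \<open>f \<in> X\<close> step(1)] step(3)])
    then show ?case by (simp add: algebra_simps)
  qed
  from fspan_linear[OF this step(3)] show ?case by (simp add: algebra_simps)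
qed

type_synonym zindex = "bool \<times> nat \<times> nat \<times> nat \<times> nat"

text \<open>The Boolean selects the real or the imaginary part. The family spans but is not
  independent: conjugate monomials repeat up to sign and the imaginary part of the constant is 0, so
  orthogonalization has to cope with vanishing remainders.\<close>

fun zbasis :: "zindex \<Rightarrow> cmat2 \<Rightarrow> real" where
  "zbasis (r, a, b, c, d) x = (if r then Re (zmono a b c d x) else Im (zmono a b c d x))"

fun zdegree :: "zindex \<Rightarrow> nat" where
  "zdegree (r, a, b, c, d) = a + b + c + d"

lemma finite_zdegree: "finite {i. zdegree i \<le> n}"
proof (rule finite_subset)
  show "{i. zdegree i \<le> n} \<subseteq> UNIV \<times> {..n} \<times> {..n} \<times> {..n} \<times> {..n}" by auto
qed simp

lemma zbasis_eq: "zbasis (True, a, b, c, d) = (\<lambda>x. Re (zmono a b c d x))" "zbasis (False, a, b, c, d) = (\<lambda>x. Im (zmono a b c d x))"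
  by auto

lemma Ck_SU2_zbasis: "Ck_SU2 k (zbasis i)"
proof -
  obtain r a b c d where i: "i = (r, a, b, c, d)" by (cases i rule: zdegree.cases)
  show ?thesis
    unfolding i by (cases r) (simp_all only: zbasis_eq Ck_SU2_bounded_linear[OF Ck_SU2_zmono] bounded_linear_Re bounded_linear_Im)
qed

lemma along_zbasis:
  assumes "x \<in> SU2"
  shows "along a (zbasis (True, b, c, d, e)) x = Re (along a (zmono b c d e) x)"
    "along a (zbasis (False, b, c, d, e)) x = Im (along a (zmono b c d e) x)"
    "along a (along a' (zbasis (True, b, c, d, e))) x = Re (along a (along a' (zmono b c d e)) x)"
    "along a (along a' (zbasis (False, b, c, d, e))) x = Im (along a (along a' (zmono b c d e)) x)"
proof -
  note L = bounded_linear_Re bounded_linear_Im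
  have 1: "along a (zbasis (True, b, c, d, e)) x = Re (along a (zmono b c d e) x)"
    "along a (zbasis (False, b, c, d, e)) x = Im (along a (zmono b c d e) x)" if "x \<in> SU2" for a x
    using that by (simp_all only: zbasis_eq along_bounded_linear[OF Ck_SU2_zmono bounded_linear_Re]
        along_bounded_linear[OF Ck_SU2_zmono bounded_linear_Im])
  show "along a (zbasis (True, b, c, d, e)) x = Re (along a (zmono b c d e) x)"
    "along a (zbasis (False, b, c, d, e)) x = Im (along a (zmono b c d e) x)" using 1 assms by blast+
  have "along a (along a' (zbasis (True, b, c, d, e))) x = along a (\<lambda>x. Re (along a' (zmono b c d e) x)) x"
    by (rule along_cong[symmetric, OF Ck_SU2_bounded_linear[OF Ck_SU2_along_zmono bounded_linear_Re] _ assms]) (simp only: 1)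
  then show "along a (along a' (zbasis (True, b, c, d, e))) x = Re (along a (along a' (zmono b c d e)) x)"
    by (simp only: along_bounded_linear[OF Ck_SU2_along_zmono bounded_linear_Re assms])
  have "along a (along a' (zbasis (False, b, c, d, e))) x = along a (\<lambda>x. Im (along a' (zmono b c d e) x)) x"
    by (rule along_cong[symmetric, OF Ck_SU2_bounded_linear[OF Ck_SU2_along_zmono bounded_linear_Im] _ assms]) (simp only: 1)
  then show "along a (along a' (zbasis (False, b, c, d, e))) x = Im (along a (along a' (zmono b c d e)) x)"
    by (simp only: along_bounded_linear[OF Ck_SU2_along_zmono bounded_linear_Im assms])
qed

lemma Ck_SU2_along_zbasis: "Ck_SU2 k (along a (zbasis i))"
proof -
  obtain r b c d e where i: "i = (r, b, c, d, e)" by (cases i rule: zdegree.cases)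
  show ?thesis
  proof (cases r)
    case True
    show ?thesis unfolding i using True
      by (auto intro!: Ck_SU2_cong[OF Ck_SU2_bounded_linear[OF Ck_SU2_along_zmono bounded_linear_Re]] simp: along_zbasis)
  next
    case False
    show ?thesis unfolding i using False
      by (auto intro!: Ck_SU2_cong[OF Ck_SU2_bounded_linear[OF Ck_SU2_along_zmono bounded_linear_Im]] simp: along_zbasis)
  qed
qed

lemma zmono_mult: "zmono a b c d x * zmono a' b' c' d' x = zmono (a + a') (b + b') (c + c') (d + d') x"
  by (simp add: zmono_def power_add)

lemma cnj_zmono: "cnj (zmono a b c d x) = zmono c d a b x"
  by (simp add: zmono_def)

text \<open>Product-to-sum formulas: for monomials m and n both m n and m cnj n are monomials, and
  products of real or imaginary parts of m and n are half-sums or half-differences of parts of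
  these, real for equal flags and imaginary for different ones.\<close>

lemma zbasis_mult: "(\<lambda>x. zbasis i x * zbasis j x) \<in> fspan (range zbasis)"
proof -
  obtain r a b c d where i: "i = (r, a, b, c, d)" by (cases i rule: zdegree.cases)
  obtain s a' b' c' d' where j: "j = (s, a', b', c', d')" by (cases j rule: zdegree.cases)
  let ?m = "\<lambda>x. zmono (a + a') (b + b') (c + c') (d + d') x"
  let ?n = "\<lambda>x. zmono (a + c') (b + d') (c + a') (d + b') x"
  have m: "?m x = zmono a b c d x * zmono a' b' c' d' x" for x by (simp add: zmono_mult)
  have n: "?n x = zmono a b c d x * cnj (zmono a' b' c' d' x)" for x by (simp add: zmono_mult cnj_zmono)
  define T where "T = (\<lambda>k l p q. (\<lambda>x. k * zbasis (p, a + a', b + b', c + c', d + d') x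
      + l * zbasis (q, a + c', b + d', c + a', d + b') x))"
  have T: "T k l p q \<in> fspan (range zbasis)" for k l p q
    unfolding T_def by (intro fspan.step fspan_scale fspan_base rangeI)
  have "(\<lambda>x. zbasis i x * zbasis j x) = T (if r = s \<and> \<not> r then - (1 / 2) else 1 / 2)
      (if s \<and> \<not> r \<or> r = s then 1 / 2 else - (1 / 2)) (r = s) (r = s)"
    unfolding i j T_def zbasis.simps m n by (rule ext) (simp add: field_simps)
  then show ?thesis using T by simp
qed

lemma continuous_on_zbasis: "continuous_on S (zbasis i)"
proof -
  obtain r a b c d where i: "i = (r, a, b, c, d)" by (cases i rule: zdegree.cases)
  have m: "continuous_on S (zmono a b c d)" for a b c d
    using Ck_on_subset[OF Ck_on_zmono[of 0 a b c d], of S] by simp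
  show ?thesis
    unfolding i by (cases r) (simp_all only: zbasis_eq m continuous_on_Re continuous_on_Im)
qed

lemma fspan_continuous:
  assumes "f \<in> fspan X" "\<And>g. g \<in> X \<Longrightarrow> continuous_on S g"
  shows "continuous_on S f"
  using assms(1) by induction (simp_all add: assms(2) continuous_on_add continuous_on_mult_left)

text \<open>Stone-Weierstrass: the real and imaginary parts of z and w already separate points,
  since a matrix in SU(2) is determined by its first column.\<close>

lemma polynomials_dense:
  assumes f: "continuous_on SU2 f" and e: "0 < e"
  shows "\<exists>g\<in>fspan (range zbasis). \<forall>x\<in>SU2. \<bar>f x - g x\<bar> < e"
proof -
  interpret function_ring_on "fspan (range zbasis)" SU2
  proof
    show "compact SU2" by (rule compact_SU2)
    show "continuous_on SU2 f" if "f \<in> fspan (range zbasis)" for f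
      using that by (rule fspan_continuous) (auto intro: continuous_on_zbasis)
    show "(\<lambda>x. f x + g x) \<in> fspan (range zbasis)" if "f \<in> fspan (range zbasis)" "g \<in> fspan (range zbasis)" for f g
      using fspan_linear[OF that, of 1] by simp
    show "(\<lambda>x. f x * g x) \<in> fspan (range zbasis)" if "f \<in> fspan (range zbasis)" "g \<in> fspan (range zbasis)" for f g
      by (rule fspan_mult[OF _ that]) (auto intro: zbasis_mult)
    show "(\<lambda>_. c) \<in> fspan (range zbasis)" for c
      using fspan_scale[OF fspan_base[of "zbasis (True, 0, 0, 0, 0)" "range zbasis"], of c] by (simp add: zmono_def)
    fix x y assume xy: "x \<in> SU2" "y \<in> SU2" "x \<noteq> y"
    then have "x $ 1 $ 1 \<noteq> y $ 1 $ 1 \<or> x $ 2 $ 1 \<noteq> y $ 2 $ 1"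
      by (metis SU2_entries_eq)
    then have "zbasis (True, 1, 0, 0, 0) x \<noteq> zbasis (True, 1, 0, 0, 0) y \<or> zbasis (False, 1, 0, 0, 0) x \<noteq> zbasis (False, 1, 0, 0, 0) y \<or>
        zbasis (True, 0, 1, 0, 0) x \<noteq> zbasis (True, 0, 1, 0, 0) y \<or> zbasis (False, 0, 1, 0, 0) x \<noteq> zbasis (False, 0, 1, 0, 0) y"
      by (simp add: zmono_def complex_eq_iff)
    then show "\<exists>f\<in>fspan (range zbasis). f x \<noteq> f y"
      by (meson fspan_base rangeI)
  qed
  show ?thesis using Stone_Weierstrass_basic[OF f e] by blast
qed

section \<open>The spectral gap\<close>

locale berger_space =
  fixes t :: real
  assumes t: "0 < t"
begin

abbreviation \<mu> :: "cmat2 measure" where "\<mu> \<equiv> volume_element (berger t)"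

definition ip :: "(cmat2 \<Rightarrow> real) \<Rightarrow> (cmat2 \<Rightarrow> real) \<Rightarrow> real" where
  "ip u v = (\<integral>x. u x * v x \<partial>\<mu>)"

lemma integral_cong_SU2: "(\<And>x. x \<in> SU2 \<Longrightarrow> u x = v x) \<Longrightarrow> (\<integral>x. u x \<partial>\<mu>) = (\<integral>x. v x \<partial>\<mu>)"
  by (rule Bochner_Integration.integral_cong) auto

lemma integral_mono_SU2:
  fixes u v :: "cmat2 \<Rightarrow> real"
  assumes "continuous_on SU2 u" "continuous_on SU2 v" "\<And>x. x \<in> SU2 \<Longrightarrow> u x \<le> v x"
  shows "(\<integral>x. u x \<partial>\<mu>) \<le> (\<integral>x. v x \<partial>\<mu>)"
  by (rule integral_mono) (auto intro: integrable_volume t assms)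

lemma ip_integrable: "continuous_on SU2 u \<Longrightarrow> continuous_on SU2 v \<Longrightarrow> integrable \<mu> (\<lambda>x. u x * v x :: real)"
  by (intro integrable_volume t continuous_on_mult)

lemma ip_cong: "(\<And>x. x \<in> SU2 \<Longrightarrow> u x = u' x) \<Longrightarrow> (\<And>x. x \<in> SU2 \<Longrightarrow> v x = v' x) \<Longrightarrow> ip u v = ip u' v'"
  unfolding ip_def by (rule integral_cong_SU2) simp

lemma ip_sym: "ip u v = ip v u"
  by (simp add: ip_def mult.commute)

lemma ip_linear:
  assumes "continuous_on SU2 u" "continuous_on SU2 v" "continuous_on SU2 w"
  shows "ip (\<lambda>x. c * u x + v x) w = c * ip u w + ip v w"
  unfolding ip_def using ip_integrable[OF assms(1,3)] ip_integrable[OF assms(2,3)]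
  by (simp add: distrib_right mult.assoc)

lemma ip_linear_right:
  assumes "continuous_on SU2 u" "continuous_on SU2 v" "continuous_on SU2 w"
  shows "ip w (\<lambda>x. c * u x + v x) = c * ip w u + ip w v"
  using ip_linear[OF assms, of c] by (simp add: ip_sym)

lemma ip_nonneg: "0 \<le> ip u u"
  unfolding ip_def by (intro integral_nonneg_AE) simp

lemma ip_definite:
  assumes "continuous_on SU2 u" "ip u u = 0" "x \<in> SU2"
  shows "u x = 0"
  using integral_volume_eq_0_iff[OF t continuous_on_mult[OF assms(1,1)] _ assms(2)[unfolded ip_def] assms(3)] by simp

lemma fspan_orthogonal:
  assumes "f \<in> fspan X" "\<And>g. g \<in> X \<Longrightarrow> continuous_on SU2 g" "\<And>g. g \<in> X \<Longrightarrow> ip g u = 0"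
    "continuous_on SU2 u"
  shows "ip f u = 0"
  using assms(1)
proof induction
  case zero
  then show ?case by (simp add: ip_def)
next
  case (step f g c)
  have "continuous_on SU2 g" by (rule fspan_continuous[OF step(2) assms(2)])
  then show ?case by (simp add: ip_linear assms step)
qed

text \<open>Gram-Schmidt: the induction hypothesis for X is applied both to u and to the new
  generator e, whose remainder is the new orthogonal direction.\<close>

lemma projection:
  assumes "finite X" "\<And>g. g \<in> X \<Longrightarrow> continuous_on SU2 g" "continuous_on SU2 u"
  shows "\<exists>p\<in>fspan X. \<forall>h\<in>fspan X. ip h (\<lambda>x. u x - p x) = 0"
  using assms
proof (induction X arbitrary: u rule: finite_induct)
  case empty
  have "h = (\<lambda>x. 0)" if "h \<in> fspan {}" for h :: "cmat2 \<Rightarrow> real"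
    using that by induction auto
  then have "ip h v = 0" if "h \<in> fspan {}" for h v
    unfolding ip_def using that by fastforce
  then show ?case by (intro bexI[of _ "\<lambda>x. 0"] fspan.zero) auto
next
  case (insert e X)
  have X: "continuous_on SU2 g" if "g \<in> X" for g using insert.prems(1) that by simp
  have e: "continuous_on SU2 e" using insert.prems(1) by simp
  obtain p0 where p0: "p0 \<in> fspan X" "\<And>h. h \<in> fspan X \<Longrightarrow> ip h (\<lambda>x. u x - p0 x) = 0"
    using insert.IH[OF X insert.prems(2)] by blast
  obtain q where q: "q \<in> fspan X" "\<And>h. h \<in> fspan X \<Longrightarrow> ip h (\<lambda>x. e x - q x) = 0"
    using insert.IH[OF X e] by blast
  have c: "continuous_on SU2 p0" "continuous_on SU2 q"
    by (auto intro: fspan_continuous[OF p0(1) X] fspan_continuous[OF q(1) X])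
  define f where "f = (\<lambda>x. e x - q x)"
  define r where "r = (\<lambda>x. u x - p0 x)"
  have fr: "continuous_on SU2 f" "continuous_on SU2 r"
    unfolding f_def r_def by (intro continuous_intros e c insert.prems(2))+
  \<comment> \<open>When e adds nothing on SU(2), ip f f = 0 and k = 0 by the convention for
    division; \<open>kf\<close> still holds because f then vanishes on SU(2).\<close>
  define k where "k = ip r f / ip f f"
  have kf: "ip f r - k * ip f f = 0"
  proof (cases "ip f f = 0")
    case True
    have "ip f r = ip (\<lambda>x. 0) r" by (rule ip_cong) (auto intro: ip_definite[OF fr(1) True])
    then show ?thesis using True by (simp add: ip_def)
  qed (simp add: k_def ip_sym)
  define p where "p = (\<lambda>x. k * e x + (- k * q x + p0 x))"
  have "p \<in> fspan (insert e X)"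
    unfolding p_def using p0(1) q(1) fspan_mono[of X "insert e X"]
    by (intro fspan.step fspan_linear) auto
  moreover have "ip h (\<lambda>x. u x - p x) = 0" if h: "h \<in> fspan (insert e X)" for h
  proof -
    have up: "(\<lambda>x. u x - p x) = (\<lambda>x. - k * f x + r x)"
      by (auto simp: p_def f_def r_def algebra_simps)
    have cup: "continuous_on SU2 (\<lambda>x. u x - p x)"
      unfolding up by (intro continuous_intros fr)
    have g0: "ip g (\<lambda>x. u x - p x) = 0" if g: "g \<in> fspan X" for g
      unfolding up
      using ip_linear_right[OF fr fspan_continuous[OF g X], of "- k"] p0(2)[OF g] q(2)[OF g]
      by (simp add: f_def r_def)
    have "ip f (\<lambda>x. u x - p x) = 0"
      unfolding up using ip_linear_right[OF fr fr(1), of "- k"] kf by simp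
    moreover have "e = (\<lambda>x. 1 * f x + q x)" by (simp add: f_def)
    ultimately have "ip e (\<lambda>x. u x - p x) = 0"
      using ip_linear[OF fr(1) c(2) cup, of 1] g0[OF q(1)] by simp
    then show ?thesis
      using fspan_orthogonal[OF h insert.prems(1) _ cup] g0 fspan_base by blast
  qed
  ultimately show ?case by blast
qed

text \<open>The frame fields are divergence free, so the derivative of the product (E_a u) v
  integrates to 0.\<close>

lemma integration_by_parts:
  fixes u v :: "cmat2 \<Rightarrow> real"
  assumes u: "Ck_SU2 1 u" "Ck_SU2 1 (along a u)" and v: "Ck_SU2 1 v"
  shows "ip (along a u) (along a v) = - ip (along a (along a u)) v"
proof -
  have "0 = (\<integral>x. along a (\<lambda>x. along a u x * v x) x \<partial>\<mu>)"
    by (rule integral_along[OF t Ck_SU2_mult[OF u(2) v], symmetric])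
  also have "\<dots> = (\<integral>x. along a u x * along a v x + along a (along a u) x * v x \<partial>\<mu>)"
    by (rule integral_cong_SU2) (rule along_mult[OF u(2) v])
  also have "\<dots> = ip (along a u) (along a v) + ip (along a (along a u)) v"
    unfolding ip_def
    by (intro Bochner_Integration.integral_add ip_integrable continuous_on_along C1_continuous_on u v)
  finally show ?thesis by simp
qed

end

text \<open>The value 0 of \<kappa> belongs to s = infinity, where the cometric degenerates along
  E_3; a parameter \<kappa> in place of s treats this case together with the others.\<close>

locale berger_gap = berger_space +
  fixes \<kappa> :: real
  assumes \<kappa>: "0 \<le> \<kappa>" "\<kappa> \<le> 6"
begin

definition dirichlet :: "(cmat2 \<Rightarrow> real) \<Rightarrow> (cmat2 \<Rightarrow> real) \<Rightarrow> real" where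
  "dirichlet u v = ip (along 1 u) (along 1 v) + ip (along 2 u) (along 2 v) + \<kappa> * ip (along 3 u) (along 3 v)"

lemma dirichlet_sym: "dirichlet u v = dirichlet v u"
  by (simp add: dirichlet_def ip_sym)

lemma dirichlet_linear:
  assumes "Ck_SU2 1 u" "Ck_SU2 1 v" "Ck_SU2 1 w"
  shows "dirichlet (\<lambda>x. c * u x + v x) w = c * dirichlet u w + dirichlet v w"
proof -
  have "ip (along a (\<lambda>x. c * u x + v x)) (along a w) = c * ip (along a u) (along a w) + ip (along a v) (along a w)" for a
  proof -
    have "ip (along a (\<lambda>x. c * u x + v x)) (along a w) = ip (\<lambda>x. c * along a u x + along a v x) (along a w)"
      by (rule ip_cong) (simp_all add: along_linear assms[unfolded One_nat_def])
    then show ?thesis by (simp add: ip_linear continuous_on_along assms[unfolded One_nat_def])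
  qed
  then show ?thesis by (simp add: dirichlet_def algebra_simps)
qed

lemma dirichlet_linear_right:
  assumes "Ck_SU2 1 u" "Ck_SU2 1 v" "Ck_SU2 1 w"
  shows "dirichlet w (\<lambda>x. c * u x + v x) = c * dirichlet w u + dirichlet w v"
  using dirichlet_linear[OF assms, of c] by (simp add: dirichlet_sym)

lemma dirichlet_nonneg: "0 \<le> dirichlet u u"
  unfolding dirichlet_def using ip_nonneg \<kappa> by (simp add: add_nonneg_nonneg)

fun eigenvalue :: "zindex \<Rightarrow> real" where
  "eigenvalue (r, a, b, c, d) =
     4 * real (a + b) * real (c + d) + 2 * real (a + b + c + d) + \<kappa> * (real (a + b) - real (c + d))\<^sup>2"

text \<open>For p = q the \<kappa> term drops out and 4 p^2 + 4 p >= 8 has to dominate 2 + \<kappa>,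
  which is where \<kappa> <= 6 enters. For p and q different, (p - q)^2 >= 1 and p + q >= 1
  suffice.\<close>

lemma eigenvalue_ge:
  assumes "zdegree i \<ge> 1"
  shows "2 + \<kappa> \<le> eigenvalue i"
proof -
  obtain r a b c d where i: "i = (r, a, b, c, d)" by (cases i rule: zdegree.cases)
  define p q where "p = a + b" and "q = c + d"
  have pq: "p + q \<ge> 1" using assms by (simp add: i p_def q_def)
  have e: "eigenvalue i = 4 * (real p * real q) + 2 * (real p + real q) + \<kappa> * (real p - real q)\<^sup>2"
    by (simp add: i p_def q_def algebra_simps)
  show ?thesis
  proof (cases "p = q")
    case True
    then have p: "real p \<ge> 1" using pq by simp
    then have "real p * real p \<ge> 1" by (metis mult_mono' mult_1 zero_le_one)
    then show ?thesis unfolding e using True \<kappa> p by simp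
  next
    case False
    then have "1 \<le> \<bar>real p - real q\<bar>" by linarith
    then have "1 \<le> (real p - real q)\<^sup>2" by (metis one_le_power power2_abs)
    then have "\<kappa> * 1 \<le> \<kappa> * (real p - real q)\<^sup>2" using \<kappa> by (intro mult_left_mono)
    moreover have "real p + real q \<ge> 1" using pq by linarith
    moreover have "0 \<le> real p * real q" by simp
    ultimately have "0 + 2 * 1 + \<kappa> * 1 \<le> eigenvalue i"
      unfolding e by (intro add_mono) simp_all
    then show ?thesis by simp
  qed
qed

definition one :: "cmat2 \<Rightarrow> real" where "one x = 1"

lemma Ck_SU2_one: "Ck_SU2 k one"
  unfolding one_def[abs_def] by (rule Ck_SU2_const)

lemma dirichlet_one: "dirichlet one v = 0"
proof -
  have "ip (along a one) w = ip (\<lambda>x. 0) w" for a w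
    by (rule ip_cong) (simp_all add: one_def[abs_def])
  then show ?thesis by (simp add: dirichlet_def ip_def)
qed

lemma fspan_C1:
  assumes "f \<in> fspan X" "\<And>g. g \<in> X \<Longrightarrow> Ck_SU2 1 g"
  shows "Ck_SU2 1 f"
  using assms(1) by induction (assumption | rule Ck_SU2_const Ck_SU2_linear assms(2))+

text \<open>The constants form the separate generator \<open>one\<close>: their eigenvalue 0
  violates the gap, and \<open>triangular\<close> keeps indices of degree 0 out of S.\<close>

definition below :: "zindex set \<Rightarrow> nat \<Rightarrow> (cmat2 \<Rightarrow> real) set" where
  "below S n = fspan (insert one (zbasis ` {j \<in> S. zdegree j < n}))"

text \<open>Triangularity of the Laplacian is expressed weakly, against \<open>C\<^sup>1\<close> test functions, since
  functions that agree on \<open>SU(2)\<close> need not be equal.\<close>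

definition triangular :: "zindex set \<Rightarrow> bool" where
  "triangular S \<longleftrightarrow> (\<forall>i\<in>S. zdegree i \<ge> 1 \<and> (\<exists>r\<in>below S (zdegree i).
     \<forall>v. Ck_SU2 1 v \<longrightarrow> dirichlet (zbasis i) v = ip (\<lambda>x. eigenvalue i * zbasis i x + r x) v))"

lemma C1_gen: "g \<in> insert one (zbasis ` S) \<Longrightarrow> Ck_SU2 1 g"
  by (auto intro: Ck_SU2_one Ck_SU2_zbasis)

text \<open>Triangularity makes the span invariant under the operator: for a generator other than
  \<open>one\<close>, the form against u is the inner product of u with another element of the
  span.\<close>

lemma dirichlet_span_orthogonal:
  assumes S: "triangular S" and y: "y \<in> fspan (insert one (zbasis ` S))" and u: "Ck_SU2 1 u"
    and orth: "\<And>h. h \<in> fspan (insert one (zbasis ` S)) \<Longrightarrow> ip h u = 0"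
  shows "dirichlet y u = 0"
  using y
proof induction
  case zero
  have "dirichlet (\<lambda>x. -1 * one x + one x) u = 0"
    by (subst dirichlet_linear[OF Ck_SU2_one Ck_SU2_one u]) (simp add: dirichlet_one)
  then show ?case by (simp add: one_def)
next
  case (step f g c)
  have "dirichlet f u = 0"
  proof (cases "f = one")
    case False
    then obtain i where i: "i \<in> S" "f = zbasis i" using step(1) by auto
    then obtain r where r: "r \<in> below S (zdegree i)"
      "\<And>v. Ck_SU2 1 v \<Longrightarrow> dirichlet (zbasis i) v = ip (\<lambda>x. eigenvalue i * zbasis i x + r x) v"
      using S unfolding triangular_def by blast
    have "below S (zdegree i) \<subseteq> fspan (insert one (zbasis ` S))"
      unfolding below_def by (rule fspan_mono) auto
    then have "(\<lambda>x. eigenvalue i * zbasis i x + r x) \<in> fspan (insert one (zbasis ` S))"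
      using r(1) i by (intro fspan.step) auto
    then show ?thesis using r(2)[OF u] orth i by simp
  qed (simp add: dirichlet_one)
  then show ?case
    using dirichlet_linear[OF C1_gen[OF step(1)] fspan_C1[OF step(2) C1_gen] u] step(3) by simp
qed

text \<open>Induction over the indices in order of degree. The last generator splits u into c f +
  w', orthogonally for both \<open>ip\<close> and \<open>dirichlet\<close>; f is controlled by its
  eigenvalue and w' by the induction hypothesis.\<close>

lemma polynomial_gap:
  assumes "finite S" "triangular S" "u \<in> fspan (insert one (zbasis ` S))" "ip one u = 0"
  shows "(2 + \<kappa>) * ip u u \<le> dirichlet u u"
  using assms
proof (induction S arbitrary: u rule: finite_ranking_induct[where f = zdegree])
  case empty
  then obtain c g where g: "g \<in> fspan {}" "u = (\<lambda>x. c * one x + g x)"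
    using fspan_insertD[of u one "{}"] by auto
  have "g = (\<lambda>x. 0)" using g(1) by induction auto
  then have u: "u = (\<lambda>x. c * one x + 0 * one x)" using g by simp
  have "ip u u = c * ip one u" unfolding u
    using ip_linear[of one "\<lambda>x. 0 * one x" "\<lambda>x. c * one x + 0 * one x" c] C1_continuous_on[OF Ck_SU2_one]
    by (simp add: ip_def one_def)
  then show ?case using empty dirichlet_nonneg by simp
next
  case (insert i S)
  let ?Y = "fspan (insert one (zbasis ` S))"
  show ?case
  proof (cases "i \<in> S")
    case True
    then show ?thesis using insert by (simp add: insert_absorb)
  next
    case False
    \<comment> \<open>The new index has maximal degree, so it is strictly below no degree in the set
      and leaves the lower spaces unchanged.\<close>
    have b: "below (insert i S) (zdegree j) = below S (zdegree j)" if "j \<in> insert i S" for j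
    proof -
      have "zdegree j \<le> zdegree i" using insert.hyps(2)[of j] that by blast
      then have "{k \<in> insert i S. zdegree k < zdegree j} = {k \<in> S. zdegree k < zdegree j}" by auto
      then show ?thesis unfolding below_def by (simp only:)
    qed
    have S: "triangular S"
      using insert.prems(1) b[OF insertI2] unfolding triangular_def by simp
    obtain r where i1: "zdegree i \<ge> 1" and r: "r \<in> below (insert i S) (zdegree i)"
      "\<And>v. Ck_SU2 1 v \<Longrightarrow> dirichlet (zbasis i) v = ip (\<lambda>x. eigenvalue i * zbasis i x + r x) v"
      using insert.prems(1) unfolding triangular_def by blast
    have "below S (zdegree i) \<subseteq> ?Y"
      unfolding below_def by (rule fspan_mono) auto
    then have rY: "r \<in> ?Y" using r(1) b by blast
    have Yc: "g \<in> ?Y \<Longrightarrow> Ck_SU2 1 g" for g using fspan_C1[OF _ C1_gen] .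
    have "\<exists>p\<in>?Y. \<forall>h\<in>?Y. ip h (\<lambda>x. zbasis i x - p x) = 0"
      by (rule projection) (use insert.hyps(1) in \<open>auto intro: C1_continuous_on C1_gen continuous_on_zbasis\<close>)
    then obtain q where q: "q \<in> ?Y" "\<And>h. h \<in> ?Y \<Longrightarrow> ip h (\<lambda>x. zbasis i x - q x) = 0" by blast
    \<comment> \<open>Since \<open>f\<close> is orthogonal to the span and the form is symmetric, triangularity makes \<open>f\<close> an eigenvector.\<close>
    define f where "f = (\<lambda>x. -1 * q x + zbasis i x)"
    have f: "ip h f = 0" if "h \<in> ?Y" for h using q(2)[OF that] by (simp add: f_def)
    have fC: "Ck_SU2 1 f" unfolding f_def by (intro Ck_SU2_linear Yc q Ck_SU2_zbasis)
    have fc: "continuous_on SU2 f" by (rule C1_continuous_on[OF fC])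
    have bf: "zbasis i = (\<lambda>x. 1 * f x + q x)" by (auto simp: f_def)
    obtain c w where w: "w \<in> ?Y" "u = (\<lambda>x. c * zbasis i x + w x)"
      using fspan_insertD[of u "zbasis i" "insert one (zbasis ` S)"] insert.prems(2) by (auto simp: insert_commute)
    define w' where "w' = (\<lambda>x. c * q x + w x)"
    have w'Y: "w' \<in> ?Y" unfolding w'_def by (rule fspan_linear[OF q(1) w(1)])
    have w'C: "Ck_SU2 1 w'" by (rule Yc[OF w'Y])
    have w'c: "continuous_on SU2 w'" by (rule C1_continuous_on[OF w'C])
    have u: "u = (\<lambda>x. c * f x + w' x)" by (auto simp: w f_def w'_def algebra_simps)
    have uC: "Ck_SU2 1 u" unfolding u by (intro Ck_SU2_linear fC w'C)
    have one: "one \<in> ?Y" by (rule fspan_base) simp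
    have dY: "dirichlet y f = 0" if "y \<in> ?Y" for y
      by (rule dirichlet_span_orthogonal[OF S that fC f])
    \<comment> \<open>The generator and f differ by q in the span, to which f is orthogonal in both
      forms; the remainder r lies in the span as well, so only the eigenvalue of the index
      survives.\<close>
    have "dirichlet f f = dirichlet (zbasis i) f"
      unfolding f_def
      using dirichlet_linear[OF Yc[OF q(1)] Ck_SU2_zbasis fC, of "-1"] dY[OF q(1)] by (simp add: f_def)
    also have "\<dots> = eigenvalue i * ip (zbasis i) f"
      using r(2)[OF fC] ip_linear[OF continuous_on_zbasis C1_continuous_on[OF Yc[OF rY]] fc] f[OF rY] by simp
    also have "ip (zbasis i) f = ip f f"
      using ip_linear[OF fc C1_continuous_on[OF Yc[OF q(1)]] fc, of 1] f[OF q(1)] bf by simp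
    finally have dff: "dirichlet f f = eigenvalue i * ip f f" .
    have "(2 + \<kappa>) * ip f f \<le> dirichlet f f"
      unfolding dff by (intro mult_right_mono eigenvalue_ge i1 ip_nonneg)
    then have 1: "(2 + \<kappa>) * (c\<^sup>2 * ip f f) \<le> c\<^sup>2 * dirichlet f f"
      using mult_left_mono[of "(2 + \<kappa>) * ip f f" "dirichlet f f" "c\<^sup>2"] by (simp add: algebra_simps)
    have "ip one w' = 0"
      using ip_linear_right[OF fc w'c C1_continuous_on[OF Ck_SU2_one], of c] insert.prems(3) f[OF one] unfolding u by simp
    then have 2: "(2 + \<kappa>) * ip w' w' \<le> dirichlet w' w'"
      by (rule insert.IH[OF S w'Y])
    have uc: "continuous_on SU2 u" by (rule C1_continuous_on[OF uC])
    have "ip u u = c * ip f u + ip w' u"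
      using ip_linear[OF fc w'c uc, of c] unfolding u[symmetric] .
    also have "ip f u = c * ip f f + ip f w'"
      using ip_linear_right[OF fc w'c fc, of c] unfolding u[symmetric] .
    also have "ip w' u = c * ip w' f + ip w' w'"
      using ip_linear_right[OF fc w'c w'c, of c] unfolding u[symmetric] .
    finally have 3: "ip u u = c\<^sup>2 * ip f f + ip w' w'"
      using f[OF w'Y] by (simp add: ip_sym[of f w'] power2_eq_square)
    have "dirichlet u u = c * dirichlet f u + dirichlet w' u"
      using dirichlet_linear[OF fC w'C uC, of c] unfolding u[symmetric] .
    also have "dirichlet f u = c * dirichlet f f + dirichlet f w'"
      using dirichlet_linear_right[OF fC w'C fC, of c] unfolding u[symmetric] .
    also have "dirichlet w' u = c * dirichlet w' f + dirichlet w' w'"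
      using dirichlet_linear_right[OF fC w'C w'C, of c] unfolding u[symmetric] .
    finally have 4: "dirichlet u u = c\<^sup>2 * dirichlet f f + dirichlet w' w'"
      using dY[OF w'Y] by (simp add: dirichlet_sym[of f w'] power2_eq_square)
    show ?thesis unfolding 3 4 using 1 2 by (simp add: distrib_left)
  qed
qed

lemma dirichlet_by_parts:
  assumes u: "Ck_SU2 1 u" "\<And>a. Ck_SU2 1 (along a u)" and v: "Ck_SU2 1 v"
  shows "dirichlet u v = ip (\<lambda>x. - (along 1 (along 1 u) x + along 2 (along 2 u) x + \<kappa> * along 3 (along 3 u) x)) v"
proof -
  have c: "continuous_on SU2 (along a (along a u))" for a by (rule continuous_on_along[OF u(2)])
  have vc: "continuous_on SU2 v" by (rule C1_continuous_on[OF v])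
  have "ip (\<lambda>x. - (along 1 (along 1 u) x + along 2 (along 2 u) x + \<kappa> * along 3 (along 3 u) x)) v =
      ip (\<lambda>x. (- \<kappa>) * along 3 (along 3 u) x + (- 1 * along 1 (along 1 u) x + (- 1 * along 2 (along 2 u) x + 0))) v"
    by (rule ip_cong) simp_all
  also have "\<dots> = (- \<kappa>) * ip (along 3 (along 3 u)) v + (- 1 * ip (along 1 (along 1 u)) v + (- 1 * ip (along 2 (along 2 u)) v + ip (\<lambda>x. 0) v))"
    by (simp only: ip_linear c vc continuous_on_add continuous_on_mult continuous_on_const)
  also have "ip (\<lambda>x. 0) v = 0" by (simp add: ip_def)
  also have "- \<kappa> * ip (along 3 (along 3 u)) v + (- 1 * ip (along 1 (along 1 u)) v + (- 1 * ip (along 2 (along 2 u)) v + 0)) = dirichlet u v"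
    by (simp add: dirichlet_def integration_by_parts[OF u v])
  finally show ?thesis by simp
qed

section \<open>Polynomials of bounded degree\<close>

definition zindices :: "nat \<Rightarrow> zindex set" where "zindices n = {i. 1 \<le> zdegree i \<and> zdegree i \<le> n}"

lemma finite_zindices: "finite (zindices n)"
  unfolding zindices_def by (rule finite_subset[OF _ finite_zdegree[of n]]) auto

text \<open>Degree 0 is absorbed by \<open>one\<close>. The bound includes m = Suc n so that every
  degree up to n is reached.\<close>

lemma zbasis_below:
  assumes "zdegree i < m" "m \<le> Suc n"
  shows "zbasis i \<in> below (zindices n) m"
proof (cases "zdegree i = 0")
  case True
  then obtain r where "i = (r, 0, 0, 0, 0)" by (cases i rule: zdegree.cases) auto
  then have "zbasis i = (\<lambda>x. (if r then 1 else 0) * one x + 0)"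
    by (auto simp: zmono_def one_def)
  moreover have "(\<lambda>x. (if r then 1 else 0) * one x + 0) \<in> below (zindices n) m"
    unfolding below_def by (intro fspan.step fspan.zero) simp
  ultimately show ?thesis by simp
next
  case False
  then show ?thesis using assms unfolding below_def
    by (intro fspan_base) (auto simp: zindices_def intro!: imageI)
qed

lemma dirichlet_zbasis:
  assumes v: "Ck_SU2 1 v"
  shows "dirichlet (zbasis (s, a, b, c, d)) v = ip (\<lambda>x. eigenvalue (s, a, b, c, d) * zbasis (s, a, b, c, d) x +
    (- (4 * real (a * c)) * zbasis (s, a - 1, b, c - 1, d) x +
      (- (4 * real (b * d)) * zbasis (s, a, b - 1, c, d - 1) x + 0))) v"
proof -
  let ?b = "zbasis (s, a, b, c, d)"
  have "- (along 1 (along 1 ?b) x + along 2 (along 2 ?b) x + \<kappa> * along 3 (along 3 ?b) x) =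
      eigenvalue (s, a, b, c, d) * ?b x +
      (- (4 * real (a * c)) * zbasis (s, a - 1, b, c - 1, d) x +
        (- (4 * real (b * d)) * zbasis (s, a, b - 1, c, d - 1) x + 0))" if x: "x \<in> SU2" for x
  proof -
    have 12: "along 1 (along 1 (zmono a b c d)) x + along 2 (along 2 (zmono a b c d)) x =
        of_real (- real (4 * (a + b) * (c + d) + 2 * (a + b + c + d))) * zmono a b c d x +
        (of_real (4 * real (a * c)) * zmono (a - 1) b (c - 1) d x + of_real (4 * real (b * d)) * zmono a (b - 1) c (d - 1) x)"
      using sublaplacian_zmono[OF x, of a b c d] by simp
    have 3: "along 3 (along 3 (zmono a b c d)) x = of_real (- (real (a + b) - real (c + d))\<^sup>2) * zmono a b c d x"
      using along_along_3[OF x, of a b c d] by simp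
    show ?thesis
    proof (cases s)
      case True
      show ?thesis
        using arg_cong[OF 12, of Re] arg_cong[OF 3, of Re] True
        by (simp add: along_zbasis[OF x] del: of_real_mult of_real_add of_real_diff of_real_power) (simp add: algebra_simps)
    next
      case False
      show ?thesis
        using arg_cong[OF 12, of Im] arg_cong[OF 3, of Im] False
        by (simp add: along_zbasis[OF x] del: of_real_mult of_real_add of_real_diff of_real_power) (simp add: algebra_simps)
    qed
  qed
  then show ?thesis
    unfolding dirichlet_by_parts[OF Ck_SU2_zbasis Ck_SU2_along_zbasis v] by (intro ip_cong) auto
qed

lemma triangular_zindices: "triangular (zindices n)"
  unfolding triangular_def
proof (intro ballI conjI)
  fix i assume i: "i \<in> zindices n"
  then show "1 \<le> zdegree i" by (simp add: zindices_def)
  obtain s a b c d where ieq: "i = (s, a, b, c, d)" by (cases i rule: zdegree.cases)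
  define r where "r = (\<lambda>x. - (4 * real (a * c)) * zbasis (s, a - 1, b, c - 1, d) x
      + (- (4 * real (b * d)) * zbasis (s, a, b - 1, c, d - 1) x + 0))"
  have "r \<in> below (zindices n) (zdegree i)"
  proof -
    \<comment> \<open>A nonzero coefficient such as 4 a c forces a and c to be positive, so the
      degree really drops; for coefficient 0 the truncated index may keep the full degree, but its
      term vanishes.\<close>
    have sc: "(\<lambda>x. k * zbasis j x + g x) \<in> below (zindices n) (zdegree i)"
      if "g \<in> below (zindices n) (zdegree i)" "k \<noteq> 0 \<Longrightarrow> zdegree j < zdegree i" for k j g
    proof (cases "k = 0")
      case False
      then have "zbasis j \<in> below (zindices n) (zdegree i)"
        using that i by (intro zbasis_below) (auto simp: zindices_def)
      then show ?thesis using that(1) unfolding below_def by (intro fspan_linear)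
    qed (use that in simp)
    show ?thesis unfolding r_def
      by (intro sc) (auto simp: below_def ieq intro: fspan.zero)
  qed
  moreover have "dirichlet (zbasis i) v = ip (\<lambda>x. eigenvalue i * zbasis i x + r x) v" if "Ck_SU2 1 v" for v
    unfolding ieq r_def by (rule dirichlet_zbasis[OF that])
  ultimately show "\<exists>r\<in>below (zindices n) (zdegree i). \<forall>v. Ck_SU2 1 v \<longrightarrow>
      dirichlet (zbasis i) v = ip (\<lambda>x. eigenvalue i * zbasis i x + r x) v"
    by (intro bexI[of _ r] allI impI)
qed

lemma fspan_zbasis_finite:
  assumes "q \<in> fspan (range zbasis)"
  shows "\<exists>n. q \<in> fspan (insert one (zbasis ` zindices n))"
  using assms
proof induction
  case zero
  show ?case by (auto intro: fspan.zero)
next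
  case (step f g c)
  then obtain n i where n: "g \<in> fspan (insert one (zbasis ` zindices n))" and i: "f = zbasis i" by blast
  define m where "m = max n (zdegree i)"
  have "below (zindices m) (Suc m) \<subseteq> fspan (insert one (zbasis ` zindices m))"
    unfolding below_def by (rule fspan_mono) auto
  then have "f \<in> fspan (insert one (zbasis ` zindices m))"
    using zbasis_below[of i "Suc m" m] unfolding i by (auto simp: m_def)
  moreover have "zindices n \<subseteq> zindices m" unfolding zindices_def m_def by auto
  then have "g \<in> fspan (insert one (zbasis ` zindices m))"
    using n fspan_mono[of "insert one (zbasis ` zindices n)" "insert one (zbasis ` zindices m)"] by blast
  ultimately show ?case using fspan_linear by blast
qed

text \<open>The projection p of u onto polynomials of degree at most n satisfies the gap and, by
  invariance, has Dirichlet energy at most that of u. Its L^2 error is at most that of the uniform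
  approximant q in the same space, so only u itself has to be approximated, not its derivatives;
  then e tends to 0.\<close>

theorem spectral_gap:
  assumes u: "Ck_SU2 1 u" and mean: "(\<integral>x. u x \<partial>\<mu>) = 0"
  shows "(2 + \<kappa>) * (\<integral>x. (u x)\<^sup>2 \<partial>\<mu>) \<le>
    (\<integral>x. (along 1 u x)\<^sup>2 + (along 2 u x)\<^sup>2 + \<kappa> * (along 3 u x)\<^sup>2 \<partial>\<mu>)"
proof -
  have uc: "continuous_on SU2 u" by (rule C1_continuous_on[OF u])
  have approx: "(2 + \<kappa>) * ip u u \<le> dirichlet u u + (2 + \<kappa>) * (e\<^sup>2 * measure \<mu> SU2)" if e: "0 < e" for e
  proof -
    obtain q where q: "q \<in> fspan (range zbasis)" "\<And>x. x \<in> SU2 \<Longrightarrow> \<bar>u x - q x\<bar> < e"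
      using polynomials_dense[OF uc e] by blast
    obtain n where n: "q \<in> fspan (insert one (zbasis ` zindices n))" using fspan_zbasis_finite[OF q(1)] by blast
    let ?Y = "fspan (insert one (zbasis ` zindices n))"
    have Yc: "g \<in> ?Y \<Longrightarrow> Ck_SU2 1 g" for g using fspan_C1[OF _ C1_gen] .
    have "\<exists>p\<in>?Y. \<forall>h\<in>?Y. ip h (\<lambda>x. u x - p x) = 0"
      by (rule projection) (use finite_zindices uc in \<open>auto intro: C1_continuous_on C1_gen\<close>)
    then obtain p where p: "p \<in> ?Y" "\<And>h. h \<in> ?Y \<Longrightarrow> ip h (\<lambda>x. u x - p x) = 0" by blast
    define f where "f = (\<lambda>x. -1 * p x + u x)"
    have f: "ip h f = 0" if "h \<in> ?Y" for h using p(2)[OF that] by (simp add: f_def)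
    have pC: "Ck_SU2 1 p" by (rule Yc[OF p(1)])
    have pc: "continuous_on SU2 p" by (rule C1_continuous_on[OF pC])
    have fC: "Ck_SU2 1 f" unfolding f_def by (intro Ck_SU2_linear pC u)
    have fc: "continuous_on SU2 f" by (rule C1_continuous_on[OF fC])
    have uf: "u = (\<lambda>x. 1 * f x + p x)" by (auto simp: f_def)
    have df: "dirichlet p f = 0" by (rule dirichlet_span_orthogonal[OF triangular_zindices p(1) fC f])
    have one: "one \<in> ?Y" by (rule fspan_base) simp
    have "ip one u = 0" using mean by (simp add: ip_def one_def)
    then have "ip one p = 0"
      using ip_linear_right[OF fc pc C1_continuous_on[OF Ck_SU2_one], of 1] f[OF one] unfolding uf[symmetric] by simp
    then have gap: "(2 + \<kappa>) * ip p p \<le> dirichlet p p"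
      by (rule polynomial_gap[OF finite_zindices triangular_zindices p(1)])
    have "dirichlet u u = 1 * dirichlet f u + dirichlet p u"
      using dirichlet_linear[OF fC pC u, of 1] unfolding uf[symmetric] .
    also have "dirichlet f u = 1 * dirichlet f f + dirichlet f p"
      using dirichlet_linear_right[OF fC pC fC, of 1] unfolding uf[symmetric] .
    also have "dirichlet p u = 1 * dirichlet p f + dirichlet p p"
      using dirichlet_linear_right[OF fC pC pC, of 1] unfolding uf[symmetric] .
    finally have d: "dirichlet p p \<le> dirichlet u u" using df dirichlet_nonneg[of f] by (simp add: dirichlet_sym[of f p])
    have "ip u u = 1 * ip f u + ip p u"
      using ip_linear[OF fc pc uc, of 1] unfolding uf[symmetric] .
    also have "ip f u = 1 * ip f f + ip f p"
      using ip_linear_right[OF fc pc fc, of 1] unfolding uf[symmetric] .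
    also have "ip p u = 1 * ip p f + ip p p"
      using ip_linear_right[OF fc pc pc, of 1] unfolding uf[symmetric] .
    finally have i: "ip u u = ip f f + ip p p" using f[OF p(1)] by (simp add: ip_sym[of f p])
    \<comment> \<open>The error u - q is the orthogonal sum of f = u - p and g = p - q, the latter
      in the span; by Pythagoras p is the better approximation.\<close>
    define g where "g = (\<lambda>x. -1 * q x + p x)"
    have gY: "g \<in> ?Y" unfolding g_def by (rule fspan_linear[OF n p(1)])
    have gc: "continuous_on SU2 g" by (rule C1_continuous_on[OF Yc[OF gY]])
    define h where "h = (\<lambda>x. 1 * f x + g x)"
    have hu: "h = (\<lambda>x. u x - q x)" by (auto simp: h_def f_def g_def)
    have hc: "continuous_on SU2 h" unfolding h_def by (intro continuous_intros fc gc)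
    have "ip h h = 1 * ip f h + ip g h"
      using ip_linear[OF fc gc hc, of 1] unfolding h_def[symmetric] .
    also have "ip f h = 1 * ip f f + ip f g"
      using ip_linear_right[OF fc gc fc, of 1] unfolding h_def[symmetric] .
    also have "ip g h = 1 * ip g f + ip g g"
      using ip_linear_right[OF fc gc gc, of 1] unfolding h_def[symmetric] .
    finally have "ip f f \<le> ip h h" using f[OF gY] ip_nonneg[of g] by (simp add: ip_sym[of f g])
    also have "\<dots> \<le> (\<integral>x. e\<^sup>2 \<partial>\<mu>)"
      unfolding ip_def
    proof (rule integral_mono_SU2)
      show "h x * h x \<le> e\<^sup>2" if "x \<in> SU2" for x
        using q(2)[OF that] e unfolding hu power2_eq_square[symmetric]
        by (metis abs_le_square_iff abs_of_pos less_imp_le)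
    qed (intro continuous_intros hc)+
    also have "\<dots> = e\<^sup>2 * measure \<mu> SU2" by (simp add: mult.commute)
    finally have "ip f f \<le> e\<^sup>2 * measure \<mu> SU2" .
    then have "(2 + \<kappa>) * ip f f \<le> (2 + \<kappa>) * (e\<^sup>2 * measure \<mu> SU2)" using \<kappa> by (intro mult_left_mono) auto
    then show ?thesis unfolding i using gap d by (simp add: distrib_left)
  qed
  have "(2 + \<kappa>) * ip u u \<le> dirichlet u u"
  proof (rule tendsto_lowerbound)
    show "((\<lambda>e. dirichlet u u + (2 + \<kappa>) * (e\<^sup>2 * measure \<mu> SU2)) \<longlongrightarrow> dirichlet u u) (at_right 0)"
      by (auto intro!: tendsto_eq_intros)
    show "\<forall>\<^sub>F e in at_right 0. (2 + \<kappa>) * ip u u \<le> dirichlet u u + (2 + \<kappa>) * (e\<^sup>2 * measure \<mu> SU2)"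
      using eventually_at_right_less[of 0] by eventually_elim (rule approx)
  qed simp
  moreover have "dirichlet u u = (\<integral>x. (along 1 u x)\<^sup>2 + (along 2 u x)\<^sup>2 + \<kappa> * (along 3 u x)\<^sup>2 \<partial>\<mu>)"
    unfolding dirichlet_def ip_def power2_eq_square
    using ip_integrable[OF continuous_on_along[OF u] continuous_on_along[OF u]] by simp
  ultimately show ?thesis by (simp add: ip_def power2_eq_square)
qed

end

section \<open>Eigenvalue maximization and inflated maps\<close>

lemma differential_nth:
  assumes "Ck_SU2 1 \<phi>" "x \<in> SU2" "v \<in> tangent x"
  shows "differential \<phi> x v $ i = differential (\<lambda>x. \<phi> x $ i) x v"
proof -
  have "((\<lambda>x. \<phi> x $ i) has_derivative (\<lambda>h. differential \<phi> x h $ i)) (at x within SU2)"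
    by (rule bounded_linear.has_derivative[OF bounded_linear_vec_nth C1_has_derivative[OF assms(1,2)]])
  from differential_eq[OF this assms(3)] show ?thesis by simp
qed

lemma E_tangent: "x \<in> SU2 \<Longrightarrow> E a x \<in> tangent x"
  by (simp add: E_eq_frame frame_tangent)

lemma berger_E:
  assumes "x \<in> SU2"
  shows "berger t x (E a x) (E b x) = (if a = b then if a = 3 then t\<^sup>2 else 1 else 0)"
  using exhaust_3[of a] exhaust_3[of b] by (auto simp: berger_def E_eq_frame assms \<sigma>_frame)

section \<open>Components in l2 and the Euclidean inclusion\<close>

lemma bounded_linear_l2_nth: "bounded_linear (\<lambda>y. l2_nth y n)"
  by (rule bounded_linear_intro[where K = 1]) (auto simp: abs_l2_nth_le_norm)

lemma l2_inclusion_nth: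
  fixes y :: "real ^ 'n::{finite, semiring_1}"
  shows "l2_nth (l2_inclusion y) n = (if n < CARD('n) then y $ of_nat (n + 1) else 0)"
proof -
  have "summable (\<lambda>n. (if n < CARD('n) then y $ of_nat (n + 1) else 0)\<^sup>2)"
    by (rule summable_finite[of "{..<CARD('n)}"]) auto
  then show ?thesis unfolding l2_inclusion_def by (subst Abs_l2_inverse) auto
qed

text \<open>The bijection says that the sequence lists every coordinate exactly once;
  \<open>enum_4\<close> and \<open>enum_7\<close> provide it for the two targets.\<close>

lemma norm_l2_inclusion:
  fixes y :: "real ^ 'n::{finite, semiring_1}"
  assumes "bij_betw (\<lambda>n. of_nat (n + 1)) {..<CARD('n::{finite, semiring_1})} (UNIV :: 'n::{finite, semiring_1} set)"
  shows "norm (l2_inclusion y) = norm y"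
proof -
  have "(norm (l2_inclusion y))\<^sup>2 = (\<Sum>n<CARD('n). (l2_nth (l2_inclusion y) n)\<^sup>2)"
    unfolding norm_l2_squared by (rule suminf_finite) (auto simp: l2_inclusion_nth)
  also have "\<dots> = (\<Sum>n<CARD('n). (y $ of_nat (n + 1))\<^sup>2)"
    by (intro sum.cong) (auto simp: l2_inclusion_nth)
  also have "\<dots> = (\<Sum>i\<in>UNIV. (y $ i)\<^sup>2)"
    by (rule sum.reindex_bij_betw[OF assms])
  also have "\<dots> = (norm y)\<^sup>2"
    by (simp add: norm_vec_def L2_set_def sum_nonneg)
  finally show ?thesis by simp
qed

lemma bounded_linear_l2_inclusion:
  assumes "bij_betw (\<lambda>n. of_nat (n + 1)) {..<CARD('n::{finite, semiring_1})} (UNIV :: 'n::{finite, semiring_1} set)"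
  shows "bounded_linear (l2_inclusion :: real ^ 'n::{finite, semiring_1} \<Rightarrow> l2)"
  by (rule bounded_linear_intro[where K = 1])
     (auto intro!: l2_eqI simp: l2_inclusion_nth norm_l2_inclusion[OF assms])

section \<open>Test functions for the first eigenvalue and the weak Laplacian\<close>

context berger_space
begin

lemma measure_pos: "0 < measure \<mu> SU2"
  by (rule measure_volume_pos[OF t])

lemma integral_normalized:
  fixes f :: "cmat2 \<Rightarrow> 'b::{banach, second_countable_topology}"
  assumes f: "continuous_on SU2 f"
  shows "(\<integral>x. f x \<partial>normalized \<mu>) = (1 / measure \<mu> SU2) *\<^sub>R (\<integral>x. f x \<partial>\<mu>)"
proof -
  interpret finite_measure \<mu> by (rule finite_measure_volume[OF t])
  have "(\<integral>x. f x \<partial>normalized \<mu>) = (\<integral>x. f x \<partial>density \<mu> (\<lambda>x. ennreal (1 / measure \<mu> SU2)))"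
  proof -
    have "uniform_measure \<mu> (space \<mu>) = density \<mu> (\<lambda>x. ennreal (1 / measure \<mu> SU2))"
      unfolding uniform_measure_def
    proof (rule density_cong)
      show "AE x in \<mu>. indicator (space \<mu>) x / emeasure \<mu> (space \<mu>) = ennreal (1 / measure \<mu> SU2)"
        using measure_pos by (intro AE_I2) (simp add: emeasure_eq_measure divide_ennreal flip: ennreal_1)
      show "(\<lambda>x. indicator (space \<mu>) x / emeasure \<mu> (space \<mu>)) \<in> borel_measurable \<mu>"
        by (subst measurable_cong[of \<mu> _ "\<lambda>x. 1 / emeasure \<mu> (space \<mu>)"]) simp_all
    qed simp
    then show ?thesis by simp
  qed
  also have "\<dots> = (\<integral>x. (1 / measure \<mu> SU2) *\<^sub>R f x \<partial>\<mu>)"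
    by (rule integral_density) (auto intro: measurable_volume_element f)
  also have "\<dots> = (1 / measure \<mu> SU2) *\<^sub>R (\<integral>x. f x \<partial>\<mu>)" by simp
  finally show ?thesis .
qed

lemma integral_const_SU2:
  assumes "\<And>x. x \<in> SU2 \<Longrightarrow> f x = (c :: real)"
  shows "(\<integral>x. f x \<partial>\<mu>) = c * measure \<mu> SU2"
proof -
  have "(\<integral>x. f x \<partial>\<mu>) = (\<integral>x. c \<partial>\<mu>)" by (rule integral_cong_SU2) (rule assms)
  then show ?thesis by (simp add: mult.commute)
qed

lemma cometric_along:
  "cometric g x (differential u x) (differential v x) =
    (\<Sum>a\<in>UNIV. \<Sum>b\<in>UNIV. g x $ a $ b * along a u x * along b v x)"
  by (simp add: cometric_def along_def)

text \<open>Evaluation on the covector \<sigma>_3. This lets a pullback that is shorter than h_t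
  along E_3 be compared with h_t after contraction.\<close>

lemma psd_33:
  assumes "g \<in> psd_sections" "x \<in> SU2"
  shows "0 \<le> g x $ 3 $ 3"
proof -
  have "linear (\<sigma> 3 x)" using bounded_linear_\<sigma> by (rule bounded_linear.linear)
  then have "0 \<le> cometric g x (\<sigma> 3 x) (\<sigma> 3 x)" using assms by (simp add: psd_sections_def)
  also have "\<dots> = g x $ 3 $ 3"
    by (simp add: cometric_def E_eq_frame assms \<sigma>_frame sum_3)
  finally show ?thesis .
qed

lemma psd_cometric_nonneg:
  assumes "g \<in> psd_sections" "x \<in> SU2" "Ck_SU2 1 u"
  shows "0 \<le> cometric g x (differential u x) (differential u x)"
proof -
  have "linear (differential u x)"
    using C1_has_derivative[OF assms(3,2)] by (rule has_derivative_linear)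
  then show ?thesis using assms by (simp add: psd_sections_def)
qed

lemma psd_continuous:
  assumes "g \<in> psd_sections"
  shows "continuous_on SU2 (\<lambda>x. g x $ a $ b)"
proof -
  have "smooth_SU2 g" using assms by (simp add: psd_sections_def)
  then show ?thesis
    by (intro bounded_linear.continuous_on[OF bounded_linear_vec_nth] smooth_continuous_on)
qed

lemma cometric_continuous:
  assumes "g \<in> psd_sections" "Ck_SU2 1 u" "Ck_SU2 1 v"
  shows "continuous_on SU2 (\<lambda>x. cometric g x (differential u x) (differential v x))"
  unfolding cometric_along
  by (intro continuous_intros psd_continuous continuous_on_along assms)

text \<open>Semidefiniteness bounds the quotients below by 0, so the infimum is a genuine lower
  bound. Clearing the denominator keeps the estimate valid for functions vanishing on SU(2), which
  are not competitors.\<close>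

lemma lambda1_le:
  assumes g: "g \<in> psd_sections" and u: "Ck_SU2 1 u" and mean: "(\<integral>x. u x \<partial>\<mu>) = 0"
  shows "lambda1 \<mu> g * ip u u \<le> (\<integral>x. cometric g x (differential u x) (differential u x) \<partial>\<mu>)"
proof -
  let ?Q = "\<lambda>u. (\<integral>x. cometric g x (differential u x) (differential u x) \<partial>\<mu>)"
  have Q: "0 \<le> ?Q u" if "Ck_SU2 1 u" for u
    by (intro integral_nonneg_AE AE_I2) (simp add: psd_cometric_nonneg[OF g _ that])
  show ?thesis
  proof (cases "ip u u = 0")
    case True
    then show ?thesis using Q[OF u] by simp
  next
    case False
    then have pos: "0 < ip u u" using ip_nonneg[of u] by simp
    have "\<exists>x\<in>SU2. u x \<noteq> 0"
    proof (rule ccontr)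
      assume "\<not> ?thesis"
      then have "ip u u = ip (\<lambda>x. 0) u" by (intro ip_cong) auto
      then show False using False by (simp add: ip_def)
    qed
    moreover have "0 \<le> ?Q u / (\<integral>x. (u x)\<^sup>2 \<partial>\<mu>)" if "Ck_SU2 1 u" for u
      by (intro divide_nonneg_nonneg Q that) simp
    ultimately have "lambda1 \<mu> g \<le> ?Q u / (\<integral>x. (u x)\<^sup>2 \<partial>\<mu>)"
      unfolding lambda1_def using u mean
      by (intro cInf_lower bdd_belowI[of _ 0]) auto
    then show ?thesis using pos by (simp add: ip_def power2_eq_square pos_le_divide_eq)
  qed
qed

text \<open>The weak formulation leaves the choice operator no freedom on SU(2): the difference of
  two solutions is smooth and may serve as its own test function.\<close>

lemma laplacian_eq:
  assumes u: "smooth_SU2 u"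
    and weak: "\<And>v. smooth_SU2 v \<Longrightarrow>
      c * ip u v = (\<integral>x. cometric g x (differential u x) (differential v x) \<partial>\<mu>)"
    and x: "x \<in> SU2"
  shows "- laplacian \<mu> g u x = c * u x"
proof -
  let ?P = "\<lambda>w. smooth_SU2 w \<and> (\<forall>v. smooth_SU2 v \<longrightarrow>
        (\<integral>x. w x * v x \<partial>\<mu>) = - (\<integral>x. cometric g x (differential u x) (differential v x) \<partial>\<mu>))"
  have s: "smooth_SU2 (\<lambda>x. - c * u x)"
    by (rule smooth_SU2_bounded_linear[OF u bounded_linear_mult_right])
  have "(\<integral>x. (- c * u x) * v x \<partial>\<mu>) = - (\<integral>x. cometric g x (differential u x) (differential v x) \<partial>\<mu>)"
    if "smooth_SU2 v" for v
    unfolding weak[OF that, symmetric] ip_def by (simp add: mult.assoc)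
  with s have "?P (\<lambda>x. - c * u x)" by blast
  then have P: "?P (laplacian \<mu> g u)" unfolding laplacian_def by (rule someI[of ?P])
  have w: "smooth_SU2 (laplacian \<mu> g u)" using P by (rule conjunct1)
  have wv: "ip (laplacian \<mu> g u) v = - (c * ip u v)" if "smooth_SU2 v" for v
    using mp[OF spec[OF conjunct2[OF P]] that] unfolding weak[OF that, symmetric] ip_def .
  let ?d = "\<lambda>x. c * u x + laplacian \<mu> g u x"
  have d: "smooth_SU2 ?d" using smooth_SU2_diff[OF w s] by (simp add: add.commute)
  have "ip ?d ?d = c * ip u ?d + ip (laplacian \<mu> g u) ?d"
    by (rule ip_linear) (intro smooth_continuous_on u w d)+
  also have "\<dots> = 0" by (simp add: wv[OF d])
  finally have "ip ?d ?d = 0" .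
  from ip_definite[OF smooth_continuous_on[OF d] this x] have "?d x = 0" .
  then show ?thesis by linarith
qed

end

context berger_gap
begin

text \<open>Common form of \<open>berger_dual s\<close>, for \<kappa> = 1/s^2, and of
  \<open>berger_dual_inf\<close>, for \<kappa> = 0.\<close>

definition diag :: cotensor2 where
  "diag x = E_tensor 1 1 x + E_tensor 2 2 x + \<kappa> *\<^sub>R E_tensor 3 3 x"

lemma diag_nth: "diag x $ a $ b = (if a = b then if a = 3 then \<kappa> else 1 else 0)"
  using exhaust_3[of a] exhaust_3[of b] by (auto simp: diag_def E_tensor_def)

lemma cometric_diag: "cometric diag x \<alpha> \<beta> = \<alpha> (E 1 x) * \<beta> (E 1 x) + \<alpha> (E 2 x) * \<beta> (E 2 x) + \<kappa> * (\<alpha> (E 3 x) * \<beta> (E 3 x))"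
  by (simp add: cometric_def sum_3 diag_nth)

lemma contraction_diag: "contraction diag k x = k x (E 1 x) (E 1 x) + k x (E 2 x) (E 2 x) + \<kappa> * k x (E 3 x) (E 3 x)"
  by (simp add: contraction_def sum_3 diag_nth)

lemma diag_psd: "diag \<in> psd_sections"
proof -
  have "diag = (\<lambda>x. diag 0)"
    by (rule ext) (simp add: diag_def E_tensor_def)
  then have "smooth_SU2 diag"
    using smooth_SU2_global[OF Ck_on_const, of "diag 0"] by simp
  moreover have "transpose (diag x) = diag x" for x
    by (simp add: vec_eq_iff transpose_def diag_nth)
  ultimately show ?thesis
    using \<kappa> by (auto simp: psd_sections_def cometric_diag)
qed

lemma diag_nonzero: "\<exists>x\<in>SU2. diag x \<noteq> 0"
proof -
  have "diag x \<noteq> 0" for x using diag_nth[of x 1 1] by auto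
  then show ?thesis using hopf_in_SU2 by blast
qed

lemma integral_cometric_diag:
  assumes "Ck_SU2 1 u" "Ck_SU2 1 v"
  shows "(\<integral>x. cometric diag x (differential u x) (differential v x) \<partial>\<mu>) = dirichlet u v"
  unfolding cometric_diag along_def[symmetric] dirichlet_def ip_def
  using ip_integrable[OF continuous_on_along[OF assms(1)] continuous_on_along[OF assms(2)]] by simp

lemma spectral_gap_dirichlet:
  assumes "Ck_SU2 1 u" "(\<integral>x. u x \<partial>\<mu>) = 0"
  shows "(2 + \<kappa>) * ip u u \<le> dirichlet u u"
  using spectral_gap[OF assms] ip_integrable[OF continuous_on_along[OF assms(1)] continuous_on_along[OF assms(1)]]
  by (simp add: dirichlet_def ip_def power2_eq_square)

text \<open>Summing the gap over components bounds the left side by the integral of the contraction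
  of \<open>diag\<close> with the pullback, which is at most that with h_t, namely 2 + \<kappa> t^2.
  Infinitely many components are reached by partial sums and dominated convergence.\<close>

lemma short_map_bound:
  fixes \<psi> :: "cmat2 \<Rightarrow> l2"
  assumes \<psi>: "smooth_SU2 \<psi>" and short: "tensor_le (pullback \<psi>) (berger t)"
    and mean: "(\<integral>x. \<psi> x \<partial>normalized \<mu>) = 0"
  shows "(2 + \<kappa>) * (\<integral>x. (norm (\<psi> x))\<^sup>2 \<partial>normalized \<mu>) \<le> 2 + \<kappa> * t\<^sup>2"
proof -
  have C: "Ck_SU2 1 \<psi>" by (rule smooth_imp_Ck[OF \<psi>])
  have c: "continuous_on SU2 \<psi>" by (rule smooth_continuous_on[OF \<psi>])
  define f where "f n x = l2_nth (\<psi> x) n" for n x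
  have fC: "Ck_SU2 1 (f n)" for n
    unfolding f_def by (rule Ck_SU2_bounded_linear[OF C bounded_linear_l2_nth])
  have fc: "continuous_on SU2 (f n)" for n by (rule C1_continuous_on[OF fC])
  have af: "along a (f n) x = l2_nth (along a \<psi> x) n" if "x \<in> SU2" for a n x
    unfolding f_def by (rule along_bounded_linear[OF C bounded_linear_l2_nth that])
  have int0: "(\<integral>x. \<psi> x \<partial>\<mu>) = 0"
    using mean measure_pos unfolding integral_normalized[OF c] by simp
  have f0: "(\<integral>x. f n x \<partial>\<mu>) = 0" for n
    unfolding f_def using integral_bounded_linear[OF bounded_linear_l2_nth integrable_volume[OF t c], of n] int0
    by simp
  have na: "(norm (along a \<psi> x))\<^sup>2 \<le> (if a = 3 then t\<^sup>2 else 1)" if "x \<in> SU2" for a x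
  proof -
    have "(norm (along a \<psi> x))\<^sup>2 = pullback \<psi> x (E a x) (E a x)"
      by (simp add: pullback_def along_def power2_norm_eq_inner)
    also have "\<dots> \<le> berger t x (E a x) (E a x)"
      using short that E_tangent unfolding tensor_le_def by blast
    finally show ?thesis using berger_E[OF that, of t a a] by simp
  qed
  have partial: "(2 + \<kappa>) * (\<integral>x. (\<Sum>n<N. (f n x)\<^sup>2) \<partial>\<mu>) \<le> (2 + \<kappa> * t\<^sup>2) * measure \<mu> SU2" for N
  proof -
    have "(\<integral>x. (\<Sum>n<N. (f n x)\<^sup>2) \<partial>\<mu>) = (\<Sum>n<N. ip (f n) (f n))"
      unfolding ip_def power2_eq_square by (intro Bochner_Integration.integral_sum ip_integrable fc)
    then have "(2 + \<kappa>) * (\<integral>x. (\<Sum>n<N. (f n x)\<^sup>2) \<partial>\<mu>) = (\<Sum>n<N. (2 + \<kappa>) * ip (f n) (f n))"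
      by (simp add: sum_distrib_left)
    also have "\<dots> \<le> (\<Sum>n<N. dirichlet (f n) (f n))"
      by (intro sum_mono spectral_gap_dirichlet fC f0)
    also have "\<dots> = (\<Sum>n<N. \<integral>x. cometric diag x (differential (f n) x) (differential (f n) x) \<partial>\<mu>)"
      by (simp only: integral_cometric_diag[OF fC fC])
    also have "\<dots> = (\<integral>x. (\<Sum>n<N. cometric diag x (differential (f n) x) (differential (f n) x)) \<partial>\<mu>)"
      by (intro Bochner_Integration.integral_sum[symmetric] integrable_volume t cometric_continuous diag_psd fC)
    also have "\<dots> \<le> (\<integral>x. 2 + \<kappa> * t\<^sup>2 \<partial>\<mu>)"
    proof (rule integral_mono_SU2)
      show "continuous_on SU2 (\<lambda>x. \<Sum>n<N. cometric diag x (differential (f n) x) (differential (f n) x))"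
        by (intro continuous_on_sum cometric_continuous diag_psd fC)
      fix x assume x: "x \<in> SU2"
      have s: "(\<Sum>n<N. along a (f n) x * along a (f n) x) \<le> (if a = 3 then t\<^sup>2 else 1)" for a
      proof -
        have "(\<Sum>n<N. (l2_nth (along a \<psi> x) n)\<^sup>2) \<le> (if a = 3 then t\<^sup>2 else 1)"
          by (rule order_trans[OF sum_l2_nth_le_norm na[OF x]])
        then show ?thesis by (simp add: af[OF x] power2_eq_square)
      qed
      have "(\<Sum>n<N. cometric diag x (differential (f n) x) (differential (f n) x)) =
          (\<Sum>n<N. along 1 (f n) x * along 1 (f n) x) + (\<Sum>n<N. along 2 (f n) x * along 2 (f n) x) +
          \<kappa> * (\<Sum>n<N. along 3 (f n) x * along 3 (f n) x)"
        by (simp add: cometric_diag along_def sum.distrib sum_distrib_left)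
      also have "\<dots> \<le> 1 + 1 + \<kappa> * t\<^sup>2"
        using s[of 1] s[of 2] s[of 3] \<kappa> by (intro add_mono mult_left_mono) auto
      finally show "(\<Sum>n<N. cometric diag x (differential (f n) x) (differential (f n) x)) \<le> 2 + \<kappa> * t\<^sup>2" by simp
    qed simp
    finally show ?thesis by (simp add: mult.commute)
  qed
  have "(\<lambda>N. \<integral>x. (\<Sum>n<N. (f n x)\<^sup>2) \<partial>\<mu>) \<longlonglongrightarrow> (\<integral>x. (norm (\<psi> x))\<^sup>2 \<partial>\<mu>)"
  proof (rule integral_dominated_convergence[where w = "\<lambda>x. (norm (\<psi> x))\<^sup>2"])
    show "(\<lambda>x. (norm (\<psi> x))\<^sup>2) \<in> borel_measurable \<mu>" "integrable \<mu> (\<lambda>x. (norm (\<psi> x))\<^sup>2)"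
      by (intro measurable_volume_element integrable_volume t continuous_intros c)+
    show "(\<lambda>x. \<Sum>n<N. (f n x)\<^sup>2) \<in> borel_measurable \<mu>" for N
      by (intro measurable_volume_element continuous_intros fc)
    show "AE x in \<mu>. (\<lambda>N. \<Sum>n<N. (f n x)\<^sup>2) \<longlonglongrightarrow> (norm (\<psi> x))\<^sup>2"
      unfolding f_def norm_l2_squared by (intro AE_I2 summable_LIMSEQ l2_summable)
    show "AE x in \<mu>. norm (\<Sum>n<N. (f n x)\<^sup>2) \<le> (norm (\<psi> x))\<^sup>2" for N
      unfolding f_def using sum_l2_nth_le_norm by (intro AE_I2) (simp add: sum_nonneg)
  qed
  then have "(\<lambda>N. (2 + \<kappa>) * (\<integral>x. (\<Sum>n<N. (f n x)\<^sup>2) \<partial>\<mu>)) \<longlonglongrightarrow> (2 + \<kappa>) * (\<integral>x. (norm (\<psi> x))\<^sup>2 \<partial>\<mu>)"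
    by (intro tendsto_intros)
  then have "(2 + \<kappa>) * (\<integral>x. (norm (\<psi> x))\<^sup>2 \<partial>\<mu>) \<le> (2 + \<kappa> * t\<^sup>2) * measure \<mu> SU2"
    by (rule LIMSEQ_le_const2) (use partial in blast)
  moreover have "(\<integral>x. (norm (\<psi> x))\<^sup>2 \<partial>normalized \<mu>) = (1 / measure \<mu> SU2) * (\<integral>x. (norm (\<psi> x))\<^sup>2 \<partial>\<mu>)"
    using integral_normalized[of "\<lambda>x. (norm (\<psi> x))\<^sup>2"] c by (simp add: continuous_intros)
  moreover have "(2 + \<kappa>) * (\<integral>x. (norm (\<psi> x))\<^sup>2 \<partial>\<mu>) / measure \<mu> SU2 \<le> (2 + \<kappa> * t\<^sup>2) * measure \<mu> SU2 / measure \<mu> SU2"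
    using calculation(1) measure_pos by (intro divide_right_mono) auto
  ultimately show ?thesis using measure_pos by simp
qed

end

text \<open>\<open>R\<close> makes the eigenmap attain equality in \<open>short_map_bound\<close>; \<open>enum\<close> is the enumeration of the indices
  used by \<open>l2_inclusion\<close>.\<close>

locale eigenmap = berger_gap +
  fixes f :: "'n::{finite, semiring_1} \<Rightarrow> cmat2 \<Rightarrow> real" and k3 R :: real
  assumes f_Ck: "\<And>k i. Ck_on k (f i) UNIV"
    and f_eigen: "\<And>i v. Ck_SU2 1 v \<Longrightarrow> dirichlet (f i) v = (2 + \<kappa>) * ip (f i) v"
    and f_gram: "\<And>x a b. x \<in> SU2 \<Longrightarrow>
      (\<Sum>i\<in>UNIV. along a (f i) x * along b (f i) x) = (if a = b then if a = 3 then k3 else 1 else 0)"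
    and k3: "0 < k3" "k3 \<le> t\<^sup>2"
    and radius: "\<And>x. x \<in> SU2 \<Longrightarrow> (\<Sum>i\<in>UNIV. (f i x)\<^sup>2) = R"
    and R: "2 + \<kappa> * t\<^sup>2 = (2 + \<kappa>) * R"
    and f_inj: "inj_on (\<lambda>x. \<chi> i. f i x) SU2"
    and enum: "bij_betw (\<lambda>n. of_nat (n + 1)) {..<CARD('n)} (UNIV :: 'n set)"
begin

section \<open>What an eigenmap with matching constants implies\<close>

definition \<phi> :: "cmat2 \<Rightarrow> (real, 'n) vec" where "\<phi> x = (\<chi> i. f i x)"

lemma \<phi>_nth [simp]: "\<phi> x $ i = f i x"
  by (simp add: \<phi>_def)

lemma R_pos: "0 < R"
proof -
  have "0 < 2 + \<kappa> * t\<^sup>2" using \<kappa> by (simp add: add_pos_nonneg)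
  then show ?thesis using R \<kappa> by (metis add_nonneg_nonneg zero_less_mult_pos add_pos_nonneg zero_less_numeral)
qed

lemma smooth_\<phi>: "smooth_SU2 \<phi>"
proof (rule smooth_SU2_global)
  have "\<phi> = (\<lambda>x. \<Sum>i\<in>UNIV. f i x *\<^sub>R axis i 1)"
    by (auto simp: vec_eq_iff axis_def if_distrib[of "\<lambda>y. _ * y"] cong: if_cong)
  moreover have "Ck_on k (\<lambda>x. \<Sum>i\<in>UNIV. f i x *\<^sub>R (axis i 1 :: (real, 'n) vec)) UNIV" for k
    by (intro Ck_on_sum Ck_on_bounded_linear[OF f_Ck open_UNIV bounded_linear_scaleR_left] open_UNIV)
  ultimately show "Ck_on k \<phi> UNIV" for k by simp
qed

lemma f_smooth: "smooth_SU2 (f i)"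
  by (rule smooth_SU2_global[OF f_Ck])

lemma f_C1: "Ck_SU2 1 (f i)"
  by (rule smooth_imp_Ck[OF f_smooth])

text \<open>Both vectors are expanded in the frame, and \<open>f_gram\<close> evaluates the
  products; \<open>k3\<close> is the squared length of the image of E_3.\<close>

lemma pullback_\<phi>:
  assumes x: "x \<in> SU2" and v: "v \<in> tangent x" and w: "w \<in> tangent x"
  shows "pullback \<phi> x v w = \<sigma> 1 x v * \<sigma> 1 x w + \<sigma> 2 x v * \<sigma> 2 x w + k3 * (\<sigma> 3 x v * \<sigma> 3 x w)"
proof -
  have d: "differential \<phi> x v $ i = (\<Sum>a\<in>UNIV. \<sigma> a x v * along a (f i) x)" if "v \<in> tangent x" for v i
    using differential_nth[OF smooth_imp_Ck[OF smooth_\<phi>] x that] differential_expand[OF f_C1 x that] by simp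
  have "pullback \<phi> x v w = (\<Sum>i\<in>UNIV. \<Sum>a\<in>UNIV. \<Sum>b\<in>UNIV. \<sigma> a x v * \<sigma> b x w * (along a (f i) x * along b (f i) x))"
    unfolding pullback_def inner_vec_def d[OF v] d[OF w] by (simp add: sum_3 algebra_simps)
  also have "\<dots> = (\<Sum>a\<in>UNIV. \<Sum>b\<in>UNIV. \<Sum>i\<in>UNIV. \<sigma> a x v * \<sigma> b x w * (along a (f i) x * along b (f i) x))"
    by (subst sum.swap, intro sum.cong refl, subst sum.swap, rule refl)
  also have "\<dots> = (\<Sum>a\<in>UNIV. \<Sum>b\<in>UNIV. \<sigma> a x v * \<sigma> b x w * (if a = b then if a = 3 then k3 else 1 else 0))"
    by (simp only: sum_distrib_left[symmetric] f_gram[OF x])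
  also have "\<dots> = \<sigma> 1 x v * \<sigma> 1 x w + \<sigma> 2 x v * \<sigma> 2 x w + k3 * (\<sigma> 3 x v * \<sigma> 3 x w)"
    by (simp add: sum_3)
  finally show ?thesis .
qed

lemma tensor_le_\<phi>: "tensor_le (pullback \<phi>) (berger t)"
  unfolding tensor_le_def
proof (intro ballI)
  fix x v assume "x \<in> SU2" "v \<in> tangent x"
  then show "pullback \<phi> x v v \<le> berger t x v v"
    using k3 by (auto simp: pullback_\<phi> berger_def intro: mult_right_mono)
qed

lemma short_map_\<phi>: "short_map (berger t) \<phi>"
  by (simp add: short_map_def smooth_\<phi> tensor_le_\<phi>)

text \<open>An injective continuous map on a compact set is a homeomorphism onto its image; the
  differential is injective because the pullback is definite, \<open>k3\<close> being
  positive.\<close>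

lemma smooth_embedding_\<phi>: "smooth_embedding \<phi>"
  unfolding smooth_embedding_def
proof (intro conjI ballI)
  show "smooth_SU2 \<phi>" by (rule smooth_\<phi>)
  have "inj_on \<phi> SU2" using f_inj by (simp add: \<phi>_def[abs_def])
  then show "\<exists>\<psi>. homeomorphism SU2 (\<phi> ` SU2) \<phi> \<psi>"
    using homeomorphism_compact[OF compact_SU2 smooth_continuous_on[OF smooth_\<phi>] refl] by blast
next
  fix x assume x: "x \<in> SU2"
  show "inj_on (differential \<phi> x) (tangent x)"
  proof (rule inj_onI)
    fix v w assume v: "v \<in> tangent x" and w: "w \<in> tangent x" and eq: "differential \<phi> x v = differential \<phi> x w"
    have p: "pullback \<phi> x v v = pullback \<phi> x v w" "pullback \<phi> x w v = pullback \<phi> x w w"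
      using eq by (simp_all add: pullback_def)
    \<comment> \<open>The left side is the quadratic form at v - w. It is expanded into four terms
      because \<open>pullback_\<phi>\<close> speaks of tangent vectors, and v - w has not been shown
      to be one.\<close>
    have "(\<sigma> 1 x v - \<sigma> 1 x w)\<^sup>2 + (\<sigma> 2 x v - \<sigma> 2 x w)\<^sup>2 + k3 * (\<sigma> 3 x v - \<sigma> 3 x w)\<^sup>2 =
        pullback \<phi> x v v - pullback \<phi> x v w - (pullback \<phi> x w v - pullback \<phi> x w w)"
      unfolding pullback_\<phi>[OF x v v] pullback_\<phi>[OF x v w] pullback_\<phi>[OF x w v] pullback_\<phi>[OF x w w]
      by (simp add: power2_eq_square algebra_simps)
    also have "\<dots> = 0" using p by simp
    finally have s: "(\<sigma> 1 x v - \<sigma> 1 x w)\<^sup>2 + (\<sigma> 2 x v - \<sigma> 2 x w)\<^sup>2 + k3 * (\<sigma> 3 x v - \<sigma> 3 x w)\<^sup>2 = 0" .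
    have nn: "0 \<le> (\<sigma> 1 x v - \<sigma> 1 x w)\<^sup>2" "0 \<le> (\<sigma> 2 x v - \<sigma> 2 x w)\<^sup>2" "0 \<le> k3 * (\<sigma> 3 x v - \<sigma> 3 x w)\<^sup>2"
      using k3 by simp_all
    have "(\<sigma> 1 x v - \<sigma> 1 x w)\<^sup>2 = 0" "(\<sigma> 2 x v - \<sigma> 2 x w)\<^sup>2 = 0" "k3 * (\<sigma> 3 x v - \<sigma> 3 x w)\<^sup>2 = 0"
      using s nn by linarith+
    then have "\<sigma> 1 x v = \<sigma> 1 x w" "\<sigma> 2 x v = \<sigma> 2 x w" "\<sigma> 3 x v = \<sigma> 3 x w" using k3 by simp_all
    then show "v = w" using tangent_expand[OF x v] tangent_expand[OF x w] by (simp add: sum_3)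
  qed
qed

lemma isometric_embedding_\<phi>:
  assumes "k3 = t\<^sup>2"
  shows "isometric_embedding (berger t) \<phi>"
  unfolding isometric_embedding_def using smooth_embedding_\<phi> by (simp add: pullback_\<phi> berger_def assms)

text \<open>An eigenfunction with eigenvalue 2 + \<kappa>, which is not 0, is orthogonal to the
  constants, on which the Dirichlet form vanishes.\<close>

lemma f_mean: "(\<integral>x. f i x \<partial>\<mu>) = 0"
proof -
  have "(2 + \<kappa>) * ip (f i) one = dirichlet one (f i)"
    using f_eigen[OF Ck_SU2_one, of i] by (simp add: dirichlet_sym)
  then have "ip (f i) one = 0" using \<kappa> by (simp add: dirichlet_one)
  then show ?thesis by (simp add: ip_def one_def)
qed

lemma sum_ip: "(\<Sum>i\<in>UNIV. ip (f i) (f i)) = R * measure \<mu> SU2"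
proof -
  have "(\<Sum>i\<in>UNIV. ip (f i) (f i)) = (\<integral>x. (\<Sum>i\<in>UNIV. f i x * f i x) \<partial>\<mu>)"
    unfolding ip_def by (intro Bochner_Integration.integral_sum[symmetric] ip_integrable C1_continuous_on f_C1)
  also have "\<dots> = R * measure \<mu> SU2"
    by (rule integral_const_SU2) (simp add: radius flip: power2_eq_square)
  finally show ?thesis .
qed

text \<open>Each component is a test function of mean 0. The constant radius determines only the sum
  of the squared L^2 norms, hence the estimates are added.\<close>

lemma lambda1_sum_le:
  assumes g: "g \<in> psd_sections"
  shows "lambda1 \<mu> g * (R * measure \<mu> SU2) \<le>
    (\<integral>x. (\<Sum>i\<in>UNIV. cometric g x (differential (f i) x) (differential (f i) x)) \<partial>\<mu>)"
proof -
  have "lambda1 \<mu> g * (R * measure \<mu> SU2) = (\<Sum>i\<in>UNIV. lambda1 \<mu> g * ip (f i) (f i))"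
    by (simp add: sum_ip sum_distrib_left[symmetric])
  also have "\<dots> \<le> (\<Sum>i\<in>UNIV. \<integral>x. cometric g x (differential (f i) x) (differential (f i) x) \<partial>\<mu>)"
    by (intro sum_mono lambda1_le g f_C1 f_mean)
  also have "\<dots> = (\<integral>x. (\<Sum>i\<in>UNIV. cometric g x (differential (f i) x) (differential (f i) x)) \<partial>\<mu>)"
    by (intro Bochner_Integration.integral_sum[symmetric] integrable_volume t cometric_continuous g f_C1)
  finally show ?thesis .
qed

lemma lambda1_diag: "lambda1 \<mu> diag = 2 + \<kappa>"
proof (rule antisym)
  have "lambda1 \<mu> diag * (R * measure \<mu> SU2) = (\<Sum>i\<in>UNIV. lambda1 \<mu> diag * ip (f i) (f i))"
    by (simp add: sum_ip sum_distrib_left[symmetric])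
  also have "\<dots> \<le> (\<Sum>i\<in>UNIV. dirichlet (f i) (f i))"
    using lambda1_le[OF diag_psd f_C1 f_mean] by (intro sum_mono) (simp add: integral_cometric_diag[OF f_C1 f_C1])
  also have "\<dots> = (2 + \<kappa>) * (R * measure \<mu> SU2)"
    by (simp add: f_eigen[OF f_C1] sum_ip sum_distrib_left[symmetric])
  finally show "lambda1 \<mu> diag \<le> 2 + \<kappa>"
    by (rule mult_right_le_imp_le) (simp add: R_pos measure_pos)
next
  show "2 + \<kappa> \<le> lambda1 \<mu> diag"
    unfolding lambda1_def
  proof (rule cInf_greatest)
    \<comment> \<open>A lower bound for an infimum needs a competitor; as R > 0, some component is
      not identically 0.\<close>
    have "\<exists>i. \<exists>x\<in>SU2. f i x \<noteq> 0"
    proof (rule ccontr)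
      assume "\<not> ?thesis"
      then have "(\<Sum>i\<in>UNIV. (f i (hopf_coords 0))\<^sup>2) = 0" by simp
      then show False using radius[of "hopf_coords 0"] R_pos by simp
    qed
    then obtain i where "\<exists>x\<in>SU2. f i x \<noteq> 0" by blast
    then show "{(\<integral>x. cometric diag x (differential u x) (differential u x) \<partial>\<mu>) / (\<integral>x. (u x)\<^sup>2 \<partial>\<mu>) | u.
        Ck_SU2 1 u \<and> (\<exists>x\<in>SU2. u x \<noteq> 0) \<and> (\<integral>x. u x \<partial>\<mu>) = 0} \<noteq> {}"
      using f_C1[of i] f_mean[of i] by blast
  next
    fix r assume "r \<in> {(\<integral>x. cometric diag x (differential u x) (differential u x) \<partial>\<mu>) / (\<integral>x. (u x)\<^sup>2 \<partial>\<mu>) | u.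
        Ck_SU2 1 u \<and> (\<exists>x\<in>SU2. u x \<noteq> 0) \<and> (\<integral>x. u x \<partial>\<mu>) = 0}"
    then obtain u where r: "r = (\<integral>x. cometric diag x (differential u x) (differential u x) \<partial>\<mu>) / (\<integral>x. (u x)\<^sup>2 \<partial>\<mu>)"
      and u: "Ck_SU2 1 u" "\<exists>x\<in>SU2. u x \<noteq> 0" "(\<integral>x. u x \<partial>\<mu>) = 0" by blast
    have "ip u u \<noteq> 0" using ip_definite[OF C1_continuous_on[OF u(1)]] u(2) by blast
    then have "0 < ip u u" using ip_nonneg[of u] by simp
    then show "2 + \<kappa> \<le> r"
      unfolding r integral_cometric_diag[OF u(1,1)] using spectral_gap_dirichlet[OF u(1,3)]
      by (simp add: pos_le_divide_eq ip_def power2_eq_square)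
  qed
qed

lemma by_first_eigenfunctions_\<phi>: "by_first_eigenfunctions \<mu> diag \<phi>"
  unfolding by_first_eigenfunctions_def first_eigenfunction_def \<phi>_nth lambda1_diag
proof (intro allI conjI ballI)
  fix i x assume x: "x \<in> SU2"
  show "- laplacian \<mu> diag (\<lambda>x. f i x) x = (2 + \<kappa>) * f i x"
    by (rule laplacian_eq[OF f_smooth _ x])
       (simp add: integral_cometric_diag[OF f_C1 smooth_imp_Ck] f_eigen[OF smooth_imp_Ck])
qed (rule f_smooth)

text \<open>The image lies on a sphere of squared radius R, and the condition \<open>R\<close> makes
  this value equal to the upper bound in \<open>short_map_bound\<close>.\<close>

lemma inflated_map_\<phi>: "inflated_map \<mu> (berger t) (l2_inclusion \<circ> \<phi>)"
proof -
  have L: "bounded_linear (l2_inclusion :: (real, 'n) vec \<Rightarrow> l2)" by (rule bounded_linear_l2_inclusion[OF enum])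
  note \<phi>C = smooth_imp_Ck[OF smooth_\<phi>, of 1]
  have s: "smooth_SU2 (l2_inclusion \<circ> \<phi>)"
    using smooth_SU2_bounded_linear[OF smooth_\<phi> L] by (simp add: o_def)
  have "pullback (l2_inclusion \<circ> \<phi>) x v v = pullback \<phi> x v v" if x: "x \<in> SU2" and v: "v \<in> tangent x" for x v
  proof -
    have "differential (l2_inclusion \<circ> \<phi>) x v = l2_inclusion (differential \<phi> x v)"
      unfolding o_def by (rule differential_eq[OF bounded_linear.has_derivative[OF L C1_has_derivative[OF \<phi>C x]] v])
    then show ?thesis
      by (simp add: pullback_def norm_l2_inclusion[OF enum] flip: power2_norm_eq_inner)
  qed
  then have le: "tensor_le (pullback (l2_inclusion \<circ> \<phi>)) (berger t)"
    using tensor_le_\<phi> by (simp add: tensor_le_def)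
  have c: "continuous_on SU2 (l2_inclusion \<circ> \<phi>)" by (rule smooth_continuous_on[OF s])
  have "(\<integral>x. (l2_inclusion \<circ> \<phi>) x \<partial>\<mu>) = 0"
  proof (rule l2_eqI)
    fix n
    have "l2_nth (\<integral>x. (l2_inclusion \<circ> \<phi>) x \<partial>\<mu>) n = (\<integral>x. l2_nth ((l2_inclusion \<circ> \<phi>) x) n \<partial>\<mu>)"
      by (rule integral_bounded_linear[OF bounded_linear_l2_nth integrable_volume[OF t c], symmetric])
    also have "\<dots> = 0" by (cases "n < CARD('n)") (simp_all add: l2_inclusion_nth f_mean)
    finally show "l2_nth (\<integral>x. (l2_inclusion \<circ> \<phi>) x \<partial>\<mu>) n = l2_nth 0 n" by simp
  qed
  then have m: "(\<integral>x. (l2_inclusion \<circ> \<phi>) x \<partial>normalized \<mu>) = 0"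
    unfolding integral_normalized[OF c] by (simp only: scaleR_zero_right)
  have "(norm ((l2_inclusion \<circ> \<phi>) x))\<^sup>2 = R" if "x \<in> SU2" for x
    using radius[OF that] R_pos by (simp add: norm_l2_inclusion[OF enum] norm_vec_def L2_set_def sum_nonneg)
  then have "(\<integral>x. (norm ((l2_inclusion \<circ> \<phi>) x))\<^sup>2 \<partial>\<mu>) = R * measure \<mu> SU2"
    by (rule integral_const_SU2)
  then have val: "(\<integral>x. (norm ((l2_inclusion \<circ> \<phi>) x))\<^sup>2 \<partial>normalized \<mu>) = R"
    using measure_pos by (subst integral_normalized) (auto intro!: continuous_intros c[unfolded o_def])
  have max: "(\<integral>x. (norm (\<psi> x))\<^sup>2 \<partial>normalized \<mu>) \<le> R"
    if "smooth_SU2 \<psi>" "tensor_le (pullback \<psi>) (berger t)" "(\<integral>x. \<psi> x \<partial>normalized \<mu>) = 0" for \<psi> :: "cmat2 \<Rightarrow> l2"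
  proof -
    have "(2 + \<kappa>) * (\<integral>x. (norm (\<psi> x))\<^sup>2 \<partial>normalized \<mu>) \<le> (2 + \<kappa>) * R"
      using short_map_bound[OF that] R by simp
    then show ?thesis by (rule mult_left_le_imp_le) (use \<kappa> in simp)
  qed
  show ?thesis
    unfolding inflated_map_def is_arg_max_def val
  proof (intro conjI notI s le m)
    assume "\<exists>\<psi> :: cmat2 \<Rightarrow> l2. (smooth_SU2 \<psi> \<and> tensor_le (pullback \<psi>) (berger t) \<and> (\<integral>x. \<psi> x \<partial>normalized \<mu>) = 0) \<and>
      R < (\<integral>x. (norm (\<psi> x))\<^sup>2 \<partial>normalized \<mu>)"
    then obtain \<psi> :: "cmat2 \<Rightarrow> l2" where \<psi>: "smooth_SU2 \<psi>" "tensor_le (pullback \<psi>) (berger t)"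
      "(\<integral>x. \<psi> x \<partial>normalized \<mu>) = 0" and "R < (\<integral>x. (norm (\<psi> x))\<^sup>2 \<partial>normalized \<mu>)"
      by blast
    with max[OF \<psi>] show False by linarith
  qed
qed

text \<open>Summed over the components, the energy density of a cometric g is its contraction with
  the pullback, hence at most that with h_t; \<open>lambda1_sum_le\<close> then bounds the ratio by
  1/R. For \<open>diag\<close> the eigenvalue is 2 + \<kappa> and the contraction (2 + \<kappa>) R,
  so equality holds.\<close>

lemma solves_diag: "solves_eigenvalue_maximization \<mu> (berger t) diag"
proof -
  have con: "contraction g (berger t) x = g x $ 1 $ 1 + g x $ 2 $ 2 + t\<^sup>2 * g x $ 3 $ 3" if "x \<in> SU2" for g x
    by (simp add: contraction_def berger_E[OF that] sum_3)
  have bound: "eigenvalue_ratio \<mu> (berger t) g \<le> 1 / R" if g: "g \<in> psd_sections" for g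
  proof -
    have cc: "continuous_on SU2 (contraction g (berger t))"
    proof -
      have "continuous_on SU2 (\<lambda>x. g x $ 1 $ 1 + g x $ 2 $ 2 + t\<^sup>2 * g x $ 3 $ 3)"
        by (intro continuous_intros psd_continuous g)
      then show ?thesis by (rule continuous_on_eq) (simp add: con)
    qed
    define I where "I = (\<integral>x. contraction g (berger t) x \<partial>\<mu>)"
    have "lambda1 \<mu> g * (R * measure \<mu> SU2) \<le>
        (\<integral>x. (\<Sum>i\<in>UNIV. cometric g x (differential (f i) x) (differential (f i) x)) \<partial>\<mu>)"
      by (rule lambda1_sum_le[OF g])
    also have sum_le: "\<dots> \<le> I"
      unfolding I_def
    proof (rule integral_mono_SU2)
      show "continuous_on SU2 (\<lambda>x. \<Sum>i\<in>UNIV. cometric g x (differential (f i) x) (differential (f i) x))"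
        by (intro continuous_on_sum cometric_continuous g f_C1)
      fix x assume x: "x \<in> SU2"
      have "(\<Sum>i\<in>UNIV. cometric g x (differential (f i) x) (differential (f i) x)) =
          (\<Sum>i\<in>UNIV. \<Sum>a\<in>UNIV. \<Sum>b\<in>UNIV. g x $ a $ b * (along a (f i) x * along b (f i) x))"
        by (simp add: cometric_along mult.assoc)
      also have "\<dots> = (\<Sum>a\<in>UNIV. \<Sum>b\<in>UNIV. \<Sum>i\<in>UNIV. g x $ a $ b * (along a (f i) x * along b (f i) x))"
        by (subst sum.swap, intro sum.cong refl, subst sum.swap, rule refl)
      also have "\<dots> = (\<Sum>a\<in>UNIV. \<Sum>b\<in>UNIV. g x $ a $ b * (if a = b then if a = 3 then k3 else 1 else 0))"
        by (simp only: sum_distrib_left[symmetric] f_gram[OF x])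
      also have "\<dots> = g x $ 1 $ 1 + g x $ 2 $ 2 + k3 * g x $ 3 $ 3"
        by (simp add: sum_3)
      also have "\<dots> \<le> contraction g (berger t) x"
        unfolding con[OF x] using k3 psd_33[OF g x] by (intro add_mono mult_right_mono) auto
      finally show "(\<Sum>i\<in>UNIV. cometric g x (differential (f i) x) (differential (f i) x)) \<le> contraction g (berger t) x" .
    qed (rule cc)
    finally have le: "lambda1 \<mu> g * (R * measure \<mu> SU2) \<le> I" .
    have "0 \<le> I"
    proof -
      have "0 \<le> (\<integral>x. (\<Sum>i\<in>UNIV. cometric g x (differential (f i) x) (differential (f i) x)) \<partial>\<mu>)"
        by (intro integral_nonneg_AE AE_I2 sum_nonneg) (simp add: psd_cometric_nonneg[OF g _ f_C1])
      then show ?thesis using sum_le by simp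
    qed
    have ratio: "eigenvalue_ratio \<mu> (berger t) g = lambda1 \<mu> g / (I / measure \<mu> SU2)"
      unfolding eigenvalue_ratio_def integral_normalized[OF cc] I_def by simp
    show ?thesis
    \<comment> \<open>\<open>bound\<close> admits every g in \<open>psd_sections\<close>, also g =
      0, where the quotient is 0 by the convention for division.\<close>
    proof (cases "I = 0")
      case True
      then show ?thesis using R_pos by (simp add: ratio)
    next
      case False
      then have "0 < I" using \<open>0 \<le> I\<close> by simp
      then show ?thesis using le measure_pos R_pos by (simp add: ratio field_simps)
    qed
  qed
  have "(\<integral>x. contraction diag (berger t) x \<partial>\<mu>) = (2 + \<kappa> * t\<^sup>2) * measure \<mu> SU2"
    by (rule integral_const_SU2) (simp add: con diag_nth mult.commute)
  moreover have cd: "continuous_on SU2 (contraction diag (berger t))"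
    by (rule continuous_on_eq[OF continuous_on_const[of _ "2 + \<kappa> * t\<^sup>2"]]) (simp add: con diag_nth mult.commute)
  ultimately have "(\<integral>x. contraction diag (berger t) x \<partial>normalized \<mu>) = (2 + \<kappa>) * R"
    using measure_pos unfolding integral_normalized[OF cd] by (simp flip: R)
  then have "eigenvalue_ratio \<mu> (berger t) diag = 1 / R"
    unfolding eigenvalue_ratio_def lambda1_diag using \<kappa> by simp
  then show ?thesis
    unfolding solves_eigenvalue_maximization_def is_arg_max_def
    using diag_psd diag_nonzero bound by (auto simp: not_less)
qed

end

section \<open>The eigenmaps into \<open>\<real>\<^sup>4\<close> and \<open>\<real>\<^sup>7\<close>\<close>

lemma exhaust_7:
  fixes x :: 7
  shows "x = 1 \<or> x = 2 \<or> x = 3 \<or> x = 4 \<or> x = 5 \<or> x = 6 \<or> x = 7"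
proof (induct x)
  case (of_int z)
  then have "z = 0 \<or> z = 1 \<or> z = 2 \<or> z = 3 \<or> z = 4 \<or> z = 5 \<or> z = 6" by fastforce
  then show ?case by auto
qed

lemma UNIV_7: "UNIV = {1, 2, 3, 4, 5, 6, 7 :: 7}"
  using exhaust_7 by auto

lemma sum_7: "sum f (UNIV :: 7 set) = f 1 + f 2 + f 3 + f 4 + f 5 + f 6 + f 7"
  unfolding UNIV_7 by (simp add: ac_simps)

lemma enum_4: "bij_betw (\<lambda>n. of_nat (n + 1)) {..<CARD(4)} (UNIV :: 4 set)"
proof -
  have "(\<lambda>n. of_nat (n + 1)) ` {..<CARD(4)} = (UNIV :: 4 set)"
    unfolding UNIV_4 by (simp add: lessThan_nat_numeral lessThan_Suc insert_commute)
  then show ?thesis by (simp add: bij_betw_def eq_card_imp_inj_on)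
qed

lemma enum_7: "bij_betw (\<lambda>n. of_nat (n + 1)) {..<CARD(7)} (UNIV :: 7 set)"
proof -
  have "(\<lambda>n. of_nat (n + 1)) ` {..<CARD(7)} = (UNIV :: 7 set)"
    unfolding UNIV_7 by (simp add: lessThan_nat_numeral lessThan_Suc insert_commute)
  then show ?thesis by (simp add: bij_betw_def eq_card_imp_inj_on)
qed

definition taut_comp :: "4 \<Rightarrow> cmat2 \<Rightarrow> real" where
  "taut_comp i = (if i = 1 then zbasis (True, 1, 0, 0, 0) else if i = 2 then zbasis (False, 1, 0, 0, 0)
    else if i = 3 then zbasis (True, 0, 1, 0, 0) else zbasis (False, 0, 1, 0, 0))"

text \<open>The Hopf map (z, w) to (2 z cnj w, |z|^2 - |w|^2) onto the unit sphere of R^3.\<close>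

definition hopf_comp :: "3 \<Rightarrow> cmat2 \<Rightarrow> real" where
  "hopf_comp i = (if i = 1 then (\<lambda>x. 2 * zbasis (True, 1, 0, 0, 1) x) else if i = 2 then (\<lambda>x. 2 * zbasis (False, 1, 0, 0, 1) x)
    else (\<lambda>x. - 1 * zbasis (True, 0, 1, 0, 1) x + zbasis (True, 1, 0, 1, 0) x))"

lemma hopf_comp_simps:
  "hopf_comp 1 = (\<lambda>x. 2 * zbasis (True, 1, 0, 0, 1) x)" "hopf_comp 2 = (\<lambda>x. 2 * zbasis (False, 1, 0, 0, 1) x)"
  "hopf_comp 3 = (\<lambda>x. - 1 * zbasis (True, 0, 1, 0, 1) x + zbasis (True, 1, 0, 1, 0) x)"
  by (simp_all add: hopf_comp_def)

lemma Ck_on_zbasis: "Ck_on k (zbasis i) UNIV"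
proof -
  obtain r a b c d where i: "i = (r, a, b, c, d)" by (cases i rule: zdegree.cases)
  show ?thesis
    unfolding i by (cases r) (simp_all only: zbasis_eq Ck_on_bounded_linear[OF Ck_on_zmono] open_UNIV bounded_linear_Re bounded_linear_Im)
qed

lemma Ck_on_scale: "Ck_on k f UNIV \<Longrightarrow> Ck_on k (\<lambda>x. c * f x :: real) UNIV"
  by (rule Ck_on_bounded_linear[OF _ open_UNIV bounded_linear_mult_right])

lemma Ck_on_taut: "Ck_on k (taut_comp i) UNIV"
  by (simp add: taut_comp_def Ck_on_zbasis)

lemma Ck_on_hopf: "Ck_on k (hopf_comp i) UNIV"
  using exhaust_3[of i]
  by (elim disjE; simp only: hopf_comp_simps) (intro Ck_on_add Ck_on_scale Ck_on_zbasis open_UNIV)+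

lemma C1_taut: "Ck_SU2 1 (taut_comp i)"
  by (rule smooth_imp_Ck[OF smooth_SU2_global[OF Ck_on_taut]])

lemma C1_hopf: "Ck_SU2 1 (hopf_comp i)"
  by (rule smooth_imp_Ck[OF smooth_SU2_global[OF Ck_on_hopf]])

lemma along_scale:
  assumes "Ck_SU2 1 u" "x \<in> SU2"
  shows "along a (\<lambda>x. c * u x :: real) x = c * along a u x"
  by (rule along_bounded_linear[OF assms(1) bounded_linear_mult_right assms(2)])

lemma zmono_simps:
  "zmono 1 0 0 0 x = x $ 1 $ 1" "zmono 0 1 0 0 x = x $ 2 $ 1"
  "zmono 1 0 0 1 x = x $ 1 $ 1 * cnj (x $ 2 $ 1)" "zmono 1 0 1 0 x = x $ 1 $ 1 * cnj (x $ 1 $ 1)"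
  "zmono 0 1 0 1 x = x $ 2 $ 1 * cnj (x $ 2 $ 1)" "zmono 0 0 0 0 x = 1"
  "zmono 0 0 0 1 x = cnj (x $ 2 $ 1)" "zmono 0 0 1 0 x = cnj (x $ 1 $ 1)"
  by (simp_all add: zmono_def)

lemma along_taut:
  assumes x: "x \<in> SU2"
  shows "along 1 (taut_comp 1) x = - Im (x $ 2 $ 1)" "along 1 (taut_comp 2) x = - Re (x $ 2 $ 1)"
    "along 1 (taut_comp 3) x = Im (x $ 1 $ 1)" "along 1 (taut_comp 4) x = Re (x $ 1 $ 1)"
    "along 2 (taut_comp 1) x = Re (x $ 2 $ 1)" "along 2 (taut_comp 2) x = - Im (x $ 2 $ 1)"
    "along 2 (taut_comp 3) x = - Re (x $ 1 $ 1)" "along 2 (taut_comp 4) x = Im (x $ 1 $ 1)"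
    "along 3 (taut_comp 1) x = - Im (x $ 1 $ 1)" "along 3 (taut_comp 2) x = Re (x $ 1 $ 1)"
    "along 3 (taut_comp 3) x = - Im (x $ 2 $ 1)" "along 3 (taut_comp 4) x = Re (x $ 2 $ 1)"
  by (simp_all add: taut_comp_def along_zbasis[OF x] along_zmono[OF x] frame_simps
      zmono_simps[unfolded One_nat_def] del: zbasis.simps)

lemma along_hopf:
  fixes x :: cmat2
  assumes x: "x \<in> SU2"
  defines "p \<equiv> Re (x $ 1 $ 1)" and "q \<equiv> Im (x $ 1 $ 1)" and "r \<equiv> Re (x $ 2 $ 1)" and "s \<equiv> Im (x $ 2 $ 1)"
  shows "along 1 (hopf_comp 1) x = 4 * (p * q - r * s)" "along 1 (hopf_comp 2) x = - 2 * (p * p - q * q + r * r - s * s)"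
    "along 1 (hopf_comp 3) x = - 4 * (p * s + q * r)"
    "along 2 (hopf_comp 1) x = 2 * (r * r - s * s - p * p + q * q)" "along 2 (hopf_comp 2) x = - 4 * (p * q + r * s)"
    "along 2 (hopf_comp 3) x = 4 * (p * r - q * s)"
    "along 3 (hopf_comp i) x = 0"
proof -
  have b: "along a (\<lambda>x. - 1 * zbasis (True, 0, 1, 0, 1) x + zbasis (True, 1, 0, 1, 0) x) x =
      - 1 * along a (zbasis (True, 0, 1, 0, 1)) x + along a (zbasis (True, 1, 0, 1, 0)) x" for a
    by (rule along_linear[OF Ck_SU2_zbasis Ck_SU2_zbasis x])
  note simps = along_zbasis[OF x] along_zmono[OF x] frame_simps
      zmono_simps[unfolded One_nat_def] p_def q_def r_def s_def
  show "along 1 (hopf_comp 1) x = 4 * (p * q - r * s)" "along 1 (hopf_comp 2) x = - 2 * (p * p - q * q + r * r - s * s)"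
    "along 1 (hopf_comp 3) x = - 4 * (p * s + q * r)"
    "along 2 (hopf_comp 1) x = 2 * (r * r - s * s - p * p + q * q)" "along 2 (hopf_comp 2) x = - 4 * (p * q + r * s)"
    "along 2 (hopf_comp 3) x = 4 * (p * r - q * s)"
    unfolding hopf_comp_simps along_scale[OF Ck_SU2_zbasis x] b
    by (simp_all add: simps algebra_simps del: zbasis.simps)
  show "along 3 (hopf_comp i) x = 0"
    using exhaust_3[of i]
    by (elim disjE; simp only: hopf_comp_simps along_scale[OF Ck_SU2_zbasis x] b; simp add: simps del: zbasis.simps)
qed

lemma gram_taut:
  assumes x: "x \<in> SU2"
  shows "(\<Sum>i\<in>UNIV. along a (taut_comp i) x * along b (taut_comp i) x) = (if a = b then 1 else 0)"
  using exhaust_3[of a] exhaust_3[of b] SU2_Re_Im[OF x]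
  by (elim disjE) (simp_all add: sum_4 along_taut[OF x])

lemma gram_hopf:
  assumes x: "x \<in> SU2"
  shows "(\<Sum>i\<in>UNIV. along a (hopf_comp i) x * along b (hopf_comp i) x) = (if a = b \<and> a \<noteq> 3 then 4 else 0)"
proof -
  define p q r s where "p = Re (x $ 1 $ 1)" and "q = Im (x $ 1 $ 1)" and "r = Re (x $ 2 $ 1)" and "s = Im (x $ 2 $ 1)"
  note al = along_hopf[OF x, folded p_def q_def r_def s_def]
  have n: "p * p + q * q + r * r + s * s = 1"
    using SU2_Re_Im[OF x] by (simp add: p_def q_def r_def s_def)
  \<comment> \<open>With the square of |z|^2 + |w|^2 written out, these are polynomial identities;
    the sphere relation is used only afterwards.\<close>
  have d: "(\<Sum>i\<in>UNIV. along 1 (hopf_comp i) x * along 1 (hopf_comp i) x) = 4 * (p * p + q * q + r * r + s * s)\<^sup>2"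
    "(\<Sum>i\<in>UNIV. along 2 (hopf_comp i) x * along 2 (hopf_comp i) x) = 4 * (p * p + q * q + r * r + s * s)\<^sup>2"
    "(\<Sum>i\<in>UNIV. along 1 (hopf_comp i) x * along 2 (hopf_comp i) x) = 0"
    "(\<Sum>i\<in>UNIV. along 2 (hopf_comp i) x * along 1 (hopf_comp i) x) = 0"
    unfolding sum_3 al by (simp_all add: power2_eq_square algebra_simps)
  show ?thesis
    using exhaust_3[of a] exhaust_3[of b] d n by (elim disjE) (simp_all add: al(7))
qed

lemma sum_taut:
  assumes x: "x \<in> SU2"
  shows "(\<Sum>i\<in>UNIV. (taut_comp i x)\<^sup>2) = 1"
  using SU2_Re_Im[OF x]
  by (simp add: sum_4 taut_comp_def zmono_simps[unfolded One_nat_def] power2_eq_square)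

lemma sum_hopf:
  assumes x: "x \<in> SU2"
  shows "(\<Sum>i\<in>UNIV. (hopf_comp i x)\<^sup>2) = 1"
proof -
  define p q r s where "p = Re (x $ 1 $ 1)" and "q = Im (x $ 1 $ 1)" and "r = Re (x $ 2 $ 1)" and "s = Im (x $ 2 $ 1)"
  have "(\<Sum>i\<in>UNIV. (hopf_comp i x)\<^sup>2) = (p * p + q * q + r * r + s * s)\<^sup>2"
    unfolding sum_3 hopf_comp_def p_def q_def r_def s_def
    by (simp add: zmono_simps[unfolded One_nat_def] power2_eq_square algebra_simps)
  then show ?thesis using SU2_Re_Im[OF x] by (simp add: p_def q_def r_def s_def)
qed

lemma taut_inj:
  assumes "x \<in> SU2" "y \<in> SU2" "\<And>i. taut_comp i x = taut_comp i y"
  shows "x = y"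
proof -
  have "x $ 1 $ 1 = y $ 1 $ 1" "x $ 2 $ 1 = y $ 2 $ 1"
    using assms(3)[of 1] assms(3)[of 2] assms(3)[of 3] assms(3)[of 4]
    by (simp_all add: taut_comp_def zmono_simps[unfolded One_nat_def] complex_eq_iff)
  then show ?thesis using SU2_entries_eq[OF assms(1)] SU2_entries_eq[OF assms(2)] by metis
qed

context berger_gap
begin

lemma ip_scale: "ip (\<lambda>x. c * u x) v = c * ip u v"
  by (simp add: ip_def mult.assoc)

lemma dirichlet_scale:
  assumes "Ck_SU2 1 u"
  shows "dirichlet (\<lambda>x. c * u x) v = c * dirichlet u v"
proof -
  have "ip (along a (\<lambda>x. c * u x)) w = c * ip (along a u) w" for a w
    unfolding ip_scale[symmetric] by (rule ip_cong) (simp_all add: along_scale assms[unfolded One_nat_def])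
  then show ?thesis by (simp add: dirichlet_def algebra_simps)
qed

lemma dirichlet_taut:
  assumes "Ck_SU2 1 v"
  shows "dirichlet (taut_comp i) v = (2 + \<kappa>) * ip (taut_comp i) v"
proof -
  have "dirichlet (zbasis (s, 1, 0, 0, 0)) v = (2 + \<kappa>) * ip (zbasis (s, 1, 0, 0, 0)) v"
    "dirichlet (zbasis (s, 0, 1, 0, 0)) v = (2 + \<kappa>) * ip (zbasis (s, 0, 1, 0, 0)) v" for s
    using dirichlet_zbasis[OF assms, of s 1 0 0 0] dirichlet_zbasis[OF assms, of s 0 1 0 0]
    by (simp_all add: ip_scale del: zbasis.simps)
  then show ?thesis by (simp add: taut_comp_def del: zbasis.simps)
qed

text \<open>Bidegree (1, 1) has eigenvalue 8 for every \<kappa>. The monomials |z|^2 and |w|^2 have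
  the same constant remainder, which cancels in the third component.\<close>

lemma dirichlet_hopf:
  assumes v: "Ck_SU2 1 v"
  shows "dirichlet (hopf_comp i) v = 8 * ip (hopf_comp i) v"
proof -
  have vc: "continuous_on SU2 v" by (rule C1_continuous_on[OF v])
  have 1: "dirichlet (zbasis (s, 1, 0, 0, 1)) v = 8 * ip (zbasis (s, 1, 0, 0, 1)) v" for s
    using dirichlet_zbasis[OF v, of s 1 0 0 1] by (simp add: ip_scale del: zbasis.simps)
  have "dirichlet (zbasis (s, a, b, a, b)) v = 8 * ip (zbasis (s, a, b, a, b)) v + - 4 * ip (zbasis (s, 0, 0, 0, 0)) v"
    if "a = 1 \<and> b = 0 \<or> a = 0 \<and> b = 1" for s a b
  proof -
    have "dirichlet (zbasis (s, a, b, a, b)) v = ip (\<lambda>x. 8 * zbasis (s, a, b, a, b) x + - 4 * zbasis (s, 0, 0, 0, 0) x) v"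
      using that dirichlet_zbasis[OF v, of s a b a b] by (auto simp del: zbasis.simps)
    also have "\<dots> = 8 * ip (zbasis (s, a, b, a, b)) v + ip (\<lambda>x. - 4 * zbasis (s, 0, 0, 0, 0) x) v"
      by (rule ip_linear[OF continuous_on_zbasis continuous_on_mult_left[OF continuous_on_zbasis] vc])
    finally show ?thesis by (simp only: ip_scale)
  qed
  from this[of 1 0 True] this[of 0 1 True]
  have "dirichlet (\<lambda>x. - 1 * zbasis (True, 0, 1, 0, 1) x + zbasis (True, 1, 0, 1, 0) x) v =
      8 * ip (\<lambda>x. - 1 * zbasis (True, 0, 1, 0, 1) x + zbasis (True, 1, 0, 1, 0) x) v"
    by (simp only: dirichlet_linear[OF Ck_SU2_zbasis Ck_SU2_zbasis v] ip_linear[OF continuous_on_zbasis continuous_on_zbasis vc])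
       simp
  then show ?thesis
    using exhaust_3[of i] 1 by (elim disjE; simp only: hopf_comp_simps dirichlet_scale[OF Ck_SU2_zbasis] ip_scale)
qed

text \<open>The second hypothesis is the radius condition for R = 1; it holds for \<kappa> = 0 with
  any t and for t = 1 with any \<kappa>, which are the two uses below.\<close>

lemma eigenmap_taut:
  assumes "1 \<le> t" "2 + \<kappa> * t\<^sup>2 = 2 + \<kappa>"
  shows "eigenmap t \<kappa> taut_comp 1 1"
proof unfold_locales
  show "Ck_on k (taut_comp i) UNIV" for k i by (rule Ck_on_taut)
  show "dirichlet (taut_comp i) v = (2 + \<kappa>) * ip (taut_comp i) v" if "Ck_SU2 1 v" for i v by (rule dirichlet_taut[OF that])
  show "(\<Sum>i\<in>UNIV. along a (taut_comp i) x * along b (taut_comp i) x) = (if a = b then if a = 3 then 1 else 1 else 0)"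
    if "x \<in> SU2" for x a b by (simp add: gram_taut[OF that])
  show "(\<Sum>i\<in>UNIV. (taut_comp i x)\<^sup>2) = 1" if "x \<in> SU2" for x by (rule sum_taut[OF that])
  show "inj_on (\<lambda>x. \<chi> i. taut_comp i x) SU2"
    by (rule inj_onI, rule taut_inj) (auto simp: vec_eq_iff)
  show "bij_betw (\<lambda>n. of_nat (n + 1)) {..<CARD(4)} (UNIV :: 4 set)" by (rule enum_4)
qed (use assms in simp_all)

end

text \<open>The Hopf map onto the unit sphere pulls the metric back to \<open>4 (\<sigma>\<^sub>1\<^sup>2 + \<sigma>\<^sub>2\<^sup>2)\<close> and the tautological
  embedding to \<open>\<sigma>\<^sub>1\<^sup>2 + \<sigma>\<^sub>2\<^sup>2 + \<sigma>\<^sub>3\<^sup>2\<close>; the weights are chosen so that the sum is \<open>h\<^sub>t\<close>.\<close>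

definition full_comp :: "real \<Rightarrow> 7 \<Rightarrow> cmat2 \<Rightarrow> real" where
  "full_comp t i = (if i = 1 then (\<lambda>x. sqrt (1 - t\<^sup>2) / 2 * hopf_comp 1 x)
    else if i = 2 then (\<lambda>x. sqrt (1 - t\<^sup>2) / 2 * hopf_comp 2 x)
    else if i = 3 then (\<lambda>x. sqrt (1 - t\<^sup>2) / 2 * hopf_comp 3 x)
    else if i = 4 then (\<lambda>x. t * taut_comp 1 x)
    else if i = 5 then (\<lambda>x. t * taut_comp 2 x)
    else if i = 6 then (\<lambda>x. t * taut_comp 3 x)
    else (\<lambda>x. t * taut_comp 4 x))"

text \<open>With c^2 = (1 - t^2)/4 the pullback is 4 c^2 + t^2 = 1 along E_1 and E_2, and t^2 along
  E_3; the squared radius is c^2 + t^2 = (1 + 3 t^2)/4, and 8 times this is 2 + 6 t^2. Injectivity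
  comes from the tautological part, as t > 0; at t = 1 the Hopf part vanishes.\<close>

lemma eigenmap_full:
  assumes tt: "0 < t" "t \<le> 1"
  shows "eigenmap t 6 (full_comp t) (t\<^sup>2) ((1 + 3 * t\<^sup>2) / 4)"
proof -
  interpret berger_gap t 6 by unfold_locales (use tt in simp_all)
  have t2: "t\<^sup>2 \<le> 1" using tt by (simp add: power_le_one)
  then have c: "(sqrt (1 - t\<^sup>2) / 2)\<^sup>2 = (1 - t\<^sup>2) / 4" by (simp add: power_divide)
  define c where "c = sqrt (1 - t\<^sup>2) / 2"
  have c2: "4 * (c * c) = 1 - t * t" using c by (simp add: c_def power2_eq_square)
  have cases: "(\<exists>j. full_comp t i = (\<lambda>x. c * hopf_comp j x)) \<or> (\<exists>j. full_comp t i = (\<lambda>x. t * taut_comp j x))" for i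
    unfolding full_comp_def c_def[symmetric] by auto
  have split: "(\<Sum>i\<in>UNIV. F (full_comp t i)) =
      (\<Sum>j\<in>UNIV. F (\<lambda>x. c * hopf_comp j x)) + (\<Sum>j\<in>UNIV. F (\<lambda>x. t * taut_comp j x))" for F :: "(cmat2 \<Rightarrow> real) \<Rightarrow> real"
    by (simp add: sum_7 sum_3 sum_4 full_comp_def c_def)
  show ?thesis
  proof unfold_locales
    show "Ck_on k (full_comp t i) UNIV" for k i
      using cases[of i] by (elim disjE exE) (simp_all add: Ck_on_scale Ck_on_hopf Ck_on_taut)
    show "dirichlet (full_comp t i) v = (2 + 6) * ip (full_comp t i) v" if v: "Ck_SU2 1 v" for i v
      using cases[of i] dirichlet_hopf[OF v] dirichlet_taut[OF v]
      by (elim disjE exE) (simp_all add: dirichlet_scale[OF C1_hopf] dirichlet_scale[OF C1_taut] ip_scale)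
    show "(\<Sum>i\<in>UNIV. along a (full_comp t i) x * along b (full_comp t i) x) = (if a = b then if a = 3 then t\<^sup>2 else 1 else 0)"
      if x: "x \<in> SU2" for x a b
    proof -
      have "(\<Sum>i\<in>UNIV. along a (full_comp t i) x * along b (full_comp t i) x) =
          c * c * (\<Sum>j\<in>UNIV. along a (hopf_comp j) x * along b (hopf_comp j) x) +
          t * t * (\<Sum>j\<in>UNIV. along a (taut_comp j) x * along b (taut_comp j) x)"
        unfolding split[of "\<lambda>f. along a f x * along b f x"] along_scale[OF C1_hopf x] along_scale[OF C1_taut x] sum_distrib_left
        by (intro arg_cong2[of _ _ _ _ "(+)"] sum.cong refl) (simp_all add: algebra_simps)
      then show ?thesis
        using c2 by (simp add: gram_hopf[OF x] gram_taut[OF x] power2_eq_square)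
    qed
    show "(\<Sum>i\<in>UNIV. (full_comp t i x)\<^sup>2) = (1 + 3 * t\<^sup>2) / 4" if x: "x \<in> SU2" for x
      unfolding split[of "\<lambda>f. (f x)\<^sup>2"] power_mult_distrib sum_distrib_left[symmetric] sum_hopf[OF x] sum_taut[OF x]
      using c2 by (simp add: power2_eq_square field_simps)
    show "inj_on (\<lambda>x. \<chi> i. full_comp t i x) SU2"
    proof (rule inj_onI)
      fix x y assume xy: "x \<in> SU2" "y \<in> SU2" "(\<chi> i. full_comp t i x) = (\<chi> i. full_comp t i y)"
      then have eq: "full_comp t i x = full_comp t i y" for i by (simp add: vec_eq_iff)
      have "taut_comp i x = taut_comp i y" for i
        using exhaust_4[of i] eq[of 4] eq[of 5] eq[of 6] eq[of 7] tt by (auto simp: full_comp_def)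
      then show "x = y" using xy(1,2) by (rule taut_inj[rotated 2])
    qed
    show "bij_betw (\<lambda>n. of_nat (n + 1)) {..<CARD(7)} (UNIV :: 7 set)" by (rule enum_7)
  qed (use tt in simp_all)
qed

lemma phi0_eq: "\<phi>\<^sub>0 = (\<lambda>x. \<chi> i. taut_comp i x)"
  by (rule ext) (simp add: vec_eq_iff forall_4 \<phi>\<^sub>0_def vector_def taut_comp_def zmono_simps[unfolded One_nat_def])

theorem proposition3p3:
  shows
    "(\<forall>t::real. 0 < t \<and> t \<le> 1 \<longrightarrow>
        (\<exists>\<phi> :: cmat2 \<Rightarrow> real ^ 7.
           isometric_embedding (berger t) \<phi> \<and>
           by_first_eigenfunctions (volume_element (berger t)) (berger_dual (1 / sqrt 6)) \<phi> \<and>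
           inflated_map (volume_element (berger t)) (berger t) (l2_inclusion \<circ> \<phi>)) \<and>
        solves_eigenvalue_maximization (volume_element (berger t)) (berger t) (berger_dual (1 / sqrt 6)))
     \<and>
     (\<forall>t::real. 1 \<le> t \<longrightarrow>
        smooth_embedding \<phi>\<^sub>0 \<and>
        short_map (berger t) \<phi>\<^sub>0 \<and>
        by_first_eigenfunctions (volume_element (berger t)) berger_dual_inf \<phi>\<^sub>0 \<and>
        (\<forall>x\<in>SU2. contraction berger_dual_inf
           (\<lambda>y v w. berger t y v w - pullback \<phi>\<^sub>0 y v w) x = 0) \<and>
        inflated_map (volume_element (berger t)) (berger t) (l2_inclusion \<circ> \<phi>\<^sub>0) \<and>
        solves_eigenvalue_maximization (volume_element (berger t)) (berger t) berger_dual_inf)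
     \<and>
     (\<forall>s::real. 1 / sqrt 6 \<le> s \<longrightarrow>
        solves_eigenvalue_maximization (volume_element (berger 1)) (berger 1) (berger_dual s)) \<and>
     solves_eigenvalue_maximization (volume_element (berger 1)) (berger 1) berger_dual_inf"
proof -
  have dual: "berger_gap.diag (1 / s\<^sup>2) = berger_dual s" if "berger_gap t (1 / s\<^sup>2)" for s t
    by (rule ext) (simp add: berger_gap.diag_def[OF that] berger_dual_def)
  have dual_inf: "berger_gap.diag 0 = berger_dual_inf" if "berger_gap t 0" for t
    by (rule ext) (simp add: berger_gap.diag_def[OF that] berger_dual_inf_def)
  have 1: "(\<exists>\<phi> :: cmat2 \<Rightarrow> real ^ 7.
           isometric_embedding (berger t) \<phi> \<and>
           by_first_eigenfunctions (volume_element (berger t)) (berger_dual (1 / sqrt 6)) \<phi> \<and>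
           inflated_map (volume_element (berger t)) (berger t) (l2_inclusion \<circ> \<phi>)) \<and>
        solves_eigenvalue_maximization (volume_element (berger t)) (berger t) (berger_dual (1 / sqrt 6))"
    if t: "0 < t" "t \<le> 1" for t
  proof -
    interpret eigenmap t 6 "full_comp t" "t\<^sup>2" "(1 + 3 * t\<^sup>2) / 4" by (rule eigenmap_full[OF t])
    have "1 / (1 / sqrt 6)\<^sup>2 = (6 :: real)" by (simp add: power_divide)
    then have d: "diag = berger_dual (1 / sqrt 6)" using dual[of t "1 / sqrt 6"] berger_gap_axioms by simp
    show ?thesis
      using isometric_embedding_\<phi>[OF refl] by_first_eigenfunctions_\<phi> inflated_map_\<phi> solves_diag
      unfolding d by blast
  qed
  have 2: "smooth_embedding \<phi>\<^sub>0 \<and>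
        short_map (berger t) \<phi>\<^sub>0 \<and>
        by_first_eigenfunctions (volume_element (berger t)) berger_dual_inf \<phi>\<^sub>0 \<and>
        (\<forall>x\<in>SU2. contraction berger_dual_inf
           (\<lambda>y v w. berger t y v w - pullback \<phi>\<^sub>0 y v w) x = 0) \<and>
        inflated_map (volume_element (berger t)) (berger t) (l2_inclusion \<circ> \<phi>\<^sub>0) \<and>
        solves_eigenvalue_maximization (volume_element (berger t)) (berger t) berger_dual_inf"
    if t: "1 \<le> t" for t
  proof -
    have "berger_gap t 0" by unfold_locales (use t in simp_all)
    then interpret eigenmap t 0 taut_comp 1 1 by (rule berger_gap.eigenmap_taut) (use t in simp_all)
    have d: "diag = berger_dual_inf" by (rule dual_inf[OF berger_gap_axioms])
    have p: "\<phi>\<^sub>0 = \<phi>" by (rule ext) (simp add: phi0_eq \<phi>_def)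
    have "contraction diag (\<lambda>y v w. berger t y v w - pullback \<phi> y v w) x = 0" if x: "x \<in> SU2" for x
    proof -
      have "pullback \<phi> x (E a x) (E a x) = 1" if "a = 1 \<or> a = 2" for a
        unfolding pullback_\<phi>[OF x E_tangent[OF x] E_tangent[OF x]] using that
        by (auto simp: E_eq_frame[OF x] \<sigma>_frame[OF x])
      then show ?thesis by (simp add: contraction_diag berger_E[OF x])
    qed
    then show ?thesis
      using smooth_embedding_\<phi> short_map_\<phi> by_first_eigenfunctions_\<phi> inflated_map_\<phi> solves_diag
      unfolding p d by blast
  qed
  \<comment> \<open>At t = 1 the tautological embedding serves as eigenmap for every \<kappa> in
    [0, 6], and 1/sqrt 6 <= s amounts to 1/s^2 <= 6.\<close>
  have 3: "solves_eigenvalue_maximization (volume_element (berger 1)) (berger 1) (berger_dual s)"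
    if s: "1 / sqrt 6 \<le> s" for s
  proof -
    have pos: "0 < s" using s by (meson less_le_trans zero_less_divide_1_iff real_sqrt_gt_zero zero_less_numeral)
    have "(1 / sqrt 6)\<^sup>2 \<le> s\<^sup>2" using s by (intro power_mono) simp_all
    then have "1 / s\<^sup>2 \<le> 6" using pos by (simp add: power_divide field_simps)
    then have g: "berger_gap 1 (1 / s\<^sup>2)" by unfold_locales simp_all
    then interpret eigenmap 1 "1 / s\<^sup>2" taut_comp 1 1 by (rule berger_gap.eigenmap_taut) simp_all
    show ?thesis using solves_diag unfolding dual[OF g] .
  qed
  \<comment> \<open>The last conjunct, s = infinity, is the second part at t = 1.\<close>
  show ?thesis using 1 2 3 2[of 1] by blast
qed

end
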